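(* $\mathsf{P}\neq \mathrm{DAGR}(\mathsf{P})$ if and only if $\mathsf{P}\neq\mathsf{NP}$.
   Context: For a language $L\subseteq\Sigma^*$, $\mathrm{DAGREACH}(L)$ is the set of triples $(G,s,t)$ where $G$ is a directed acyclic graph with edges labelled by symbols of $\Sigma$ and $s,t$ are vertices, such that some path from $s$ to $t$ has yield (concatenation of edge labels in order) in $L$. For a complexity class $\mathcal{C}$, $\mathrm{DAGR}(\mathcal{C})=\{L : \mathrm{DAGREACH}(L)\in\mathcal{C}\}$. *)

theory Defs
  imports
    "HOL-Computational_Algebra.Polynomial"
    "Graph_Theory.Arc_Walk"
begin

section \<open>Deterministic multi-tape Turing machines\<close>

text \<open>
  Control states are \<open>0, ..., tm_states - 1\<close> and tape symbols are
  \<open>0, ..., tm_symbols - 1\<close>, where \<open>0\<close> is the blank; both sets are finite. The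
  transition function maps a state and the list of scanned symbols (one per tape) to
  a new state and, for each tape, the symbol to write and the head move.
\<close>

datatype move = Move_Left | Stay | Move_Right

record tm =
  tm_tapes :: nat
  tm_states :: nat
  tm_symbols :: nat
  tm_start :: nat
  tm_accept :: nat
  tm_reject :: nat
  tm_trans :: "nat \<Rightarrow> nat list \<Rightarrow> nat \<times> (nat \<times> move) list"

definition wf_tm :: "tm \<Rightarrow> bool" where
  "wf_tm M \<longleftrightarrow>
     0 < tm_tapes M \<and> 0 < tm_symbols M \<and>
     tm_start M < tm_states M \<and> tm_accept M < tm_states M \<and> tm_reject M < tm_states M \<and>
     tm_accept M \<noteq> tm_reject M \<and>
     (\<forall>q gs. q < tm_states M \<longrightarrow> length gs = tm_tapes M \<longrightarrow> set gs \<subseteq> {..<tm_symbols M} \<longrightarrow>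
        fst (tm_trans M q gs) < tm_states M \<and>
        length (snd (tm_trans M q gs)) = tm_tapes M \<and>
        fst ` set (snd (tm_trans M q gs)) \<subseteq> {..<tm_symbols M})"

text \<open>
  Tapes are infinite in both directions. A tape is given by its contents and the
  position of its head.
\<close>

type_synonym tape = "(int \<Rightarrow> nat) \<times> int"
type_synonym config = "nat \<times> tape list"

fun shift :: "move \<Rightarrow> int \<Rightarrow> int" where
  "shift Move_Left p = p - 1"
| "shift Stay p = p"
| "shift Move_Right p = p + 1"

fun act :: "nat \<times> move \<Rightarrow> tape \<Rightarrow> tape" where
  "act (g, m) (f, p) = (f(p := g), shift m p)"

fun step :: "tm \<Rightarrow> config \<Rightarrow> config" where
  "step M (q, ts) =
     (if q = tm_accept M \<or> q = tm_reject M then (q, ts)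
      else let (q', as) = tm_trans M q (map (\<lambda>(f, p). f p) ts)
           in (q', map2 act as ts))"

text \<open>
  The input symbol \<open>a\<close> is stored as the tape symbol \<open>Suc a\<close>, so that every natural
  number, including \<open>0\<close>, can be used as an input symbol.
\<close>

definition input_tape :: "nat list \<Rightarrow> tape" where
  "input_tape w = (\<lambda>i. if 0 \<le> i \<and> i < int (length w) then Suc (w ! nat i) else 0, 0)"

definition init :: "tm \<Rightarrow> nat list \<Rightarrow> config" where
  "init M w = (tm_start M, input_tape w # replicate (tm_tapes M - 1) (\<lambda>_. 0, 0))"

text \<open>
  Accepting and rejecting configurations are fixed points of \<open>step\<close>, hence being in
  such a configuration after exactly \<open>T (length w)\<close> steps means halting within
  \<open>T (length w)\<close> steps.
\<close>

definition decides_in_time :: "tm \<Rightarrow> nat set \<Rightarrow> nat list set \<Rightarrow> (nat \<Rightarrow> nat) \<Rightarrow> bool" where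
  "decides_in_time M \<Sigma> L T \<longleftrightarrow>
     wf_tm M \<and> (\<forall>a\<in>\<Sigma>. Suc a < tm_symbols M) \<and>
     (\<forall>w\<in>lists \<Sigma>.
        fst ((step M ^^ T (length w)) (init M w)) = (if w \<in> L then tm_accept M else tm_reject M))"


section \<open>The classes P and NP\<close>

text \<open>
  Languages are sets of words over some finite alphabet of natural numbers.
\<close>

definition class_P :: "nat list set set" where
  "class_P = {L. \<exists>\<Sigma> M (p :: nat poly).
     finite \<Sigma> \<and> L \<subseteq> lists \<Sigma> \<and> decides_in_time M \<Sigma> L (poly p)}"

text \<open>
  The shift by \<open>Suc\<close> reserves the symbol \<open>0\<close> as separator between the two components.
\<close>

definition pair_word :: "nat list \<Rightarrow> nat list \<Rightarrow> nat list" where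
  "pair_word x y = map Suc x @ [0] @ map Suc y"

text \<open>
  NP is defined by polynomial-time verifiers \<open>R\<close> and certificates \<open>y\<close> of polynomial
  length. Words of \<open>R\<close> are over a finite alphabet, so \<open>x\<close> and \<open>y\<close> are as well.
\<close>

definition class_NP :: "nat list set set" where
  "class_NP = {L. \<exists>R\<in>class_P. \<exists>p :: nat poly.
     L = {x. \<exists>y. length y \<le> poly p (length x) \<and> pair_word x y \<in> R}}"


section \<open>Reachability in labelled acyclic digraphs\<close>

text \<open>
  A labelled digraph is a digraph \<open>G\<close> (parallel arcs are allowed) together with a
  labelling \<open>lab\<close> of its arcs. Since \<open>G\<close> is acyclic, walks and paths coincide.
\<close>

type_synonym ('v, 'e, 'a) labelled_digraph = "('v, 'e) pre_digraph \<times> ('e \<Rightarrow> 'a)"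

definition is_labelled_dag :: "'a set \<Rightarrow> ('v, 'e, 'a) labelled_digraph \<Rightarrow> bool" where
  "is_labelled_dag \<Sigma> = (\<lambda>(G, lab).
     fin_digraph G \<and> acyclic (arcs_ends G) \<and> lab ` arcs G \<subseteq> \<Sigma>)"

definition DAGREACH ::
    "'a set \<Rightarrow> 'a list set \<Rightarrow> (('v, 'e, 'a) labelled_digraph \<times> 'v \<times> 'v) set" where
  "DAGREACH \<Sigma> L = {((G, lab), s, t).
     is_labelled_dag \<Sigma> (G, lab) \<and> s \<in> verts G \<and> t \<in> verts G \<and>
     (\<exists>p. pre_digraph.awalk G s p t \<and> map lab p \<in> L)}"

text \<open>
  Instances are written as words by listing the number \<open>n\<close> of vertices, \<open>s\<close>, \<open>t\<close> and
  then the labelled arcs in any order; vertices are \<open>0, ..., n - 1\<close>. All these numbers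
  are in unary (symbol \<open>1\<close>), \<open>0\<close> is a separator and the label \<open>a\<close> becomes the symbol
  \<open>a + 2\<close>. As \<open>n\<close> is the number of vertices, the length of the code is polynomially
  related to that of adjacency lists or matrices.
\<close>

definition instance_code :: "nat \<Rightarrow> nat \<Rightarrow> nat \<Rightarrow> (nat \<times> nat \<times> nat) list \<Rightarrow> nat list" where
  "instance_code n s t es =
     replicate n 1 @ [0] @ replicate s 1 @ [0] @ replicate t 1 @ [0] @
     concat (map (\<lambda>(u, a, v). replicate u 1 @ [a + 2] @ replicate v 1 @ [0]) es)"

definition encodes :: "nat list \<Rightarrow> (nat, nat, nat) labelled_digraph \<times> nat \<times> nat \<Rightarrow> bool" where
  "encodes w = (\<lambda>((G, lab), s, t).
     \<exists>n es. verts G = {..<n} \<and> set es = arcs G \<and> distinct es \<and>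
       w = instance_code n s t (map (\<lambda>e. (tail G e, lab e, head G e)) es))"

definition DAGREACH_lang :: "nat set \<Rightarrow> nat list set \<Rightarrow> nat list set" where
  "DAGREACH_lang \<Sigma> L = {w. \<exists>I\<in>DAGREACH \<Sigma> L. encodes w I}"

definition DAGR :: "nat list set set \<Rightarrow> nat list set set" where
  "DAGR \<C> = {L. \<exists>\<Sigma>. finite \<Sigma> \<and> L \<subseteq> lists \<Sigma> \<and> DAGREACH_lang \<Sigma> L \<in> \<C>}"

end

theory Submission
  imports Defs
begin

text \<open>
  \<open>DAGR(P)\<close> is contained in \<open>P\<close>, since a word lies in \<open>L\<close> iff the path graph that spells it is a
  positive instance of \<open>DAGREACH(L)\<close>. If \<open>P = NP\<close>, then \<open>P\<close> is contained in \<open>DAGR(P)\<close>, because for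
  \<open>L\<close> in \<open>P\<close> a walk together with a topological order of the graph is a certificate for
  \<open>DAGREACH(L)\<close>. Conversely, let \<open>R\<close> be a verifier with certificates of length at most \<open>p(n)\<close>. A layered
  acyclic graph computed from \<open>x\<close> has as yields from source to sink exactly the words
  \<open>pair_word x y\<close> with \<open>y\<close> of length at most \<open>p(n)\<close>. So if \<open>R\<close> is in \<open>DAGR(P)\<close>, then the language
  verified by \<open>R\<close> is in \<open>P\<close>.

  All machine constructions go through a small language of loop programs on stacks. A Turing machine
  runs such a program with one tape per stack, the head being on the top symbol, and its control
  state is the list of commands that remain to be executed. An input tape is then already a stack,
  and the decider of another language can be started on the output stack without any conversion.
\<close>

section \<open>Stack programs\<close>

text \<open>The obstacle is to bound running times without timing each program by hand. Nested loops
  can double a stack in every round, so a program text alone gives no polynomial bound. With all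
  loops capped at \<open>N\<close> rounds, the text determines a polynomial in \<open>N\<close> that
  bounds both the time and the growth of the stacks; for each program it remains to show that its
  run is defined for some \<open>N\<close> polynomial in the input length.
  \<open>class_P_preimage\<close> turns this into closure of \<open>P\<close> under reductions and
  is the only interface to machines in the four inclusions that need one. Handing the verifier a
  topological order replaces a search for cycles. Positions in that order also bound the length of
  every walk, hence of the certificate. In the converse direction the choice of a certificate
  becomes the choice of a walk. One sink has to serve all lengths up to \<open>p(n)\<close>, so the
  separator arc may enter the chain of letters at any point.\<close>

datatype com =
    Skip
  | Push nat nat
  | Pop nat
  | Seq com com  (infixr \<open>;;\<close> 60)
  | If nat "nat option \<Rightarrow> bool" com com
  | For nat "nat \<Rightarrow> com"

type_synonym state = "nat \<Rightarrow> nat list"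

definition top :: "nat list \<Rightarrow> nat option" where
  "top xs = (case xs of [] \<Rightarrow> None | x # _ \<Rightarrow> Some x)"

lemma top_simps [simp]: "top [] = None" "top (x # xs) = Some x"
  by (simp_all add: top_def)

primrec loop :: "(nat \<Rightarrow> state \<Rightarrow> state option) \<Rightarrow> nat \<Rightarrow> nat list \<Rightarrow> state \<Rightarrow> state option" where
  "loop g r [] s = Some s"
| "loop g r (a # xs) s = (case g a (s(r := xs)) of None \<Rightarrow> None
     | Some s' \<Rightarrow> if s' r = xs then loop g r xs s' else None)"

text \<open>
  \<open>For r B\<close> pops the symbols of \<open>r\<close> one by one. A run is undefined if a loop starts on more than
  \<open>N\<close> symbols or if the body of a loop changes the register that controls it; this makes the
  running time polynomial in \<open>N\<close> for every program.
\<close>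

primrec run :: "nat \<Rightarrow> com \<Rightarrow> state \<Rightarrow> state option" where
  "run N Skip s = Some s"
| "run N (Push r a) s = Some (s(r := a # s r))"
| "run N (Pop r) s = Some (s(r := tl (s r)))"
| "run N (c ;; d) s = (case run N c s of None \<Rightarrow> None | Some s' \<Rightarrow> run N d s')"
| "run N (If r P c d) s = (if P (top (s r)) then run N c s else run N d s)"
| "run N (For r B) s = (if length (s r) \<le> N then loop (\<lambda>a. run N (B a)) r (s r) s else None)"

primrec wf_com :: "nat \<Rightarrow> nat \<Rightarrow> com \<Rightarrow> bool" where
  "wf_com k K Skip \<longleftrightarrow> True"
| "wf_com k K (Push r a) \<longleftrightarrow> r < k \<and> a < K"
| "wf_com k K (Pop r) \<longleftrightarrow> r < k"
| "wf_com k K (c ;; d) \<longleftrightarrow> wf_com k K c \<and> wf_com k K d"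
| "wf_com k K (If r P c d) \<longleftrightarrow> r < k \<and> wf_com k K c \<and> wf_com k K d"
| "wf_com k K (For r B) \<longleftrightarrow> r < k \<and> (\<forall>a<K. wf_com k K (B a))"

text \<open>The indeterminate stands for the loop cap \<open>N\<close>. A push costs two machine
  steps. A round of a loop costs one step to pop plus a body, where the sum over all symbols
  dominates the maximum; the leading 1 of a loop pays for the last step, which finds the register
  empty.\<close>

primrec time_bound :: "nat \<Rightarrow> com \<Rightarrow> nat poly" where
  "time_bound K Skip = 1"
| "time_bound K (Push r a) = 2"
| "time_bound K (Pop r) = 1"
| "time_bound K (c ;; d) = 1 + time_bound K c + time_bound K d"
| "time_bound K (If r P c d) = 1 + time_bound K c + time_bound K d"
| "time_bound K (For r B) = 1 + [:0, 1:] * (1 + (\<Sum>a<K. time_bound K (B a)))"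

section \<open>Growth of the stacks during a run\<close>

lemma poly_nat_mono: "m \<le> n \<Longrightarrow> poly p m \<le> poly (p :: nat poly) n"
  by (induction p) (auto intro: add_mono mult_mono)


definition bounded :: "nat \<Rightarrow> state \<Rightarrow> bool" where
  "bounded K s \<longleftrightarrow> (\<forall>r. set (s r) \<subseteq> {..<K})"

lemma bounded_update: "bounded K s \<Longrightarrow> set xs \<subseteq> {..<K} \<Longrightarrow> bounded K (s(r := xs))"
  by (simp add: bounded_def)

lemma bounded_tl:
  assumes "bounded K s" "s r = x # xs"
  shows "bounded K (s(r := xs))" "x < K"
proof -
  have "set (x # xs) \<subseteq> {..<K}" using assms unfolding bounded_def by metis
  then show "bounded K (s(r := xs))" "x < K" using assms by (auto intro: bounded_update)
qed

text \<open>The last clause keeps registers from \<open>k\<close> on as they were. They become work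
  tapes of the simulated machine, which must start blank.\<close>

definition grows :: "nat \<Rightarrow> nat \<Rightarrow> nat \<Rightarrow> state \<Rightarrow> state \<Rightarrow> bool" where
  "grows k K b s s' \<longleftrightarrow> bounded K s' \<and> (\<forall>r. length (s' r) \<le> length (s r) + b) \<and> (\<forall>r\<ge>k. s' r = s r)"

lemma grows_trans:
  assumes "grows k K b1 s s1" "grows k K b2 s1 s2" "b1 + b2 \<le> b"
  shows "grows k K b s s2"
proof -
  have "length (s2 r) \<le> length (s r) + b" for r
  proof -
    have "length (s2 r) \<le> length (s1 r) + b2" "length (s1 r) \<le> length (s r) + b1"
      using assms(1,2) by (simp_all add: grows_def)
    then show ?thesis using assms(3) by linarith
  qed
  then show ?thesis using assms by (simp add: grows_def)
qed

lemma grows_mono: "grows k K b s s' \<Longrightarrow> b \<le> b' \<Longrightarrow> grows k K b' s s'"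
  by (rule grows_trans[of k K b s s' 0 s']) (simp_all add: grows_def)

text \<open>One unit of time pushes at most one symbol, so the time bound is also a growth bound.
  The loop case has an inner induction with a bound linear in the number of symbols still to be
  popped; the cap \<open>N\<close> enters only afterwards.\<close>

lemma run_grows:
  assumes "run N c s = Some s'" "wf_com k K c" "bounded K s"
  shows "grows k K (poly (time_bound K c) N) s s'"
  using assms
proof (induction c arbitrary: s s')
  case (Seq c d)
  then obtain s1 where s1: "run N c s = Some s1" "run N d s1 = Some s'"
    by (auto split: option.splits)
  have 1: "grows k K (poly (time_bound K c) N) s s1" using Seq s1 by simp
  moreover have "bounded K s1" using 1 by (simp add: grows_def)
  then have "grows k K (poly (time_bound K d) N) s1 s'" using Seq s1 by simp
  ultimately show ?case by (rule grows_trans) simp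
next
  case (If r P c d)
  show ?case
  proof (cases "P (top (s r))")
    case True
    then have "grows k K (poly (time_bound K c) N) s s'" using If by simp
    then show ?thesis by (rule grows_mono) simp
  next
    case False
    then have "grows k K (poly (time_bound K d) N) s s'" using If by simp
    then show ?thesis by (rule grows_mono) simp
  qed
next
  case (For r B)
  let ?q = "1 + (\<Sum>a<K. poly (time_bound K (B a)) N)"
  have *: "grows k K (length xs * ?q) s s'"
    if "loop (\<lambda>a. run N (B a)) r xs s = Some s'" "s r = xs" "bounded K s" for xs s
    using that
  proof (induction xs arbitrary: s)
    case Nil
    then show ?case by (simp add: grows_def)
  next
    case (Cons a xs)
    have a: "a < K" and bnd: "bounded K (s(r := xs))"
      using bounded_tl[OF Cons.prems(3,2)] by auto
    obtain s1 where s1: "run N (B a) (s(r := xs)) = Some s1" "s1 r = xs"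
      "loop (\<lambda>a. run N (B a)) r xs s1 = Some s'"
      using Cons.prems by (auto split: option.splits if_splits)
    have "grows k K 0 s (s(r := xs))" using Cons.prems(2) For.prems(2) bnd by (simp add: grows_def)
    moreover have 1: "grows k K (poly (time_bound K (B a)) N) (s(r := xs)) s1"
      using For.prems(2) a by (intro For.IH[OF _ s1(1) _ bnd]) auto
    ultimately have "grows k K (poly (time_bound K (B a)) N) s s1" by (rule grows_trans) simp
    then show ?case
    proof (rule grows_trans)
      show "grows k K (length xs * ?q) s1 s'"
        using 1 by (intro Cons.IH s1) (simp add: grows_def)
      have "poly (time_bound K (B a)) N \<le> (\<Sum>a<K. poly (time_bound K (B a)) N)"
        using a by (intro member_le_sum) auto
      then show "poly (time_bound K (B a)) N + length xs * ?q \<le> length (a # xs) * ?q" by simp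
    qed
  qed
  have "grows k K (length (s r) * ?q) s s'"
    using For.prems by (intro *) (auto split: if_splits)
  moreover have "length (s r) \<le> N" using For.prems by (auto split: if_splits)
  ultimately show ?case
    by (elim grows_mono) (simp add: poly_sum trans_le_add2 add_mono mult_right_mono le_SucI)
next
  case (Pop r)
  then show ?case by (cases "s r") (auto simp: grows_def intro: bounded_tl bounded_update)
qed (auto simp: grows_def bounded_def)

lemma loop_mono:
  assumes "\<And>a s s'. g a s = Some s' \<Longrightarrow> g' a s = Some s'" "loop g r xs s = Some s'"
  shows "loop g' r xs s = Some s'"
  using assms(2)
proof (induction xs arbitrary: s)
  case (Cons a xs)
  then obtain s1 where "g a (s(r := xs)) = Some s1" "s1 r = xs" "loop g r xs s1 = Some s'"
    by (auto split: option.splits if_splits)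
  then show ?case using Cons.IH assms(1) by simp
qed simp

text \<open>\<open>N\<close> enters a run only as the cap on loops. Hence programs analysed with
  different caps can be joined under the larger one.\<close>

lemma run_mono:
  assumes "run N c s = Some s'" "N \<le> N'"
  shows "run N' c s = Some s'"
  using assms(1)
proof (induction c arbitrary: s s')
  case (For r B)
  then show ?case using assms(2)
    by (auto split: if_splits intro: loop_mono[where g = "\<lambda>a. run N (B a)"])
qed (auto split: option.splits if_splits)

lemma loop_prefixes:
  assumes "\<And>ys a zs. xs = ys @ a # zs \<Longrightarrow> g a ((S ys)(r := zs)) = Some ((S (ys @ [a]))(r := zs))"
  shows "xs = ys @ zs \<Longrightarrow> loop g r zs ((S ys)(r := zs)) = Some ((S xs)(r := []))"
proof (induction zs arbitrary: ys)
  case (Cons a zs)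
  then show ?case using assms[of ys a zs] Cons.IH[of "ys @ [a]"] by (simp add: fun_upd_same del: fun_upd_apply)
qed simp

text \<open>\<open>S ys\<close> is the state after the loop has processed the prefix \<open>ys\<close>.\<close>

lemma run_For:
  assumes "length (s r) \<le> N" "S [] = s"
    and "\<And>ys a zs. s r = ys @ a # zs \<Longrightarrow> run N (B a) ((S ys)(r := zs)) = Some ((S (ys @ [a]))(r := zs))"
    and "s' = (S (s r))(r := [])"
  shows "run N (For r B) s = Some s'"
proof -
  have "loop (\<lambda>a. run N (B a)) r (s r) ((S [])(r := s r)) = Some ((S (s r))(r := []))"
    using assms(3) by (rule loop_prefixes) simp_all
  then show ?thesis using assms(1,2,4) by simp
qed

lemma run_move:
  "r \<noteq> d \<Longrightarrow> length (s r) \<le> N \<Longrightarrow>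
    run N (For r (Push d)) s = Some (s(r := [], d := rev (s r) @ s d))"
  by (rule run_For[where S = "\<lambda>ys. s(d := rev ys @ s d)"]) (auto simp: fun_eq_iff)


section \<open>Running a stack program before a Turing machine\<close>

text \<open>A machine step writes before it moves, so a push takes two steps: move left, then write.
  \<open>Put\<close> is the state in between; \<open>Sim\<close> carries a state of the decider that
  is started afterwards.\<close>

datatype ctl = Run "com list" | Put nat nat "com list" | Sim nat

text \<open>The control states that occur while \<open>c\<close> is executed with the commands \<open>cs\<close> to follow.\<close>

primrec conts :: "nat \<Rightarrow> com \<Rightarrow> com list \<Rightarrow> ctl set" where
  "conts K Skip cs = {Run (Skip # cs)}"
| "conts K (Push r a) cs = {Run (Push r a # cs), Put r a cs}"
| "conts K (Pop r) cs = {Run (Pop r # cs)}"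
| "conts K (c ;; d) cs = {Run ((c ;; d) # cs)} \<union> conts K c (d # cs) \<union> conts K d cs"
| "conts K (If r P c d) cs = {Run (If r P c d # cs)} \<union> conts K c cs \<union> conts K d cs"
| "conts K (For r B) cs = {Run (For r B # cs)} \<union> (\<Union>a<K. conts K (B a) (For r B # cs))"

text \<open>A loop puts itself back below its body instead of being unrolled, so command lists do
  not grow with the number of rounds. This is why they can serve as a finite control.\<close>

lemma finite_conts: "finite (conts K c cs)"
  by (induction c arbitrary: cs) auto

lemma Run_in_conts: "Run (c # cs) \<in> conts K c cs"
  by (cases c) auto

section \<open>Stacks on tapes\<close>

definition keep :: "nat list \<Rightarrow> (nat \<times> move) list" where
  "keep gs = map (\<lambda>g. (g, Stay)) gs"

definition scan :: "tape list \<Rightarrow> nat list" where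
  "scan ts = map (\<lambda>(f, p). f p) ts"

lemma length_keep [simp]: "length (keep gs) = length gs"
  by (simp add: keep_def)

lemma length_scan [simp]: "length (scan ts) = length ts"
  by (simp add: scan_def)

lemma fst_set_keep [simp]: "fst ` set (keep gs) = set gs"
  by (force simp: keep_def)

lemma map2_act_keep: "map2 act (keep (scan ts)) ts = ts"
  by (induction ts) (auto simp: keep_def scan_def)

lemma map2_act_keep_update:
  "r < length ts \<Longrightarrow> map2 act ((keep (scan ts))[r := am]) ts = ts[r := act am (ts ! r)]"
  by (rule nth_equalityI)
     (auto simp: nth_list_update keep_def scan_def split: prod.splits)

text \<open>The condition covers all integers \<open>i\<close>, so cells to the left of the head are
  blank as well. A pop therefore erases the symbol it leaves behind, and in return the tape is an
  input tape up to translation.\<close>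

definition srep :: "nat list \<Rightarrow> tape \<Rightarrow> bool" where
  "srep xs T \<longleftrightarrow> (\<forall>i. fst T (snd T + i) = fst (input_tape xs) i)"

lemma fst_input_tape: "fst (input_tape xs) i = (if 0 \<le> i \<and> i < int (length xs) then Suc (xs ! nat i) else 0)"
  by (simp add: input_tape_def)

lemma srep_scan: "srep xs (f, p) \<Longrightarrow> f p = (case xs of [] \<Rightarrow> 0 | x # _ \<Rightarrow> Suc x)"
  unfolding srep_def by (drule spec[of _ 0]) (auto simp: fst_input_tape split: list.splits)

lemma srep_pop:
  assumes "srep (x # xs) T" shows "srep xs (act (0, Move_Right) T)"
proof -
  obtain f p where T: "T = (f, p)" by (cases T)
  have *: "f (p + i) = fst (input_tape (x # xs)) i" for i
    using assms by (auto simp: srep_def T)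
  have "(f(p := 0)) (p + 1 + i) = fst (input_tape xs) i" for i
    using *[of "1 + i"] by (auto simp: fst_input_tape nth_Cons' nat_add_distrib add.assoc nat_eq_iff
        nat_diff_distrib' split: if_splits)
  then show ?thesis by (auto simp: srep_def T)
qed

lemma srep_push:
  assumes "srep xs T" "act (g, Move_Left) T = T'" "g = fst T (snd T)"
  shows "srep (a # xs) (act (Suc a, Stay) T')"
proof -
  obtain f p where T: "T = (f, p)" by (cases T)
  have *: "f (p + i) = fst (input_tape xs) i" for i
    using assms by (auto simp: srep_def T)
  have T': "T' = (f, p - 1)" using assms(2,3) by (auto simp: T)
  have "(f(p - 1 := Suc a)) (p - 1 + i) = fst (input_tape (a # xs)) i" for i
    using *[of "i - 1"] by (auto simp: fst_input_tape nth_Cons' algebra_simps nat_diff_distrib' split: if_splits)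
  then show ?thesis by (auto simp: srep_def T')
qed

text \<open>
  Results outside of the finite sets of states and symbols are replaced, so that \<open>wf_tm\<close> holds
  without any invariant on configurations.
\<close>

definition safe_trans ::
  "ctl set \<Rightarrow> nat \<Rightarrow> (ctl \<Rightarrow> nat) \<Rightarrow> (ctl \<Rightarrow> nat list \<Rightarrow> ctl \<times> (nat \<times> move) list) \<Rightarrow>
    nat \<Rightarrow> nat list \<Rightarrow> nat \<times> (nat \<times> move) list" where
  "safe_trans S K h d q gs = (let (c, as) = d (inv_into S h q) gs in
     if c \<in> S \<and> length as = length gs \<and> (set gs \<subseteq> {..<K} \<longrightarrow> fst ` set as \<subseteq> {..<K})
     then (h c, as) else (0, keep gs))"

text \<open>
  After the program, a nonempty register \<open>1\<close> means rejection. Otherwise \<open>M\<close> is started with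
  register \<open>out\<close> as its input tape and the following, still blank, tapes as work tapes.
\<close>

fun ctl_step :: "nat \<Rightarrow> tm \<Rightarrow> ctl \<Rightarrow> nat list \<Rightarrow> ctl \<times> (nat \<times> move) list" where
  "ctl_step out M (Run []) gs = (Sim (if gs ! 1 = 0 then tm_start M else tm_reject M), keep gs)"
| "ctl_step out M (Run (Skip # cs)) gs = (Run cs, keep gs)"
| "ctl_step out M (Run (Push r a # cs)) gs = (Put r a cs, (keep gs)[r := (gs ! r, Move_Left)])"
| "ctl_step out M (Put r a cs) gs = (Run cs, (keep gs)[r := (Suc a, Stay)])"
| "ctl_step out M (Run (Pop r # cs)) gs =
     (Run cs, if gs ! r = 0 then keep gs else (keep gs)[r := (0, Move_Right)])"
| "ctl_step out M (Run ((c ;; d) # cs)) gs = (Run (c # d # cs), keep gs)"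
| "ctl_step out M (Run (If r P c d # cs)) gs =
     (Run ((if P (if gs ! r = 0 then None else Some (gs ! r - 1)) then c else d) # cs), keep gs)"
| "ctl_step out M (Run (For r B # cs)) gs =
     (if gs ! r = 0 then (Run cs, keep gs)
      else (Run (B (gs ! r - 1) # For r B # cs), (keep gs)[r := (0, Move_Right)]))"
| "ctl_step out M (Sim q) gs =
     (let (q', as) = tm_trans M q (drop out gs) in (Sim q', keep (take out gs) @ as))"

section \<open>The compiled machine and its correctness\<close>

locale compiled =
  fixes c0 :: com and out K :: nat and M :: tm
  assumes wf_M: "wf_tm M" and out_pos: "0 < out"
begin

definition S :: "ctl set" where
  "S = conts K c0 [] \<union> {Run []} \<union> Sim ` {..<tm_states M}"

lemma finite_S: "finite S"
  by (auto simp: S_def finite_conts)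

definition h :: "ctl \<Rightarrow> nat" where
  "h = (SOME h. bij_betw h S {0..<card S})"

lemma bij_h: "bij_betw h S {0..<card S}"
  using someI_ex[OF ex_bij_betw_finite_nat[OF finite_S]] by (simp add: h_def)

lemma h_less: "c \<in> S \<Longrightarrow> h c < card S"
  using bij_h by (auto simp: bij_betw_def)

lemma h_inj: "c \<in> S \<Longrightarrow> d \<in> S \<Longrightarrow> h c = h d \<longleftrightarrow> c = d"
  using bij_h by (auto simp: bij_betw_def inj_on_def)

lemma inv_h: "c \<in> S \<Longrightarrow> inv_into S h (h c) = c"
  using bij_h by (auto simp: bij_betw_def)

lemma Sim_in_S: "Sim q \<in> S \<longleftrightarrow> q < tm_states M"
proof -
  have "Sim q \<notin> conts K c cs" for c cs by (induction c arbitrary: cs) auto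
  then show ?thesis by (auto simp: S_def)
qed

lemma M_states: "tm_start M < tm_states M" "tm_accept M < tm_states M" "tm_reject M < tm_states M"
  "tm_accept M \<noteq> tm_reject M" "0 < tm_tapes M" "0 < tm_symbols M"
  using wf_M by (auto simp: wf_tm_def)

text \<open>\<open>Suc K\<close> because the program symbol \<open>a\<close> is stored as
  \<open>Suc a\<close>.\<close>

definition syms :: nat where "syms = max (Suc K) (tm_symbols M)"

text \<open>Tape \<open>out\<close> is shared: it is the output register of the program and the
  input tape of \<open>M\<close>. The tapes behind it are the work tapes of
  \<open>M\<close>.\<close>

definition M' :: tm where
  "M' = \<lparr>tm_tapes = out + tm_tapes M, tm_states = card S, tm_symbols = syms,
     tm_start = h (Run [c0]), tm_accept = h (Sim (tm_accept M)), tm_reject = h (Sim (tm_reject M)),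
     tm_trans = safe_trans S syms h (ctl_step out M)\<rparr>"

lemma Run_c0_in_S: "Run [c0] \<in> S"
  by (simp add: S_def Run_in_conts)

lemma card_S_pos: "0 < card S"
  using Run_c0_in_S finite_S by (auto simp: card_gt_0_iff)

lemma safe_trans_wf:
  assumes "safe_trans S n h d q gs = (q', as)"
  shows "q' < card S" "length as = length gs" "set gs \<subseteq> {..<n} \<Longrightarrow> fst ` set as \<subseteq> {..<n}"
  using assms card_S_pos
  by (auto simp: safe_trans_def Let_def h_less keep_def split: prod.splits if_splits)

lemma wf_M': "wf_tm M'"
proof -
  have "fst (tm_trans M' q gs) < card S \<and> length (snd (tm_trans M' q gs)) = length gs \<and>
      (set gs \<subseteq> {..<syms} \<longrightarrow> fst ` set (snd (tm_trans M' q gs)) \<subseteq> {..<syms})" for q gs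
    using safe_trans_wf[of syms "ctl_step out M" q gs "fst (tm_trans M' q gs)" "snd (tm_trans M' q gs)"]
    by (simp add: M'_def)
  moreover have "0 < syms" by (simp add: syms_def)
  ultimately show ?thesis
    using M_states card_S_pos Run_c0_in_S
    by (simp add: wf_tm_def M'_def h_less Sim_in_S h_inj)
qed

lemma step_ctl:
  assumes "c \<in> S" "c \<noteq> Sim (tm_accept M)" "c \<noteq> Sim (tm_reject M)"
    and "ctl_step out M c (scan ts) = (c', as)" "c' \<in> S" "length as = length ts"
    and "set (scan ts) \<subseteq> {..<syms} \<Longrightarrow> fst ` set as \<subseteq> {..<syms}"
  shows "step M' (h c, ts) = (h c', map2 act as ts)"
proof -
  have "tm_trans M' (h c) (scan ts) = (h c', as)"
    using assms by (simp add: M'_def safe_trans_def inv_h)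
  moreover have "h c \<noteq> tm_accept M'" "h c \<noteq> tm_reject M'"
    using assms(1-3) M_states by (simp_all add: M'_def h_inj Sim_in_S)
  ultimately show ?thesis
    by (simp add: scan_def)
qed

definition rep :: "state \<Rightarrow> tape list \<Rightarrow> bool" where
  "rep s ts \<longleftrightarrow> length ts = out + tm_tapes M \<and> (\<forall>r<length ts. srep (s r) (ts ! r))"

lemma rep_scan:
  assumes "rep s ts" "r < length ts"
  shows "scan ts ! r = (case s r of [] \<Rightarrow> 0 | x # _ \<Rightarrow> Suc x)"
proof -
  obtain f p where "ts ! r = (f, p)" by (cases "ts ! r")
  then show ?thesis using assms srep_scan[of "s r" f p] by (auto simp: rep_def scan_def)
qed

lemma rep_scan_eq_0:
  assumes "rep s ts" "r < length ts"
  shows "scan ts ! r = 0 \<longleftrightarrow> s r = []"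
  using rep_scan[OF assms] by (auto split: list.splits)

lemma rep_top:
  assumes "rep s ts" "r < length ts"
  shows "(if scan ts ! r = 0 then None else Some (scan ts ! r - 1)) = top (s r)"
  using rep_scan[OF assms] by (auto simp: top_def split: list.splits)

lemma rep_update:
  assumes "rep s ts" "srep xs T"
  shows "rep (s(r := xs)) (ts[r := T])"
  using assms by (auto simp: rep_def nth_list_update)

lemma rep_pop:
  assumes "rep s ts" "s r = x # xs" "r < length ts"
  shows "rep (s(r := xs)) (ts[r := act (0, Move_Right) (ts ! r)])"
proof (rule rep_update[OF assms(1)])
  have "srep (x # xs) (ts ! r)" using assms unfolding rep_def by metis
  then show "srep xs (act (0, Move_Right) (ts ! r))" by (rule srep_pop)
qed

lemma rep_length: "rep s ts \<Longrightarrow> r < Suc out \<Longrightarrow> r < length ts"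
  using M_states unfolding rep_def by linarith

lemma set_list_update_keep:
  "set gs \<subseteq> {..<n} \<Longrightarrow> g < n \<Longrightarrow> fst ` set ((keep gs)[r := (g, m)]) \<subseteq> {..<n}"
proof -
  assume "set gs \<subseteq> {..<n}" "g < n"
  have "fst ` set ((keep gs)[r := (g, m)]) \<subseteq> fst ` insert (g, m) (set (keep gs))"
    by (intro image_mono set_update_subset_insert)
  also have "\<dots> = insert g (set gs)" by (simp add: image_insert)
  finally show ?thesis using \<open>set gs \<subseteq> {..<n}\<close> \<open>g < n\<close> by auto
qed

lemma step_keep:
  assumes "c \<in> S" "c \<noteq> Sim (tm_accept M)" "c \<noteq> Sim (tm_reject M)"
    and "ctl_step out M c (scan ts) = (c', keep (scan ts))" "c' \<in> S"
  shows "step M' (h c, ts) = (h c', ts)"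
  using step_ctl[OF assms(1-5)] by (simp add: map2_act_keep)

lemma step_upd:
  assumes "c \<in> S" "c \<noteq> Sim (tm_accept M)" "c \<noteq> Sim (tm_reject M)"
    and "ctl_step out M c (scan ts) = (c', (keep (scan ts))[r := (g, m)])" "c' \<in> S"
    and "r < length ts" "g < syms \<or> g = scan ts ! r"
  shows "step M' (h c, ts) = (h c', ts[r := act (g, m) (ts ! r)])"
proof -
  have "step M' (h c, ts) = (h c', map2 act ((keep (scan ts))[r := (g, m)]) ts)"
  proof (rule step_ctl[OF assms(1-5)])
    assume *: "set (scan ts) \<subseteq> {..<syms}"
    then have "g < syms" using assms(6,7) by (metis length_scan lessThan_iff nth_mem subsetD)
    with * show "fst ` set ((keep (scan ts))[r := (g, m)]) \<subseteq> {..<syms}"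
      by (rule set_list_update_keep)
  qed simp
  then show ?thesis using assms(6) by (simp add: map2_act_keep_update)
qed

definition reach :: "nat \<Rightarrow> ctl \<Rightarrow> tape list \<Rightarrow> ctl \<Rightarrow> tape list \<Rightarrow> bool" where
  "reach t c ts c' ts' \<longleftrightarrow> (step M' ^^ t) (h c, ts) = (h c', ts')"

lemma reach_step: "step M' (h c, ts) = (h c', ts') \<Longrightarrow> reach 1 c ts c' ts'"
  by (simp add: reach_def)

lemma reach_keep:
  assumes "Run cs \<in> S" "ctl_step out M (Run cs) (scan ts) = (c', keep (scan ts))" "c' \<in> S"
  shows "reach 1 (Run cs) ts c' ts"
  using assms by (intro reach_step step_keep) simp_all

lemma reach_upd:
  assumes "c \<in> S" "c \<noteq> Sim (tm_accept M)" "c \<noteq> Sim (tm_reject M)"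
    and "ctl_step out M c (scan ts) = (c', (keep (scan ts))[r := (g, m)])" "c' \<in> S"
    and "r < length ts" "g < syms \<or> g = scan ts ! r"
  shows "reach 1 c ts c' (ts[r := act (g, m) (ts ! r)])"
  using step_upd[OF assms] by (rule reach_step)

lemma reach_trans:
  "reach t1 c ts c' ts' \<Longrightarrow> reach t2 c' ts' c'' ts'' \<Longrightarrow> reach (t1 + t2) c ts c'' ts''"
  unfolding reach_def by (subst add.commute) (simp add: funpow_add)

definition sim :: "nat \<Rightarrow> com list \<Rightarrow> tape list \<Rightarrow> com list \<Rightarrow> state \<Rightarrow> bool" where
  "sim b cs ts cs' s' \<longleftrightarrow> (\<exists>t ts'. t \<le> b \<and> reach t (Run cs) ts (Run cs') ts' \<and> rep s' ts')"

lemma simI: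
  "t \<le> b \<Longrightarrow> reach t (Run cs) ts (Run cs') ts' \<Longrightarrow> rep s' ts' \<Longrightarrow> sim b cs ts cs' s'"
  by (auto simp: sim_def)

lemma sim_keep:
  assumes "Run cs \<in> S" "ctl_step out M (Run cs) (scan ts) = (Run cs', keep (scan ts))" "Run cs' \<in> S"
    and "rep s ts" "1 \<le> b"
  shows "sim b cs ts cs' s"
  using assms reach_keep[OF assms(1-3)] by (intro simI) auto

lemma sim_trans:
  assumes "sim b1 cs ts cs' s'"
    and "\<And>ts'. rep s' ts' \<Longrightarrow> sim b2 cs' ts' cs'' s''"
    and "b1 + b2 \<le> b"
  shows "sim b cs ts cs'' s''"
proof -
  from assms(1) obtain t1 ts' where 1: "t1 \<le> b1" "reach t1 (Run cs) ts (Run cs') ts'" "rep s' ts'"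
    by (auto simp: sim_def)
  from assms(2)[OF 1(3)] obtain t2 ts'' where 2: "t2 \<le> b2" "reach t2 (Run cs') ts' (Run cs'') ts''"
    "rep s'' ts''" by (auto simp: sim_def)
  show ?thesis using 1(1) 2(1,3) assms(3) reach_trans[OF 1(2) 2(2)]
    by (intro simI[of "t1 + t2"]) auto
qed

lemma sim_mono: "sim b cs ts cs' s' \<Longrightarrow> b \<le> b' \<Longrightarrow> sim b' cs ts cs' s'"
  unfolding sim_def by (meson le_trans)

text \<open>The commands \<open>cs\<close> to follow are arbitrary, since sequences and loops run
  their parts with more commands pending. After each loop body the control is back in the same
  state, and the check in \<open>loop\<close> guarantees that the register holds exactly the
  remaining symbols; this drives the inner induction.\<close>

lemma sim_run:
  assumes "run N c s = Some s'" "wf_com (Suc out) K c" "bounded K s" "rep s ts"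
    "conts K c cs \<subseteq> S" "Run cs \<in> S"
  shows "sim (poly (time_bound K c) N) (c # cs) ts cs s'"
  using assms
proof (induction c arbitrary: s s' ts cs)
  case Skip
  then show ?case
    by (auto intro!: sim_keep)
next
  case (Push r a)
  let ?T = "act (scan ts ! r, Move_Left) (ts ! r)"
  have len: "r < length ts" by (rule rep_length[OF Push.prems(4)]) (use Push.prems(2) in simp)
  have "reach 1 (Run (Push r a # cs)) ts (Put r a cs) (ts[r := ?T])"
    using Push.prems len by (intro reach_upd) auto
  moreover have "reach 1 (Put r a cs) (ts[r := ?T]) (Run cs) (ts[r := ?T, r := act (Suc a, Stay) (ts[r := ?T] ! r)])"
    using Push.prems len by (intro reach_upd) (auto simp: syms_def)
  ultimately have "reach 2 (Run (Push r a # cs)) ts (Run cs) (ts[r := act (Suc a, Stay) ?T])"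
    using reach_trans[of 1 _ _ _ _ 1] len by (simp add: numeral_2_eq_2 del: act.simps)
  moreover have "rep s' (ts[r := act (Suc a, Stay) ?T])"
  proof -
    have "srep (s r) (ts ! r)" using Push.prems len by (simp add: rep_def)
    then have "srep (a # s r) (act (Suc a, Stay) ?T)"
      using len by (intro srep_push[OF _ refl]) (auto simp: scan_def split: prod.splits)
    then show ?thesis using Push.prems by (auto intro!: rep_update)
  qed
  ultimately show ?case
    by (intro simI[of 2]) auto
next
  case (Pop r)
  have len: "r < length ts" by (rule rep_length[OF Pop.prems(4)]) (use Pop.prems(2) in simp)
  show ?case
  proof (cases "s r")
    case Nil
    then have "s' = s" using Pop.prems by auto
    moreover have "reach 1 (Run (Pop r # cs)) ts (Run cs) ts"
      using Pop.prems len Nil by (intro reach_keep) (auto simp: rep_scan_eq_0)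
    ultimately show ?thesis using Pop.prems by (intro simI[of 1]) auto
  next
    case (Cons x xs)
    then have s': "s' = s(r := xs)" using Pop.prems by auto
    have "reach 1 (Run (Pop r # cs)) ts (Run cs) (ts[r := act (0, Move_Right) (ts ! r)])"
      using Pop.prems len Cons by (intro reach_upd) (auto simp: rep_scan_eq_0 syms_def)
    moreover have "rep s' (ts[r := act (0, Move_Right) (ts ! r)])"
      unfolding s' using Pop.prems Cons len by (intro rep_pop)
    ultimately show ?thesis by (intro simI[of 1]) simp_all
  qed
next
  case (Seq c d)
  obtain s1 where s1: "run N c s = Some s1" "run N d s1 = Some s'"
    using Seq.prems by (auto split: option.splits)
  have bnd: "bounded K s1" using run_grows[OF s1(1), of "Suc out" K] Seq.prems by (simp add: grows_def)
  have d_in: "Run (d # cs) \<in> S" using Seq.prems Run_in_conts[of d cs K] by auto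
  have "Run (c # d # cs) \<in> S" using Seq.prems Run_in_conts[of c "d # cs" K] by auto
  then have "sim 1 ((c ;; d) # cs) ts (c # d # cs) s"
    using Seq.prems by (intro sim_keep) auto
  then have "sim (1 + poly (time_bound K c) N) ((c ;; d) # cs) ts (d # cs) s1"
    by (rule sim_trans[OF _ _ order_refl]) (use Seq.prems d_in s1 in \<open>auto intro: Seq.IH(1)\<close>)
  then show ?case
    by (rule sim_trans) (use Seq.prems bnd s1 in \<open>auto intro: Seq.IH(2)\<close>)
next
  case (If r P c d)
  have len: "r < length ts" by (rule rep_length[OF If.prems(4)]) (use If.prems(2) in simp)
  have "sim 1 (If r P c d # cs) ts ((if P (top (s r)) then c else d) # cs) s"
    using If.prems len Run_in_conts[of d cs K] Run_in_conts[of c cs K]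
    by (intro sim_keep) (auto simp: rep_top simp del: if_split)
  then show ?case
  proof (rule sim_trans)
    fix ts' assume ts': "rep s ts'"
    show "sim (poly (time_bound K (if P (top (s r)) then c else d)) N)
      ((if P (top (s r)) then c else d) # cs) ts' cs s'"
    proof (cases "P (top (s r))")
      case True
      then show ?thesis using If.prems ts' by (auto intro!: If.IH(1))
    next
      case False
      then show ?thesis using If.prems ts' by (auto intro!: If.IH(2))
    qed
  qed auto
next
  case (For r B)
  let ?q = "1 + (\<Sum>a<K. poly (time_bound K (B a)) N)"
  have For_in: "Run (For r B # cs) \<in> S" using For.prems by auto
  have *: "sim (1 + length xs * ?q) (For r B # cs) ts cs s'"
    if "loop (\<lambda>a. run N (B a)) r xs s = Some s'" "s r = xs" "bounded K s" "rep s ts" for xs s ts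
    using that
  proof (induction xs arbitrary: s ts)
    case Nil
    have len: "r < length ts" by (rule rep_length[OF Nil.prems(4)]) (use For.prems(2) in simp)
    have "reach 1 (Run (For r B # cs)) ts (Run cs) ts"
      using For.prems Nil.prems len For_in by (intro reach_keep) (auto simp: rep_scan_eq_0)
    then show ?case using Nil by (intro simI[of 1]) auto
  next
    case (Cons a xs)
    have len: "r < length ts" by (rule rep_length[OF Cons.prems(4)]) (use For.prems(2) in simp)
    have a: "a < K" and bnd: "bounded K (s(r := xs))"
      using bounded_tl[OF Cons.prems(3,2)] by auto
    obtain s1 where s1: "run N (B a) (s(r := xs)) = Some s1" "s1 r = xs"
      "loop (\<lambda>a. run N (B a)) r xs s1 = Some s'"
      using Cons.prems by (auto split: option.splits if_splits)
    have wf: "wf_com (Suc out) K (B a)" using For.prems(2) a by simp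
    have bnd1: "bounded K s1" using run_grows[OF s1(1) wf bnd] by (simp add: grows_def)
    have in_S: "conts K (B a) (For r B # cs) \<subseteq> S" using For.prems a by auto
    have "reach 1 (Run (For r B # cs)) ts (Run (B a # For r B # cs)) (ts[r := act (0, Move_Right) (ts ! r)])"
      using For.prems Cons.prems len For_in in_S Run_in_conts[of "B a" "For r B # cs" K]
      by (intro reach_upd) (auto simp: rep_scan syms_def)
    moreover have "rep (s(r := xs)) (ts[r := act (0, Move_Right) (ts ! r)])"
      using Cons.prems len by (intro rep_pop)
    ultimately have "sim 1 (For r B # cs) ts (B a # For r B # cs) (s(r := xs))"
      by (intro simI[of 1]) auto
    then have "sim (1 + poly (time_bound K (B a)) N) (For r B # cs) ts (For r B # cs) s1"
      by (rule sim_trans[OF _ For.IH[OF _ s1(1) wf bnd _ in_S For_in] order_refl]) (auto simp del: fun_upd_apply)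
    then show ?case
    proof (rule sim_trans[OF _ Cons.IH[OF s1(3,2) bnd1]])
      have "poly (time_bound K (B a)) N \<le> (\<Sum>a<K. poly (time_bound K (B a)) N)"
        using a by (intro member_le_sum) auto
      then show "1 + poly (time_bound K (B a)) N + (1 + length xs * ?q) \<le> 1 + length (a # xs) * ?q" by simp
    qed
  qed
  have 1: "sim (1 + length (s r) * ?q) (For r B # cs) ts cs s'"
    using For.prems by (intro *) (auto split: if_splits)
  have "length (s r) \<le> N" using For.prems by (auto split: if_splits)
  then show ?case
    by (intro sim_mono[OF 1]) (simp add: poly_sum add_mono mult_right_mono)
qed

end

section \<open>Running the decider on translated tapes\<close>

definition same :: "tape \<Rightarrow> tape \<Rightarrow> bool" where
  "same T U \<longleftrightarrow> (\<forall>i. fst T (snd T + i) = fst U (snd U + i))"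

lemma same_scan: "list_all2 same ts us \<Longrightarrow> scan ts = scan us"
proof (induction rule: list_all2_induct)
  case (Cons T ts U us)
  then show ?case
    unfolding same_def by (auto simp: scan_def split: prod.splits dest: spec[of _ 0])
qed (simp add: scan_def)

lemma same_act:
  assumes "same T U" shows "same (act am T) (act am U)"
proof -
  obtain f p f' p' g m where eq: "T = (f, p)" "U = (f', p')" "am = (g, m)"
    by (metis surj_pair)
  have *: "f (p + i) = f' (p' + i)" for i using assms by (simp add: same_def eq)
  have "(f(p := g)) (shift m p + i) = (f'(p' := g)) (shift m p' + i)" for i
    using *[of "i - 1"] *[of i] *[of "i + 1"] by (cases m) (auto simp: algebra_simps)
  then show ?thesis by (simp add: same_def eq)
qed

lemma list_all2_same_act:
  "list_all2 same ts us \<Longrightarrow> list_all2 same (map2 act as ts) (map2 act as us)"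
proof (induction arbitrary: as rule: list_all2_induct)
  case (Cons T ts U us)
  then show ?case by (cases as) (simp_all add: same_act del: act.simps)
qed simp

text \<open>When the program stops, the head on the output stack can be anywhere, whereas
  \<open>init\<close> puts it at position 0. This is why tapes are compared up to
  translation.\<close>

lemma same_srep: "same T (input_tape xs) \<longleftrightarrow> srep xs T"
  by (auto simp: same_def srep_def input_tape_def)

text \<open>\<open>wf_tm\<close> controls transitions only on symbols of \<open>M\<close>, and the
  compiled machine can have more. So this invariant is kept along the run of \<open>M\<close>
  itself.\<close>

definition tapes_ok :: "nat \<Rightarrow> tape list \<Rightarrow> bool" where
  "tapes_ok n ts \<longleftrightarrow> (\<forall>T\<in>set ts. range (fst T) \<subseteq> {..<n})"

lemma scan_tapes_ok: "tapes_ok n ts \<Longrightarrow> set (scan ts) \<subseteq> {..<n}"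
  by (fastforce simp: tapes_ok_def scan_def)

lemma tapes_ok_act:
  assumes "tapes_ok n ts" "fst ` set as \<subseteq> {..<n}"
  shows "tapes_ok n (map2 act as ts)"
proof -
  have "range (fst (act am T)) \<subseteq> {..<n}" if "am \<in> set as" "T \<in> set ts" for am T
  proof -
    obtain f p g m where eq: "T = (f, p)" "am = (g, m)" by (metis surj_pair)
    have "g < n" using assms(2) that(1) eq by force
    moreover have "range f \<subseteq> {..<n}" using assms(1) that(2) eq by (force simp: tapes_ok_def)
    ultimately show ?thesis by (auto simp: eq)
  qed
  moreover have "\<exists>am\<in>set as. \<exists>U\<in>set ts. T = act am U" if "T \<in> set (map2 act as ts)" for T
    using that by (force dest: set_zip_leftD set_zip_rightD simp del: act.simps)
  ultimately show ?thesis unfolding tapes_ok_def by blast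
qed

lemma drop_map2: "drop n (map2 f xs ys) = map2 f (drop n xs) (drop n ys)"
  by (simp add: drop_map drop_zip)

lemma step_halted: "q = tm_accept M \<or> q = tm_reject M \<Longrightarrow> (step M ^^ t) (q, ts) = (q, ts)"
  by (induction t) auto

context compiled
begin

text \<open>Both machines move in lockstep, and only the tapes from \<open>out\<close> on are
  compared. Acceptance depends on the state alone, so nothing is recorded about the final
  tapes.\<close>

lemma sim_M:
  assumes "(step M ^^ t) (q, us) = (q', us')" "list_all2 same (drop out ts) us"
    and "length ts = out + tm_tapes M" "q < tm_states M" "tapes_ok (tm_symbols M) us"
  shows "\<exists>ts'. (step M' ^^ t) (h (Sim q), ts) = (h (Sim q'), ts')"
  using assms
proof (induction t arbitrary: q us ts)
  case (Suc t)
  show ?case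
  proof (cases "q = tm_accept M \<or> q = tm_reject M")
    case True
    \<comment> \<open>The halting states of \<open>M'\<close> are the codes of those of
      \<open>M\<close>, so both machines stay put.\<close>
    then have "(step M' ^^ Suc t) (h (Sim q), ts) = (h (Sim q), ts)"
      by (intro step_halted) (auto simp: M'_def)
    moreover have "q' = q" using step_halted[OF True, of "Suc t" us] Suc.prems(1) by simp
    ultimately show ?thesis by blast
  next
    case False
    obtain q1 as where tr: "tm_trans M q (scan us) = (q1, as)" by (metis surj_pair)
    have len: "length us = tm_tapes M"
      using Suc.prems(2,3) by (auto dest: list_all2_lengthD)
    have "length (scan us) = tm_tapes M" "set (scan us) \<subseteq> {..<tm_symbols M}"
      using len Suc.prems(5) scan_tapes_ok by auto
    then have as: "q1 < tm_states M" "length as = tm_tapes M" "fst ` set as \<subseteq> {..<tm_symbols M}"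
      using wf_M Suc.prems(4) tr unfolding wf_tm_def by (metis fst_conv snd_conv)+
    have step: "step M (q, us) = (q1, map2 act as us)"
      using False tr by (simp add: scan_def)
    have scan_drop: "drop out (scan ts) = scan us"
      using same_scan[OF Suc.prems(2)] by (simp add: scan_def drop_map)
    let ?as = "keep (take out (scan ts)) @ as"
    have "step M' (h (Sim q), ts) = (h (Sim q1), map2 act ?as ts)"
    proof (rule step_ctl)
      show "ctl_step out M (Sim q) (scan ts) = (Sim q1, ?as)"
        by (simp add: scan_drop tr)
      assume *: "set (scan ts) \<subseteq> {..<syms}"
      have "set (take out (scan ts)) \<subseteq> {..<syms}"
        using * set_take_subset by (rule order_trans[rotated])
      moreover have "fst ` set as \<subseteq> {..<syms}"
        using as(3) by (auto simp: syms_def)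
      ultimately show "fst ` set ?as \<subseteq> {..<syms}"
        by (simp add: image_Un)
    qed (use False Suc.prems as in \<open>simp_all add: Sim_in_S\<close>)
    moreover have "\<exists>ts'. (step M' ^^ t) (h (Sim q1), map2 act ?as ts) = (h (Sim q'), ts')"
    proof (rule Suc.IH)
      show "(step M ^^ t) (q1, map2 act as us) = (q', us')"
        using Suc.prems(1) step by (simp add: funpow_Suc_right del: funpow.simps step.simps)
      have "drop out ?as = as" using Suc.prems(3) by simp
      then have "drop out (map2 act ?as ts) = map2 act as (drop out ts)"
        by (simp only: drop_map2)
      then show "list_all2 same (drop out (map2 act ?as ts)) (map2 act as us)"
        using list_all2_same_act[OF Suc.prems(2)] by simp
      show "tapes_ok (tm_symbols M) (map2 act as us)"
        by (rule tapes_ok_act[OF Suc.prems(5) as(3)])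
    qed (use Suc.prems(3) as in simp_all)
    ultimately show ?thesis
      by (simp add: funpow_Suc_right del: funpow.simps step.simps)
  qed
qed auto

end

definition ini :: "nat list \<Rightarrow> state" where
  "ini w = (\<lambda>_. [])(0 := w)"

context compiled
begin

lemma rep_init: "init M' w = (h (Run [c0]), snd (init M' w))" "rep (ini w) (snd (init M' w))"
proof -
  have "srep [] (\<lambda>_. 0, 0)" "srep w (input_tape w)"
    by (simp_all add: srep_def input_tape_def)
  then show "rep (ini w) (snd (init M' w))"
    using M_states(5)
    by (auto simp: rep_def init_def M'_def ini_def nth_Cons' simp del: One_nat_def)
qed (simp add: init_def M'_def)

text \<open>The three summands are the program, one step that inspects the flag, and the decider on
  the output. The length of the output is only bounded, by \<open>length w + b\<close>, which is
  where monotonicity of \<open>T\<close> enters. Halting configurations are fixed points, so any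
  later time \<open>B\<close> shows the same verdict.\<close>

lemma decides:
  assumes "run N c0 (ini w) = Some s'" "wf_com (Suc out) K c0" "set w \<subseteq> {..<K}"
    and M: "decides_in_time M \<Sigma> L T" "mono T"
    and out_ok: "s' 1 = [] \<Longrightarrow> s' out \<in> lists \<Sigma>"
  defines "b \<equiv> poly (time_bound K c0) N"
  assumes B: "b + 1 + T (length w + b) \<le> B"
  shows "fst ((step M' ^^ B) (init M' w)) =
    (if s' 1 = [] \<and> s' out \<in> L then tm_accept M' else tm_reject M')"
proof -
  have "Run [] \<in> S" "conts K c0 [] \<subseteq> S" by (auto simp: S_def)
  moreover have bnd: "bounded K (ini w)" using assms(3) by (auto simp: bounded_def ini_def)
  ultimately have "sim b [c0] (snd (init M' w)) [] s'"
    unfolding b_def using assms(1,2) rep_init(2) by (intro sim_run) auto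
  then obtain t ts where t: "t \<le> b" "reach t (Run [c0]) (snd (init M' w)) (Run []) ts" "rep s' ts"
    unfolding sim_def by blast
  have grows: "grows (Suc out) K b (ini w) s'"
    unfolding b_def by (rule run_grows[OF assms(1,2) bnd])
  have len: "length ts = out + tm_tapes M" using t(3) by (simp add: rep_def)
  then have len1: "1 < length ts" using M_states(5) out_pos by linarith
  let ?q = "if s' 1 = [] then tm_start M else tm_reject M"
  have "reach 1 (Run []) ts (Sim ?q) ts"
    using \<open>Run [] \<in> S\<close> M_states rep_scan_eq_0[OF t(3) len1] by (intro reach_keep) (auto simp: Sim_in_S)
  with t(2) have r: "(step M' ^^ (t + 1)) (init M' w) = (h (Sim ?q), ts)"
    using reach_trans rep_init(1) unfolding reach_def by metis
  have B_eq: "(step M' ^^ B) (init M' w) = (step M' ^^ (B - (t + 1))) (h (Sim ?q), ts)"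
    using r t(1) B funpow_add[of "B - (t + 1)" "t + 1" "step M'"] by simp
  show ?thesis
  proof (cases "s' 1 = []")
    case False
    then show ?thesis using B_eq step_halted[of "tm_reject M'" M'] by (simp add: M'_def)
  next
    case True
    let ?v = "s' out"
    have v: "?v \<in> lists \<Sigma>" using out_ok True .
    obtain q us where M_run: "(step M ^^ T (length ?v)) (init M ?v) = (q, us)" by (metis surj_pair)
    then have q: "q = (if ?v \<in> L then tm_accept M else tm_reject M)"
      using M(1) v unfolding decides_in_time_def by (metis fst_conv)
    let ?us = "input_tape ?v # replicate (tm_tapes M - 1) (\<lambda>_. 0, 0)"
    have init: "init M ?v = (tm_start M, ?us)" by (simp add: init_def)
    have "\<exists>ts'. (step M' ^^ T (length ?v)) (h (Sim (tm_start M)), ts) = (h (Sim q), ts')"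
    proof (rule sim_M)
      show "(step M ^^ T (length ?v)) (tm_start M, ?us) = (q, us)"
        using M_run init by simp
      show "list_all2 same (drop out ts) ?us"
      proof (rule list_all2_all_nthI)
        show "length (drop out ts) = length ?us" using len M_states(5) by simp
        fix i assume i: "i < length (drop out ts)"
        show "same (drop out ts ! i) (?us ! i)"
        proof (cases i)
          case 0
          then show ?thesis using t(3) i by (simp add: same_srep rep_def)
        next
          case (Suc j)
          \<comment> \<open>The program leaves registers above \<open>out\<close> alone, so the work
            tapes are blank.\<close>
          have "s' (out + i) = []" using Suc grows by (simp add: ini_def grows_def)
          moreover have "?us ! i = input_tape []" using Suc i len by (auto simp: input_tape_def fun_eq_iff)
          moreover have "srep (s' (out + i)) (ts ! (out + i))" using t(3) i len by (auto simp: rep_def)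
          ultimately show ?thesis using i len by (simp add: same_srep)
        qed
      qed
      have "Suc a < tm_symbols M" if "a \<in> set ?v" for a
        using that v M(1) unfolding decides_in_time_def by auto
      then show "tapes_ok (tm_symbols M) ?us"
        using M_states(6) by (auto simp: tapes_ok_def input_tape_def)
    qed (use len M_states in simp_all)
    then obtain ts' where *: "(step M' ^^ T (length ?v)) (h (Sim (tm_start M)), ts) = (h (Sim q), ts')"
      by blast
    have "length ?v \<le> length (ini w out) + b" using grows by (simp add: grows_def)
    then have "length ?v \<le> length w + b" using out_pos by (simp add: ini_def)
    then have "T (length ?v) \<le> B - (t + 1)"
      using monoD[OF M(2), of "length ?v" "length w + b"] B t(1) by linarith
    then obtain d where d: "B - (t + 1) = d + T (length ?v)"
      using le_Suc_ex by (metis add.commute)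
    have "(step M' ^^ (B - (t + 1))) (h (Sim (tm_start M)), ts) = (step M' ^^ d) (h (Sim q), ts')"
      unfolding d funpow_add using * by simp
    also have "\<dots> = (h (Sim q), ts')"
      by (rule step_halted) (use q in \<open>auto simp: M'_def\<close>)
    finally show ?thesis using B_eq True q by (simp add: M'_def)
  qed
qed

end

section \<open>Closure of P under preimages of stack programs\<close>

lemma wf_com_mono: "wf_com k K c \<Longrightarrow> k \<le> k' \<Longrightarrow> wf_com k' K c"
  by (induction c) auto

lemma run_Seq: "run N c s = Some s1 \<Longrightarrow> run N d s1 = s2 \<Longrightarrow> run N (c ;; d) s = s2"
  by simp

text \<open>A decider for \<open>L\<close> is specified only on words over its own alphabet, whereas
  the output of \<open>c\<close> may contain other symbols. Such an output is not in
  \<open>L\<close>, so it suffices to raise the flag in register 1 and to drop the foreign symbols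
  before the decider starts.\<close>

lemma class_P_preimage:
  assumes "finite \<Gamma>" "A \<subseteq> lists \<Gamma>" "L \<in> class_P"
    and wf: "wf_com (Suc out) K c" and out: "1 < out" and K: "0 < K" "\<Gamma> \<subseteq> {..<K}"
    and run: "\<And>w. w \<in> lists \<Gamma> \<Longrightarrow>
      \<exists>s. run (poly q (length w)) c (ini w) = Some s \<and> (w \<in> A \<longleftrightarrow> s 1 = [] \<and> s out \<in> L)"
  shows "A \<in> class_P"
proof -
  obtain \<Sigma> M p where \<Sigma>: "finite \<Sigma>" "L \<subseteq> lists \<Sigma>" and M: "decides_in_time M \<Sigma> L (poly p)"
    using assms(3) by (auto simp: class_P_def)
  \<comment> \<open>\<open>F\<close> reverses the word, so a second move, into
    \<open>Suc (Suc out)\<close>, restores the order.\<close>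
  define F where "F = For out (\<lambda>a. if a \<in> \<Sigma> then Push (Suc out) a else Push 1 0)"
  define c' where "c' = c ;; F ;; For (Suc out) (Push (Suc (Suc out)))"
  \<comment> \<open>The new cap is at least the cap of \<open>c\<close> and at least the length of
    its output, over which the two added loops run.\<close>
  define q' where "q' = q + [:0, 1:] + pcompose (time_bound K c) q"
  define b where "b = pcompose (time_bound K c') q'"
  define B where "B = b + 1 + pcompose p ([:0, 1:] + b)"
  have wf': "wf_com (Suc (Suc (Suc out))) K c'"
    using wf_com_mono[OF wf, of "Suc (Suc (Suc out))"] K out by (auto simp: c'_def F_def)
  interpret compiled c' "Suc (Suc out)" K M
    using M by unfold_locales (auto simp: decides_in_time_def)
  have "fst ((step M' ^^ poly B (length w)) (init M' w)) = (if w \<in> A then tm_accept M' else tm_reject M')"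
    if w: "w \<in> lists \<Gamma>" for w
  proof -
    let ?n = "length w"
    obtain s where s: "run (poly q ?n) c (ini w) = Some s" "w \<in> A \<longleftrightarrow> s 1 = [] \<and> s out \<in> L"
      using run w by blast
    have wK: "set w \<subseteq> {..<K}" using w K by auto
    then have "bounded K (ini w)" by (auto simp: bounded_def ini_def)
    from run_grows[OF s(1) wf this]
    have grows: "s (Suc out) = []" "s (Suc (Suc out)) = []"
      "length (s out) \<le> length (ini w out) + poly (time_bound K c) (poly q ?n)"
      by (simp_all add: grows_def ini_def)
    define N where "N = poly q' ?n"
    have N: "poly q ?n \<le> N" "length (s out) \<le> N"
      using grows(3) out by (simp_all add: N_def q'_def poly_pcompose ini_def)
    define S where "S = (\<lambda>ys. s(Suc out := rev (filter (\<lambda>a. a \<in> \<Sigma>) ys),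
       1 := map (\<lambda>_. 0) (filter (\<lambda>a. a \<notin> \<Sigma>) ys) @ s 1))"
    define s1 where "s1 = (S (s out))(out := [])"
    have F: "run N F s = Some s1" unfolding F_def
      by (rule run_For[where S = S]) (use N grows out in \<open>auto simp: S_def s1_def fun_eq_iff replicate_append_same map_replicate_const\<close>)
    define s2 where "s2 = s1(Suc out := [], Suc (Suc out) := rev (s1 (Suc out)) @ s1 (Suc (Suc out)))"
    have "length (s1 (Suc out)) \<le> N"
      using N(2) out by (auto simp: s1_def S_def intro: order_trans[OF length_filter_le])
    then have G: "run N (For (Suc out) (Push (Suc (Suc out)))) s1 = Some s2"
      unfolding s2_def by (intro run_move) auto
    have c': "run N c' (ini w) = Some s2"
      unfolding c'_def by (intro run_Seq[OF run_mono[OF s(1) N(1)]] run_Seq[OF F] G)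
    have s2_1: "s2 1 = [] \<longleftrightarrow> s 1 = [] \<and> set (s out) \<subseteq> \<Sigma>"
      using out by (auto simp: s2_def s1_def S_def filter_empty_conv)
    have s2_out: "s2 (Suc (Suc out)) = filter (\<lambda>a. a \<in> \<Sigma>) (s out)"
      using grows out by (simp add: s2_def s1_def S_def)
    have eq: "w \<in> A \<longleftrightarrow> s2 1 = [] \<and> s2 (Suc (Suc out)) \<in> L"
    proof -
      have "filter (\<lambda>a. a \<in> \<Sigma>) (s out) = s out" if "set (s out) \<subseteq> \<Sigma>"
        using that by (auto simp: filter_id_conv)
      moreover have "set (s out) \<subseteq> \<Sigma>" if "s out \<in> L" using that \<Sigma>(2) by auto
      ultimately show ?thesis unfolding s(2) s2_1 s2_out by auto
    qed
    have "poly (time_bound K c') N = poly b ?n" by (simp add: b_def N_def poly_pcompose)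
    then show ?thesis
      unfolding eq using s2_out
      by (intro decides[OF c' wf' wK M]) (auto simp: mono_def poly_nat_mono B_def poly_pcompose)
  qed
  moreover have "Suc a < tm_symbols M'" if "a \<in> \<Gamma>" for a
    using that K by (auto simp: M'_def syms_def)
  ultimately have "decides_in_time M' \<Gamma> A (poly B)"
    unfolding decides_in_time_def using wf_M' by blast
  then show ?thesis using assms(1,2) unfolding class_P_def by blast
qed

section \<open>Reachability instances as lists of labelled arcs\<close>

fun twalk :: "(nat \<times> nat \<times> nat) set \<Rightarrow> nat \<Rightarrow> nat list \<Rightarrow> nat \<Rightarrow> bool" where
  "twalk E s [] t \<longleftrightarrow> s = t"
| "twalk E s (a # as) t \<longleftrightarrow> (\<exists>v. (s, a, v) \<in> E \<and> twalk E v as t)"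

text \<open>Arcs are plain triples, possibly repeated in the list: a repetition stands for parallel
  arcs with equal labels.\<close>

definition valid_instance :: "nat set \<Rightarrow> nat \<Rightarrow> nat \<Rightarrow> nat \<Rightarrow> (nat \<times> nat \<times> nat) list \<Rightarrow> bool" where
  "valid_instance \<Sigma> n s t es \<longleftrightarrow> s < n \<and> t < n \<and> (\<forall>(u, a, v)\<in>set es. u < n \<and> v < n \<and> a \<in> \<Sigma>) \<and>
     acyclic {(u, v). \<exists>a. (u, a, v) \<in> set es}"

lemma cas_imp_twalk:
  assumes "pre_digraph.cas G s p t" "set p \<subseteq> arcs G"
  shows "twalk ((\<lambda>e. (tail G e, lab e, head G e)) ` arcs G) s (map lab p) t"
  using assms by (induction p arbitrary: s) (auto simp: pre_digraph.cas.simps)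

lemma twalk_imp_cas:
  assumes "twalk ((\<lambda>e. (tail G e, lab e, head G e)) ` arcs G) s ls t"
  shows "\<exists>p. pre_digraph.cas G s p t \<and> set p \<subseteq> arcs G \<and> map lab p = ls"
  using assms
proof (induction ls arbitrary: s)
  case Nil
  then show ?case by (intro exI[of _ "[]"]) (simp add: pre_digraph.cas.simps)
next
  case (Cons a ls)
  then obtain e where e: "e \<in> arcs G" "tail G e = s" "lab e = a"
    and "twalk ((\<lambda>e. (tail G e, lab e, head G e)) ` arcs G) (head G e) ls t" by auto
  then obtain p where "pre_digraph.cas G (head G e) p t" "set p \<subseteq> arcs G" "map lab p = ls"
    using Cons.IH by blast
  then show ?case using e by (intro exI[of _ "e # p"]) (simp add: pre_digraph.cas.simps)
qed

lemma awalk_iff_twalk: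
  assumes "s \<in> verts G"
  shows "(\<exists>p. pre_digraph.awalk G s p t \<and> map lab p = ls) \<longleftrightarrow>
    twalk ((\<lambda>e. (tail G e, lab e, head G e)) ` arcs G) s ls t"
  using assms cas_imp_twalk[of G s _ t lab] twalk_imp_cas[of G lab s ls t]
  by (auto simp: pre_digraph.awalk_def)

lemma DAGREACH_lang_iff:
  "w \<in> DAGREACH_lang \<Sigma> L \<longleftrightarrow> (\<exists>n s t es ls. w = instance_code n s t es \<and>
     valid_instance \<Sigma> n s t es \<and> ls \<in> L \<and> twalk (set es) s ls t)"
proof
  assume "w \<in> DAGREACH_lang \<Sigma> L"
  then obtain I where I: "I \<in> DAGREACH \<Sigma> L" "encodes w I" unfolding DAGREACH_lang_def by blast
  obtain G lab s t where I_eq: "I = ((G, lab), s, t)" by (metis surj_pair)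
  from I obtain n es p where
    dag: "is_labelled_dag \<Sigma> (G, lab)" "s \<in> verts G" "t \<in> verts G"
    and p: "pre_digraph.awalk G s p t" "map lab p \<in> L"
    and enc: "verts G = {..<n}" "set es = arcs G"
      "w = instance_code n s t (map (\<lambda>e. (tail G e, lab e, head G e)) es)"
    unfolding I_eq DAGREACH_def encodes_def by blast
  let ?es = "map (\<lambda>e. (tail G e, lab e, head G e)) es"
  have fin: "fin_digraph G" using dag(1) by (simp add: is_labelled_dag_def)
  then have wf: "tail G e \<in> verts G" "head G e \<in> verts G" if "e \<in> arcs G" for e
    using that by (auto simp: fin_digraph_def wf_digraph_def)
  have "{(u, v). \<exists>a. (u, a, v) \<in> set ?es} = arcs_ends G"
    using enc(2) by (auto simp: arcs_ends_def arc_to_ends_def)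
  then have "valid_instance \<Sigma> n s t ?es"
    using dag enc wf by (auto simp: valid_instance_def is_labelled_dag_def)
  moreover have "twalk (set ?es) s (map lab p) t"
    using awalk_iff_twalk[OF dag(2), of t lab "map lab p"] p(1) enc(2) by auto
  ultimately show "\<exists>n s t es ls. w = instance_code n s t es \<and>
     valid_instance \<Sigma> n s t es \<and> ls \<in> L \<and> twalk (set es) s ls t"
    using enc(3) p(2) by blast
next
  assume "\<exists>n s t es ls. w = instance_code n s t es \<and>
     valid_instance \<Sigma> n s t es \<and> ls \<in> L \<and> twalk (set es) s ls t"
  then obtain n s t es ls where w: "w = instance_code n s t es"
    and val: "valid_instance \<Sigma> n s t es" and ls: "ls \<in> L" "twalk (set es) s ls t" by blast
  \<comment> \<open>Positions in the list serve as arcs, so equal triples become distinct parallel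
    arcs.\<close>
  define G where "G = \<lparr>verts = {..<n}, arcs = {..<length es}, tail = (\<lambda>i. fst (es ! i)),
    head = (\<lambda>i. snd (snd (es ! i)))\<rparr>"
  define lab where "lab = (\<lambda>i. fst (snd (es ! i)))"
  have trip: "(\<lambda>e. (tail G e, lab e, head G e)) ` arcs G = set es"
    by (auto simp: G_def lab_def set_conv_nth)
  have es: "map (\<lambda>e. (tail G e, lab e, head G e)) [0..<length es] = es"
    by (auto simp: G_def lab_def intro: nth_equalityI)
  have ends: "arcs_ends G = {(u, v). \<exists>a. (u, a, v) \<in> set es}"
  proof -
    have "arcs_ends G = (\<lambda>(u, a, v). (u, v)) ` ((\<lambda>e. (tail G e, lab e, head G e)) ` arcs G)"
      by (auto simp: arcs_ends_def arc_to_ends_def image_image)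
    also have "\<dots> = {(u, v). \<exists>a. (u, a, v) \<in> set es}"
      unfolding trip by force
    finally show ?thesis .
  qed
  have nth: "fst (es ! i) < n" "snd (snd (es ! i)) < n" "fst (snd (es ! i)) \<in> \<Sigma>" if "i < length es" for i
    using val nth_mem[OF that] by (cases "es ! i"; force simp: valid_instance_def)+
  have "fin_digraph G"
    by unfold_locales (auto simp: G_def nth)
  then have "is_labelled_dag \<Sigma> (G, lab)"
    using val nth by (auto simp: is_labelled_dag_def ends valid_instance_def) (auto simp: G_def lab_def)
  moreover have s: "s \<in> verts G" "t \<in> verts G" using val by (auto simp: valid_instance_def G_def)
  moreover have "\<exists>p. pre_digraph.awalk G s p t \<and> map lab p = ls"
    using awalk_iff_twalk[OF s(1)] ls(2) trip by metis
  ultimately have "((G, lab), s, t) \<in> DAGREACH \<Sigma> L"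
    using ls(1) by (auto simp: DAGREACH_def)
  moreover have "encodes w ((G, lab), s, t)"
    unfolding encodes_def prod.case
    by (intro exI[of _ n] exI[of _ "[0..<length es]"]) (auto simp: w es, auto simp: G_def)
  ultimately show "w \<in> DAGREACH_lang \<Sigma> L" by (auto simp: DAGREACH_lang_def)
qed


section \<open>Words as lists of zero-terminated segments\<close>

definition enc :: "nat list list \<Rightarrow> nat list" where
  "enc ss = concat (map (\<lambda>e. e @ [0]) ss)"

lemma enc_simps [simp]: "enc [] = []" "enc (e # ss) = e @ 0 # enc ss" "enc (ss @ ss') = enc ss @ enc ss'"
  by (simp_all add: enc_def)

text \<open>A left fold, because a loop processes a word prefix by prefix. The second component is
  the current segment, not yet ended by a 0.\<close>

definition split_word :: "nat list \<Rightarrow> nat list list \<times> nat list" where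
  "split_word w = foldl (\<lambda>(ss, r) a. if a = 0 then (ss @ [r], []) else (ss, r @ [a])) ([], []) w"

definition segs :: "nat list \<Rightarrow> nat list list" where "segs w = fst (split_word w)"
definition rest :: "nat list \<Rightarrow> nat list" where "rest w = snd (split_word w)"

lemma segs_simps [simp]:
  "segs [] = []" "rest [] = []"
  "segs (w @ [a]) = (if a = 0 then segs w @ [rest w] else segs w)"
  "rest (w @ [a]) = (if a = 0 then [] else rest w @ [a])"
  by (simp_all add: segs_def rest_def split_word_def split: prod.splits)

text \<open>Splitting is lossless on every word, not only on codes. Hence the verifier can check
  segments one by one and still conclude that the whole word is a code.\<close>

lemma enc_segs_rest: "enc (segs w) @ rest w = w"
  by (induction w rule: rev_induct) (auto simp: append_assoc[symmetric] simp del: append_assoc)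

lemma append_nonzero [simp]:
  "0 \<notin> set e \<Longrightarrow> segs (w @ e) = segs w" "0 \<notin> set e \<Longrightarrow> rest (w @ e) = rest w @ e"
  by (induction e rule: rev_induct) (auto simp: append_assoc[symmetric] simp del: append_assoc)

lemma segs_enc:
  "\<forall>e\<in>set ss. 0 \<notin> set e \<Longrightarrow> segs (enc ss) = ss \<and> rest (enc ss) = []"
proof (induction ss rule: rev_induct)
  case (snoc e ss)
  have "enc (ss @ [e]) = (enc ss @ e) @ [0]" by simp
  then show ?case using snoc by (simp del: enc_simps append_assoc)
qed simp

lemma length_rest: "length (rest w) \<le> length w"
  by (induction w rule: rev_induct) auto

definition unary :: "nat \<Rightarrow> nat list" where
  "unary k = replicate k 1"

definition edge_seg :: "nat \<times> nat \<times> nat \<Rightarrow> nat list" where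
  "edge_seg = (\<lambda>(u, a, v). unary u @ (a + 2) # unary v)"

lemma unary_inject [simp]: "unary m = unary n \<longleftrightarrow> m = n"
  by (simp add: unary_def)

lemma length_unary [simp]: "length (unary k) = k"
  by (simp add: unary_def)

lemma rev_unary [simp]: "rev (unary k) = unary k"
  by (simp add: unary_def)

lemma set_unary: "set (unary k) \<subseteq> {1}"
  by (auto simp: unary_def)

lemma unary_snoc: "unary k @ 1 # xs = 1 # unary k @ xs"
  by (simp add: unary_def replicate_app_Cons_same)

lemma unary_Suc: "unary (Suc k) = 1 # unary k" "unary 0 = []"
  by (simp_all add: unary_def)

lemma edge_seg_neq_unary [simp]: "edge_seg e \<noteq> unary k" "unary k \<noteq> edge_seg e"
proof -
  obtain u a v where "e = (u, a, v)" by (metis surj_pair)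
  then have "a + 2 \<in> set (edge_seg e)" by (simp add: edge_seg_def)
  then show "edge_seg e \<noteq> unary k" "unary k \<noteq> edge_seg e"
    using set_unary[of k] by fastforce+
qed

lemma unary_append_inject:
  "2 \<le> a \<Longrightarrow> 2 \<le> b \<Longrightarrow> unary u @ a # xs = unary v @ b # ys \<longleftrightarrow> u = v \<and> a = b \<and> xs = ys"
proof (induction u arbitrary: v)
  case 0
  then show ?case by (cases v) (auto simp: unary_Suc)
next
  case (Suc u)
  then show ?case by (cases v) (auto simp: unary_Suc)
qed

lemma edge_seg_inject [simp]: "edge_seg e = edge_seg e' \<longleftrightarrow> e = e'"
  by (cases e; cases e') (auto simp: edge_seg_def unary_append_inject)

lemma zero_notin_unary: "0 \<notin> set (unary k)"
  by (auto simp: unary_def)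

lemma zero_notin_edge_seg: "0 \<notin> set (edge_seg e)"
  by (auto simp: edge_seg_def unary_def split: prod.splits)

lemma instance_code_enc:
  "instance_code n s t es = enc ([unary n, unary s, unary t] @ map edge_seg es)"
proof -
  have "concat (map (\<lambda>(u, a, v). replicate u 1 @ [a + 2] @ replicate v 1 @ [0]) es) = enc (map edge_seg es)"
    by (induction es) (auto simp: edge_seg_def unary_def)
  then show ?thesis by (simp add: instance_code_def unary_def)
qed

lemma segs_instance_code:
  "segs (instance_code n s t es) = [unary n, unary s, unary t] @ map edge_seg es"
  "rest (instance_code n s t es) = []"
proof -
  have "\<forall>e\<in>set ([unary n, unary s, unary t] @ map edge_seg es). 0 \<notin> set e"
    by (auto simp: zero_notin_unary zero_notin_edge_seg)
  from segs_enc[OF this]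
  show "segs (instance_code n s t es) = [unary n, unary s, unary t] @ map edge_seg es"
    "rest (instance_code n s t es) = []"
    by (simp_all add: instance_code_enc del: enc_simps)
qed

text \<open>Unique decoding turns the quantifier over encoded instances in
  \<open>DAGREACH_lang_iff\<close> into a statement about the given one.\<close>

lemma instance_code_inject:
  "instance_code n s t es = instance_code n' s' t' es' \<longleftrightarrow> n = n' \<and> s = s' \<and> t = t' \<and> es = es'"
proof
  assume "instance_code n s t es = instance_code n' s' t' es'"
  then have "[unary n, unary s, unary t] @ map edge_seg es = [unary n', unary s', unary t'] @ map edge_seg es'"
    by (metis segs_instance_code(1))
  moreover have "inj edge_seg" by (simp add: inj_def)
  ultimately show "n = n' \<and> s = s' \<and> t = t' \<and> es = es'"
    by (simp add: inj_map_eq_map)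
qed simp

lemma instance_code_in_DAGREACH_lang:
  "instance_code n s t es \<in> DAGREACH_lang \<Sigma> L \<longleftrightarrow>
     valid_instance \<Sigma> n s t es \<and> (\<exists>ls\<in>L. twalk (set es) s ls t)"
  unfolding DAGREACH_lang_iff instance_code_inject by blast

lemma acyclic_rank:
  fixes f :: "nat \<Rightarrow> nat"
  assumes "\<And>u v. (u, v) \<in> r \<Longrightarrow> f u < f v"
  shows "acyclic r"
proof (rule acyclic_subset)
  show "acyclic (measure f)" by (rule wf_acyclic[OF wf_measure])
  show "r \<subseteq> measure f" using assms by auto
qed


section \<open>Topological orders as certificates of acyclicity\<close>

text \<open>The first segment that equals \<open>U\<close> or \<open>V\<close> is \<open>U\<close>;
  \<open>V\<close> may be absent. The reversals occur because a loop over segments delivers each one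
  reversed on a stack; unary words are palindromes.\<close>

definition precedes :: "nat list list \<Rightarrow> nat list \<Rightarrow> nat list \<Rightarrow> bool" where
  "precedes ys U V \<longleftrightarrow> (\<exists>e. find (\<lambda>e. rev e = V \<or> rev e = U) ys = Some e \<and> rev e \<noteq> V)"

text \<open>The rank is the position of the first occurrence, with absent words at the end. Every
  list defines such a rank, so a certificate is sound without a check that it enumerates the
  vertices.\<close>

lemma precedes_rank:
  assumes "precedes ys U V"
  shows "length (takeWhile (\<lambda>e. rev e \<noteq> U) ys) < length (takeWhile (\<lambda>e. rev e \<noteq> V) ys)"
  using assms unfolding precedes_def by (induction ys) (auto split: if_splits)

lemma acyclic_if_precedes:
  assumes "\<And>u v. (u, v) \<in> r \<Longrightarrow> precedes ys (unary u) (unary v)"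
  shows "acyclic r"
  by (rule acyclic_rank[of r "\<lambda>u. length (takeWhile (\<lambda>e. rev e \<noteq> unary u) ys)"])
     (rule precedes_rank[OF assms])

lemma precedes_append: "precedes ys U V \<Longrightarrow> precedes (ys @ zs) U V"
  unfolding precedes_def by (induction ys) (auto split: if_splits)

lemma precedes_sorted:
  fixes f :: "nat \<Rightarrow> nat"
  assumes "sorted (map f xs)" "u \<in> set xs" "f u < f v"
  shows "precedes (map unary xs) (unary u) (unary v)"
  using assms unfolding precedes_def by (induction xs) (auto split: if_splits)

text \<open>Rank a vertex by its number of proper ancestors. Along an arc this set grows strictly:
  the tail is an ancestor of the head but, by acyclicity, not of itself. Sorting by rank gives the
  order.\<close>

lemma acyclic_obtain_order:
  fixes r :: "(nat \<times> nat) set"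
  assumes "acyclic r" "r \<subseteq> {..<n} \<times> {..<n}"
  obtains xs where "set xs = {..<n}" "length xs = n"
    "\<And>u v. (u, v) \<in> r \<Longrightarrow> precedes (map unary xs) (unary u) (unary v)"
proof -
  define f where "f v = card {u. (u, v) \<in> r\<^sup>+}" for v
  have tr: "r\<^sup>+ \<subseteq> {..<n} \<times> {..<n}" using assms(2) by (rule trancl_subset_Sigma)
  have mono: "f u < f v" if "(u, v) \<in> r" for u v
    unfolding f_def
  proof (rule psubset_card_mono)
    show "finite {u. (u, v) \<in> r\<^sup>+}" by (rule finite_subset[of _ "{..<n}"]) (use tr in auto)
    have "(u, u) \<notin> r\<^sup>+" using assms(1) by (simp add: acyclic_def)
    moreover have "u \<in> {u. (u, v) \<in> r\<^sup>+}" using that by auto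
    moreover have "{x. (x, u) \<in> r\<^sup>+} \<subseteq> {x. (x, v) \<in> r\<^sup>+}" using that by (auto intro: trancl_into_trancl)
    ultimately show "{x. (x, u) \<in> r\<^sup>+} \<subset> {x. (x, v) \<in> r\<^sup>+}" by auto
  qed
  have "precedes (map unary (sort_key f [0..<n])) (unary u) (unary v)" if "(u, v) \<in> r" for u v
  proof (rule precedes_sorted)
    show "sorted (map f (sort_key f [0..<n]))" by (rule sorted_sort_key)
  qed (use that assms(2) mono in auto)
  then show ?thesis by (intro that[of "sort_key f [0..<n]"]) auto
qed

section \<open>Clearing and copying registers\<close>

declare run.simps(6) [simp del]

definition Clear :: "nat \<Rightarrow> com" where
  "Clear r = For r (\<lambda>_. Skip)"

definition Copy :: "nat \<Rightarrow> nat \<Rightarrow> com" where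
  "Copy d r = For r (Push 2) ;; For 2 (\<lambda>a. Push r a ;; Push d a)"

lemma run_Clear [simp]: "length (s r) \<le> N \<Longrightarrow> run N (Clear r) s = Some (s(r := []))"
  unfolding Clear_def by (rule run_For[where S = "\<lambda>_. s"]) auto

text \<open>Register 2 is scratch space; if \<open>d\<close> is not empty, then the copy is put on top of it.\<close>

lemma run_Copy [simp]:
  assumes "s 2 = []" "r \<noteq> 2" "d \<noteq> 2" "r \<noteq> d" "length (s r) \<le> N"
  shows "run N (Copy d r) s = Some (s(d := s r @ s d))"
proof -
  have "run N (For 2 (\<lambda>a. Push r a ;; Push d a)) (s(r := [], 2 := rev (s r))) = Some (s(d := s r @ s d))"
    by (rule run_For[where S = "\<lambda>ys. s(r := rev ys, d := rev ys @ s d, 2 := rev (s r))"])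
       (use assms in \<open>auto simp: fun_eq_iff\<close>)
  then show ?thesis using assms run_move[of r 2 s N] by (simp add: Copy_def)
qed

lemma wf_Clear [simp]: "wf_com k K (Clear r) \<longleftrightarrow> r < k"
  by (simp add: Clear_def)

lemma wf_Copy [simp]: "wf_com k K (Copy d r) \<longleftrightarrow> r < k \<and> 2 < k \<and> (0 < K \<longrightarrow> d < k)"
  by (auto simp: Copy_def)


section \<open>P is contained in NP\<close>

lemma pair_word_Nil: "pair_word x [] = map Suc x @ [0]"
  by (simp add: pair_word_def)

text \<open>With the length bound 0, only words \<open>pair_word x []\<close> are ever queried. So
  \<open>R\<close> may simply erase every 0 and undo the shift, without checking the shape of the
  word.\<close>

lemma class_P_subset_NP: "class_P \<subseteq> class_NP"
proof
  fix L assume L: "L \<in> class_P"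
  then obtain \<Sigma> where \<Sigma>: "finite \<Sigma>" "L \<subseteq> lists \<Sigma>" by (auto simp: class_P_def)
  define \<Gamma> where "\<Gamma> = insert 0 (Suc ` \<Sigma>)"
  have fin: "finite \<Gamma>" using \<Sigma> by (simp add: \<Gamma>_def)
  then obtain K where K: "\<Gamma> \<subseteq> {..<K}" using finite_nat_iff_bounded by blast
  define f where "f = (\<lambda>w. map (\<lambda>a. a - 1) (filter (\<lambda>a. a \<noteq> (0::nat)) w))"
  define c where "c = For 0 (\<lambda>a. if a = 0 then Skip else Push 2 (a - 1)) ;; For 2 (Push 3)"
  define R where "R = {w \<in> lists \<Gamma>. f w \<in> L}"
  have "R \<in> class_P"
  proof (rule class_P_preimage[where c = c and out = 3 and K = K and q = "[:0, 1:]"])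
    fix w assume w: "w \<in> lists \<Gamma>"
    let ?s = "(ini w)(0 := [], 2 := rev (f w))"
    have "run (length w) (For 0 (\<lambda>a. if a = 0 then Skip else Push 2 (a - 1))) (ini w) = Some ?s"
      by (rule run_For[where S = "\<lambda>ys. (ini w)(2 := rev (f ys))"])
         (auto simp: ini_def f_def fun_eq_iff)
    moreover have "run (length w) (For 2 (Push 3)) ?s = Some (?s(2 := [], 3 := f w))"
      using run_move[of 2 3 ?s "length w"] by (simp add: ini_def f_def)
    ultimately have "run (length w) c (ini w) = Some (?s(2 := [], 3 := f w))"
      by (simp add: c_def)
    then show "\<exists>s. run (poly [:0, 1:] (length w)) c (ini w) = Some s \<and> (w \<in> R \<longleftrightarrow> s 1 = [] \<and> s 3 \<in> L)"
      using w by (auto simp: R_def ini_def)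
  qed (use fin L K in \<open>auto simp: R_def c_def \<Gamma>_def\<close>)
  moreover have "x \<in> L \<longleftrightarrow> pair_word x [] \<in> R" for x
  proof -
    have "f (map Suc x @ [0]) = x" by (simp add: f_def filter_map comp_def)
    moreover have "x \<in> L \<Longrightarrow> map Suc x @ [0] \<in> lists \<Gamma>" using subsetD[OF \<Sigma>(2)] by (fastforce simp: \<Gamma>_def)
    ultimately show ?thesis by (auto simp: R_def pair_word_Nil)
  qed
  then have "L = {x. \<exists>y. length y \<le> poly 0 (length x) \<and> pair_word x y \<in> R}" by auto
  ultimately show "L \<in> class_NP" unfolding class_NP_def by blast
qed


section \<open>Languages reduce to reachability on paths\<close>

text \<open>What is pushed last is read first, so an arc is written from its end. For the same
  reason whole instances are built from back to front, the header last.\<close>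

definition Emit :: "nat \<Rightarrow> nat \<Rightarrow> nat \<Rightarrow> nat \<Rightarrow> com" where
  "Emit d u a v = Push d 0 ;; Copy d v ;; Push d (a + 2) ;; Copy d u"

lemma run_Emit [simp]:
  assumes "s 2 = []" "u \<noteq> 2" "v \<noteq> 2" "d \<noteq> 2" "u \<noteq> d" "v \<noteq> d" "length (s u) \<le> N" "length (s v) \<le> N"
    and "s u = unary i" "s v = unary j" "s d = enc es"
  shows "run N (Emit d u a v) s = Some (s(d := enc (edge_seg (i, a, j) # es)))"
  using assms by (simp add: Emit_def edge_seg_def)

lemma wf_Emit [simp]: "wf_com k K (Emit d u a v) \<longleftrightarrow> u < k \<and> v < k \<and> d < k \<and> 2 < k \<and> a + 2 < K"
  by (auto simp: Emit_def)

definition path_edges :: "nat list \<Rightarrow> (nat \<times> nat \<times> nat) list" where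
  "path_edges w = map (\<lambda>i. (i, w ! i, Suc i)) [0..<length w]"

lemma path_edges_snoc [simp]:
  "path_edges [] = []" "path_edges (w @ [a]) = path_edges w @ [(length w, a, Suc (length w))]"
  by (auto simp: path_edges_def nth_append)

lemma set_path_edges: "(u, a, v) \<in> set (path_edges w) \<longleftrightarrow> u < length w \<and> a = w ! u \<and> v = Suc u"
  by (auto simp: path_edges_def)

text \<open>Registers 3 and 4 hold the consecutive vertices \<open>i\<close> and
  \<open>i + 1\<close> in unary. Their final values are reused for the header or for further
  arcs.\<close>

definition Path :: "nat \<Rightarrow> (nat \<Rightarrow> nat) \<Rightarrow> com" where
  "Path d f = Push 4 1 ;; For 0 (\<lambda>a. Emit d 3 (f a) 4 ;; Push 3 1 ;; Push 4 1)"

lemma run_Path: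
  assumes "d > 4" "length w < N"
  shows "run N (Path d f) (ini w) = Some ((\<lambda>_. [])(3 := unary (length w), 4 := unary (Suc (length w)),
     d := enc (map edge_seg (rev (path_edges (map f w))))))"
proof -
  let ?S = "\<lambda>ys. (ini w)(3 := unary (length ys), 4 := unary (Suc (length ys)),
     d := enc (map edge_seg (rev (path_edges (map f ys)))))"
  have "run N (For 0 (\<lambda>a. Emit d 3 (f a) 4 ;; Push 3 1 ;; Push 4 1)) ((ini w)(4 := [1])) = Some ((?S w)(0 := []))"
  proof (rule run_For[where S = ?S])
    fix ys a zs assume "((ini w)(4 := [1])) 0 = ys @ a # zs"
    then have "w = ys @ a # zs" by (simp add: ini_def)
    then show "run N (Emit d 3 (f a) 4 ;; Push 3 1 ;; Push 4 1) ((?S ys)(0 := zs)) = Some ((?S (ys @ [a]))(0 := zs))"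
      using assms by (simp add: run_Emit[where i = "length ys" and j = "Suc (length ys)" and es = "map edge_seg (rev (path_edges (map f ys)))"] ini_def)
        (auto simp: fun_eq_iff unary_Suc)
  qed (use assms in \<open>auto simp: ini_def unary_Suc fun_eq_iff\<close>)
  moreover have "(?S w)(0 := []) = (\<lambda>_. [])(3 := unary (length w), 4 := unary (Suc (length w)),
     d := enc (map edge_seg (rev (path_edges (map f w)))))"
    using assms by (auto simp: ini_def fun_eq_iff)
  ultimately show ?thesis by (simp add: Path_def ini_def)
qed

lemma twalk_path_edges:
  "s \<le> length w \<Longrightarrow> twalk (set (path_edges w)) s ls (length w) \<longleftrightarrow> ls = drop s w"
proof (induction ls arbitrary: s)
  case (Cons a ls)
  then show ?case
    by (cases "s < length w") (auto simp: set_path_edges Cons_nth_drop_Suc[symmetric])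
qed auto

lemma valid_instance_increasing:
  assumes "s < n" "t < n" "\<And>u a v. (u, a, v) \<in> set es \<Longrightarrow> u < v \<and> v < n \<and> a \<in> \<Sigma>"
  shows "valid_instance \<Sigma> n s t es"
  using assms acyclic_rank[of "{(u, v). \<exists>a. (u, a, v) \<in> set es}" "\<lambda>u. u"]
  by (fastforce simp: valid_instance_def)

lemma DAGR_P_subset_P: "DAGR class_P \<subseteq> class_P"
proof
  fix L assume "L \<in> DAGR class_P"
  then obtain \<Sigma> where \<Sigma>: "finite \<Sigma>" "L \<subseteq> lists \<Sigma>" and D: "DAGREACH_lang \<Sigma> L \<in> class_P"
    by (auto simp: DAGR_def)
  obtain m where m: "\<Sigma> \<subseteq> {..<m}" using \<Sigma>(1) finite_nat_iff_bounded by blast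
  \<comment> \<open>Well-formedness ranges over all symbols below \<open>K\<close>, so
    \<open>f\<close> sends those that cannot be labels to 0. The resulting symbol 2 is below
    \<open>m + 3\<close> even for \<open>m = 0\<close>.\<close>
  define f where "f = (\<lambda>a. if a < m then a else 0)"
  \<comment> \<open>The header from back to front: \<open>t\<close> is register 3,
    \<open>s = 0\<close> is the empty word between two separators, \<open>n\<close> is register
    4.\<close>
  define c where "c = Path 5 f ;; Push 5 0 ;; Copy 5 3 ;; Push 5 0 ;; Push 5 0 ;; Copy 5 4"
  show "L \<in> class_P"
  proof (rule class_P_preimage[where c = c and out = 5 and K = "m + 3" and q = "[:2, 1:]"])
    fix w assume w: "w \<in> lists \<Sigma>"
    let ?es = "rev (path_edges w)"
    have map_f: "map f w = w" using w m by (intro map_idI) (auto simp: f_def)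
    let ?n = "length w"
    let ?s = "(\<lambda>_. [])(3 := unary ?n, 4 := unary (Suc ?n), 5 := instance_code (Suc ?n) 0 ?n ?es)"
    have "run (poly [:2, 1:] ?n) c (ini w) = Some ?s"
      by (simp add: c_def run_Path map_f) (simp add: fun_eq_iff instance_code_enc unary_Suc)
    moreover have "w \<in> L \<longleftrightarrow> ?s 5 \<in> DAGREACH_lang \<Sigma> L"
    proof -
      have "valid_instance \<Sigma> (Suc ?n) 0 ?n ?es"
        using w by (intro valid_instance_increasing) (auto simp: set_path_edges)
      then show ?thesis
        by (simp add: instance_code_in_DAGREACH_lang twalk_path_edges)
    qed
    ultimately show "\<exists>s. run (poly [:2, 1:] ?n) c (ini w) = Some s \<and>
        (w \<in> L \<longleftrightarrow> s 1 = [] \<and> s 5 \<in> DAGREACH_lang \<Sigma> L)"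
      by (intro exI[of _ ?s]) simp
  next
    show "wf_com (Suc 5) (m + 3) c" by (auto simp: c_def Path_def f_def)
  qed (use \<Sigma> m D in auto)
qed

section \<open>A layered graph whose walks spell all short certificates\<close>

primrec layer_edges :: "nat \<Rightarrow> nat list \<Rightarrow> nat \<Rightarrow> (nat \<times> nat \<times> nat) list" where
  "layer_edges l As 0 = []"
| "layer_edges l As (Suc j) =
     map (\<lambda>a. (l + 1 + j, Suc a, l + 2 + j)) (rev As) @ (l, 0, l + 1 + j) # layer_edges l As j"

lemma set_layer_edges:
  "(u, a, v) \<in> set (layer_edges l As j) \<longleftrightarrow>
    (\<exists>i<j. u = l \<and> a = 0 \<and> v = l + 1 + i \<or> u = l + 1 + i \<and> a \<in> Suc ` set As \<and> v = l + 2 + i)"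
  by (induction j) (auto simp: less_Suc_eq)

text \<open>Arcs labelled 0, the separator of \<open>pair_word\<close>, lead from the end of the
  \<open>x\<close> part to each vertex of a chain of letters. Entering the chain at offset
  \<open>i\<close> leaves exactly \<open>P - i\<close> letters before the sink, so one sink accounts
  for all certificates of length at most \<open>P\<close>. The order of the list is dictated by
  \<open>Cert\<close>, which pushes its last arc first.\<close>

definition cert_edges :: "nat list \<Rightarrow> nat list \<Rightarrow> nat \<Rightarrow> (nat \<times> nat \<times> nat) list" where
  "cert_edges x As P = (length x, 0, length x + 1 + P) # layer_edges (length x) As P @
     rev (path_edges (map Suc x))"

lemma set_cert_edges:
  "(u, a, v) \<in> set (cert_edges x As P) \<longleftrightarrow>
    u < length x \<and> a = Suc (x ! u) \<and> v = Suc u \<or>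
    u = length x \<and> a = 0 \<and> (\<exists>i\<le>P. v = length x + 1 + i) \<or>
    (\<exists>i<P. u = length x + 1 + i \<and> a \<in> Suc ` set As \<and> v = length x + 2 + i)"
  unfolding cert_edges_def by (auto simp: set_layer_edges set_path_edges le_less)

lemma twalk_letters:
  "i \<le> P \<Longrightarrow> twalk (set (cert_edges x As P)) (length x + 1 + i) ls (length x + 1 + P) \<longleftrightarrow>
    (\<exists>y\<in>lists (set As). ls = map Suc y \<and> i + length y = P)"
proof (induction ls arbitrary: i)
  case (Cons b ls)
  have "twalk (set (cert_edges x As P)) (length x + 1 + i) (b # ls) (length x + 1 + P) \<longleftrightarrow>
    i < P \<and> b \<in> Suc ` set As \<and> twalk (set (cert_edges x As P)) (length x + 1 + Suc i) ls (length x + 1 + P)"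
    by (auto simp: set_cert_edges)
  also have "\<dots> \<longleftrightarrow> i < P \<and> b \<in> Suc ` set As \<and> (\<exists>y\<in>lists (set As). ls = map Suc y \<and> Suc i + length y = P)"
    using Cons.IH[of "Suc i"] by (auto simp del: twalk.simps)
  also have "\<dots> \<longleftrightarrow> (\<exists>y\<in>lists (set As). b # ls = map Suc y \<and> i + length y = P)"
  proof safe
    fix a y assume *: "a \<in> set As" "\<forall>a\<in>set y. a \<in> set As" "P = Suc i + length y"
    then show "\<exists>y'\<in>lists (set As). Suc a # map Suc y = map Suc y' \<and> i + length y' = Suc i + length y"
      by (intro bexI[of _ "a # y"]) auto
  qed (auto simp: Cons_eq_map_conv)
  finally show ?case .
qed auto

lemma twalk_cert_edges:
  "s \<le> length x \<Longrightarrow> twalk (set (cert_edges x As P)) s ls (length x + 1 + P) \<longleftrightarrow>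
    (\<exists>y\<in>lists (set As). ls = drop s (map Suc x) @ 0 # map Suc y \<and> length y \<le> P)"
proof (induction "length x - s" arbitrary: s ls)
  case 0
  then have s: "s = length x" by simp
  show ?case
  proof (cases ls)
    case (Cons b ls')
    have "twalk (set (cert_edges x As P)) s ls (length x + 1 + P) \<longleftrightarrow>
      b = 0 \<and> (\<exists>i\<le>P. twalk (set (cert_edges x As P)) (length x + 1 + i) ls' (length x + 1 + P))"
      by (auto simp: set_cert_edges s Cons)
    also have "\<dots> \<longleftrightarrow> b = 0 \<and> (\<exists>i\<le>P. \<exists>y\<in>lists (set As). ls' = map Suc y \<and> i + length y = P)"
      using twalk_letters[of _ P x As ls'] by blast
    \<comment> \<open>The entry point for \<open>y\<close> is
      \<open>i = P - length y\<close>.\<close>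
    also have "\<dots> \<longleftrightarrow> b = 0 \<and> (\<exists>y\<in>lists (set As). ls' = map Suc y \<and> length y \<le> P)"
      by (metis add_diff_cancel_right' diff_le_self le_add2 le_add_diff_inverse2)
    finally show ?thesis by (auto simp: s Cons)
  qed (simp add: s)
next
  case (Suc k)
  then have s: "s < length x" by simp
  show ?case
  proof (cases ls)
    case (Cons b ls')
    have "twalk (set (cert_edges x As P)) s ls (length x + 1 + P) \<longleftrightarrow>
      b = Suc (x ! s) \<and> twalk (set (cert_edges x As P)) (Suc s) ls' (length x + 1 + P)"
      using s by (auto simp: set_cert_edges Cons)
    also have "\<dots> \<longleftrightarrow> b = Suc (x ! s) \<and> (\<exists>y\<in>lists (set As). ls' = drop (Suc s) (map Suc x) @ 0 # map Suc y \<and> length y \<le> P)"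
      using Suc by simp
    finally show ?thesis using s by (auto simp: Cons Cons_nth_drop_Suc[symmetric])
  qed (use s in simp)
qed

text \<open>A separator arc is always present, so validity hinges on its label. If 0 is not in the
  alphabet, the instance is rightly negative: no pair word is over the alphabet then.\<close>

lemma valid_instance_cert_edges:
  assumes "x \<in> lists {a. Suc a \<in> \<Sigma>}" "set As = {a. Suc a \<in> \<Sigma>}"
  shows "valid_instance \<Sigma> (length x + 2 + P) 0 (length x + 1 + P) (cert_edges x As P) \<longleftrightarrow> 0 \<in> \<Sigma>"
proof
  assume "valid_instance \<Sigma> (length x + 2 + P) 0 (length x + 1 + P) (cert_edges x As P)"
  then show "0 \<in> \<Sigma>" by (simp add: valid_instance_def cert_edges_def)
next
  assume "0 \<in> \<Sigma>"
  then show "valid_instance \<Sigma> (length x + 2 + P) 0 (length x + 1 + P) (cert_edges x As P)"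
    using assms by (intro valid_instance_increasing) (auto simp: set_cert_edges)
qed


section \<open>Computing polynomials in unary\<close>

primrec Ones :: "nat \<Rightarrow> nat \<Rightarrow> com" where
  "Ones r 0 = Skip"
| "Ones r (Suc c) = Push r 1 ;; Ones r c"

lemma run_Ones: "s r = unary i \<Longrightarrow> run N (Ones r c) s = Some (s(r := unary (c + i)))"
proof (induction c arbitrary: s i)
  case (Suc c)
  have "1 # s r = unary (Suc i)" using Suc.prems by (simp add: unary_Suc)
  moreover have "run N (Ones r c) (s(r := unary (Suc i))) = Some (s(r := unary (Suc c + i)))"
    using Suc.IH[of "s(r := unary (Suc i))" "Suc i"] by (simp add: fun_upd_same del: fun_upd_apply)
  ultimately show ?case by (simp only: Ones.simps run.simps option.case)
qed (auto simp: fun_eq_iff)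

lemma wf_Ones [simp]: "r < k \<Longrightarrow> 1 < K \<Longrightarrow> wf_com k K (Ones r c)"
  by (induction c) auto

lemma unary_append_one: "unary k @ [Suc 0] = Suc 0 # unary k"
  by (simp add: unary_def replicate_append_same)

lemma lists_setI: "set y \<subseteq> A \<Longrightarrow> y \<in> lists A"
  by auto

text \<open>Horner's rule \<open>h := c + n * h\<close>, with \<open>n\<close> in register 3 and
  \<open>h\<close> in register 6. The product is collected in register 7, one copy of
  \<open>n\<close> for each symbol of \<open>h\<close>.\<close>

primrec Horner :: "nat list \<Rightarrow> com" where
  "Horner [] = Skip"
| "Horner (c # cs) = Horner cs ;; For 6 (\<lambda>_. Copy 7 3) ;; For 7 (Push 6) ;; Ones 6 c"

lemma unary_add: "unary i @ unary j = unary (i + j)"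
  by (simp add: unary_def replicate_add)

lemma horner_mono: "horner_sum id n cs \<le> horner_sum id (n + 1) (cs :: nat list)"
  by (induction cs) (auto intro: mult_le_mono add_mono trans_le_add2)

text \<open>For \<open>n = 0\<close> the products vanish, so intermediate values can exceed the
  final one. The value at \<open>n + 1\<close> bounds them all, as there each round multiplies by at
  least 1.\<close>

lemma run_Horner:
  assumes "s 2 = []" "s 6 = []" "s 7 = []" "s 3 = unary n" "n \<le> N" "horner_sum id (n + 1) cs \<le> N"
  shows "run N (Horner cs) s = Some (s(6 := unary (horner_sum id n cs)))"
  using assms(6)
proof (induction cs)
  case Nil
  then show ?case using assms by (auto simp: unary_def)
next
  case (Cons c cs)
  let ?h = "horner_sum id n cs"
  have h: "?h \<le> N" "n * ?h \<le> N" "horner_sum id (n + 1) cs \<le> N"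
  proof -
    have 1: "?h \<le> horner_sum id (n + 1) cs" by (rule horner_mono)
    then have "n * ?h \<le> (n + 1) * horner_sum id (n + 1) cs" by (intro mult_le_mono) auto
    with 1 Cons.prems show "?h \<le> N" "n * ?h \<le> N" "horner_sum id (n + 1) cs \<le> N" by (auto simp: id_def)
  qed
  have "run N (Horner cs) s = Some (s(6 := unary ?h))"
    using h(3) by (rule Cons.IH)
  moreover have "run N (For 6 (\<lambda>_. Copy 7 3)) (s(6 := unary ?h)) = Some (s(6 := [], 7 := unary (n * ?h)))"
  proof (rule run_For[where S = "\<lambda>ys. s(6 := unary ?h, 7 := unary (n * length ys))"])
    fix ys a zs
    show "run N (Copy 7 3) (s(6 := unary ?h, 7 := unary (n * length ys), 6 := zs)) =
      Some (s(6 := unary ?h, 7 := unary (n * length (ys @ [a])), 6 := zs))"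
      using assms by (simp add: unary_add) (simp add: fun_eq_iff)
  qed (use assms h in \<open>auto simp: fun_eq_iff unary_Suc\<close>)
  moreover have "run N (For 7 (Push 6)) (s(6 := [], 7 := unary (n * ?h))) = Some (s(6 := unary (n * ?h)))"
    using run_move[of 7 6 "s(6 := [], 7 := unary (n * ?h))" N] h assms by (auto simp: fun_eq_iff)
  moreover have "run N (Ones 6 c) (s(6 := unary (n * ?h))) = Some (s(6 := unary (c + n * ?h)))"
    by (subst run_Ones) auto
  ultimately show ?case by (simp add: id_def del: fun_upd_apply)
qed

lemma wf_Horner [simp]: "7 < k \<Longrightarrow> 1 < K \<Longrightarrow> wf_com k K (Horner cs)"
  by (induction cs) auto


section \<open>If P is contained in DAGR(P), then NP is contained in P\<close>

primrec Letters :: "nat \<Rightarrow> nat list \<Rightarrow> com" where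
  "Letters d [] = Skip"
| "Letters d (a # as) = Emit d 4 (Suc a) 5 ;; Letters d as"

lemma run_Letters:
  assumes "s 2 = []" "d > 5" "length (s 4) \<le> N" "length (s 5) \<le> N" "s 4 = unary i" "s 5 = unary j"
    and "s d = enc es"
  shows "run N (Letters d as) s = Some (s(d := enc (map (\<lambda>a. edge_seg (i, Suc a, j)) (rev as) @ es)))"
  using assms
proof (induction as arbitrary: s es)
  case (Cons a as)
  have "run N (Emit d 4 (Suc a) 5) s = Some (s(d := enc (edge_seg (i, Suc a, j) # es)))"
    using Cons.prems by (intro run_Emit) auto
  moreover have "run N (Letters d as) (s(d := enc (edge_seg (i, Suc a, j) # es))) =
    Some (s(d := enc (map (\<lambda>a. edge_seg (i, Suc a, j)) (rev as) @ edge_seg (i, Suc a, j) # es)))"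
    using Cons.prems by (subst Cons.IH[where es = "edge_seg (i, Suc a, j) # es"]) auto
  ultimately show ?case by (simp del: enc_simps fun_upd_apply)
qed auto

lemma wf_Letters: "(\<forall>a\<in>set as. a + 3 < K) \<Longrightarrow> d < k \<Longrightarrow> 5 < k \<Longrightarrow> wf_com k K (Letters d as)"
  by (induction as) auto

text \<open>In round \<open>j\<close>, registers 3, 4, 5 hold \<open>l\<close>,
  \<open>l + 1 + j\<close>, \<open>l + 2 + j\<close>, where \<open>l\<close> is the length of
  \<open>x\<close>. After the last round, 4 and 5 are the sink and the number of vertices, ready for
  the header.\<close>

definition Cert :: "nat list \<Rightarrow> (nat \<Rightarrow> nat) \<Rightarrow> nat list \<Rightarrow> com" where
  "Cert cs f As = Path 8 f ;; Horner cs ;; (Push 5 1 ;; Copy 5 4) ;;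
     For 6 (\<lambda>_. Emit 8 3 0 4 ;; Letters 8 As ;; Push 4 1 ;; Push 5 1) ;; Emit 8 3 0 4 ;;
     Push 8 0 ;; Copy 8 4 ;; Push 8 0 ;; Push 8 0 ;; Copy 8 5"

lemma run_Cert:
  fixes x cs As
  defines "l \<equiv> length x" and "P \<equiv> horner_sum id (length x) cs"
  assumes f: "map f x = map Suc x" and N: "horner_sum id (l + 1) cs \<le> N" "l + 2 + P \<le> N"
  shows "\<exists>s. run N (Cert cs f As) (ini x) = Some s \<and> s 1 = [] \<and>
    s 8 = instance_code (l + 2 + P) 0 (l + 1 + P) (cert_edges x As P)"
proof -
  let ?p = "map edge_seg (rev (path_edges (map Suc x)))"
  let ?s1 = "((\<lambda>_. []) :: state)(3 := unary l, 4 := unary (Suc l), 8 := enc ?p)"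
  have 1: "run N (Path 8 f) (ini x) = Some ?s1"
    using run_Path[of 8 x N f] f N by (simp add: l_def)
  have 2: "run N (Horner cs) ?s1 = Some (?s1(6 := unary P))"
    using N run_Horner[of ?s1 l N cs] by (simp add: P_def l_def)
  let ?S = "\<lambda>j. ((\<lambda>_. []) :: state)(3 := unary l, 4 := unary (l + 1 + j), 5 := unary (l + 2 + j), 6 := unary P,
      8 := enc (map edge_seg (layer_edges l As j) @ ?p))"
  have 3: "run N (Push 5 1 ;; Copy 5 4) (?s1(6 := unary P)) = Some (?S 0)"
    using N by (simp add: unary_append_one) (simp add: fun_eq_iff unary_Suc)
  let ?B = "Emit 8 3 0 4 ;; Letters 8 As ;; Push 4 1 ;; Push 5 1"
  have body: "run N ?B ((?S j)(6 := zs)) = Some ((?S (Suc j))(6 := zs))" if "j < P" for j zs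
  proof -
    let ?es = "map edge_seg (layer_edges l As j) @ ?p"
    let ?es' = "edge_seg (l, 0, l + 1 + j) # ?es"
    let ?s2 = "(?S j)(6 := zs, 8 := enc ?es')"
    have "run N (Emit 8 3 0 4) ((?S j)(6 := zs)) = Some ?s2"
      using that N by (intro run_Emit) auto
    moreover have "run N (Letters 8 As) ?s2 =
      Some (?s2(8 := enc (map (\<lambda>a. edge_seg (l + 1 + j, Suc a, l + 2 + j)) (rev As) @ ?es')))"
      using that N by (intro run_Letters) auto
    ultimately show ?thesis
      by (simp add: comp_def del: enc_simps) (simp add: fun_eq_iff unary_Suc comp_def)
  qed
  have 4: "run N (For 6 (\<lambda>_. ?B)) (?S 0) = Some ((?S P)(6 := []))"
  proof (rule run_For[where S = "\<lambda>ys. ?S (length ys)"])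
    fix ys a zs assume "?S 0 6 = ys @ a # zs"
    then have "length (unary P) = length (ys @ a # zs)" by simp
    then have "length ys < P" by simp
    then show "run N ?B ((?S (length ys))(6 := zs)) = Some ((?S (length (ys @ [a])))(6 := zs))"
      using body by simp
  qed (use N in \<open>auto simp del: enc_simps\<close>)
  have cert: "map edge_seg (cert_edges x As P) = edge_seg (l, 0, l + 1 + P) # map edge_seg (layer_edges l As P) @ ?p"
    unfolding cert_edges_def l_def by simp
  have 5: "run N (Emit 8 3 0 4) ((?S P)(6 := [])) = Some ((?S P)(6 := [], 8 := enc (map edge_seg (cert_edges x As P))))"
    unfolding cert using N by (subst run_Emit[where i = l and j = "l + 1 + P" and es = "map edge_seg (layer_edges l As P) @ ?p"]) auto
  let ?s5 = "(?S P)(6 := [], 8 := enc (map edge_seg (cert_edges x As P)))"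
  let ?s6 = "?s5(8 := instance_code (l + 2 + P) 0 (l + 1 + P) (cert_edges x As P))"
  have 6: "run N (Push 8 0 ;; Copy 8 4 ;; Push 8 0 ;; Push 8 0 ;; Copy 8 5) ?s5 = Some ?s6"
    using N by simp (simp add: instance_code_enc unary_Suc)
  have "run N (Cert cs f As) (ini x) = Some ?s6"
    unfolding Cert_def
    by (intro run_Seq[OF 1] run_Seq[OF 2] run_Seq[OF 3] run_Seq[OF 4] run_Seq[OF 5] 6)
  then show ?thesis by (intro exI[of _ ?s6]) simp
qed

lemma NP_subset_P:
  assumes "class_P \<subseteq> DAGR class_P"
  shows "class_NP \<subseteq> class_P"
proof
  fix A assume "A \<in> class_NP"
  then obtain R p where R: "R \<in> class_P" "A = {x. \<exists>y. length y \<le> poly p (length x) \<and> pair_word x y \<in> R}"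
    by (auto simp: class_NP_def)
  then obtain \<Sigma> where \<Sigma>: "finite \<Sigma>" "R \<subseteq> lists \<Sigma>" and D: "DAGREACH_lang \<Sigma> R \<in> class_P"
    using assms by (auto simp: DAGR_def)
  obtain m where m: "\<Sigma> \<subseteq> {..<m}" using \<Sigma>(1) finite_nat_iff_bounded by blast
  \<comment> \<open>\<open>pair_word\<close> shifts letters by one, so these are the letters that
    \<open>x\<close> and \<open>y\<close> can have.\<close>
  define \<Gamma> where "\<Gamma> = {a. Suc a \<in> \<Sigma>}"
  have fin: "finite \<Gamma>"
    using finite_vimageI[OF \<Sigma>(1), of Suc] by (simp add: \<Gamma>_def vimage_def)
  define As where "As = sorted_list_of_set \<Gamma>"
  have As: "set As = \<Gamma>" using fin by (simp add: As_def)
  have pair: "set x \<subseteq> \<Gamma> \<and> set y \<subseteq> \<Gamma> \<and> 0 \<in> \<Sigma>" if "pair_word x y \<in> R" for x y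
    using subsetD[OF \<Sigma>(2) that] by (auto simp: pair_word_def \<Gamma>_def)
  define f where "f = (\<lambda>a. if a < m then Suc a else 0)"
  \<comment> \<open>The first two summands cover the vertex numbers, at most
    \<open>length x + 2 + p(length x)\<close>. The third is the value of \<open>p\<close> at
    \<open>length x + 1\<close> that \<open>run_Horner\<close> asks for.\<close>
  define q where "q = [:2, 1:] + p + pcompose p [:1, 1:]"
  show "A \<in> class_P"
  proof (rule class_P_preimage[where c = "Cert (coeffs p) f As" and out = 8 and K = "m + 4" and q = q])
    show "A \<subseteq> lists \<Gamma>" using R(2) pair by blast
    show "wf_com (Suc 8) (m + 4) (Cert (coeffs p) f As)"
      using m As by (auto simp: Cert_def Path_def f_def \<Gamma>_def intro!: wf_Letters)
    fix x assume x: "x \<in> lists \<Gamma>"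
    let ?P = "poly p (length x)"
    let ?w = "instance_code (length x + 2 + ?P) 0 (length x + 1 + ?P) (cert_edges x As ?P)"
    have "map f x = map Suc x" using x m by (auto simp: f_def \<Gamma>_def)
    moreover have "horner_sum id (length x) (coeffs p) = ?P" "horner_sum id (length x + 1) (coeffs p) = poly p (length x + 1)"
      by (simp_all add: poly_def)
    ultimately obtain s where s: "run (poly q (length x)) (Cert (coeffs p) f As) (ini x) = Some s" "s 1 = []" "s 8 = ?w"
      using run_Cert[of f x "coeffs p" "poly q (length x)" As] by (auto simp: q_def poly_pcompose)
    have "?w \<in> DAGREACH_lang \<Sigma> R \<longleftrightarrow> 0 \<in> \<Sigma> \<and> (\<exists>ls\<in>R. \<exists>y\<in>lists \<Gamma>. ls = pair_word x y \<and> length y \<le> ?P)"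
      using x As valid_instance_cert_edges[of x \<Sigma> As ?P] twalk_cert_edges[of 0 x As ?P]
      by (simp add: instance_code_in_DAGREACH_lang \<Gamma>_def pair_word_def)
    also have "\<dots> \<longleftrightarrow> x \<in> A"
      unfolding R(2) using pair by (blast intro: lists_setI)
    finally show "\<exists>s. run (poly q (length x)) (Cert (coeffs p) f As) (ini x) = Some s \<and>
       (x \<in> A \<longleftrightarrow> s 1 = [] \<and> s 8 \<in> DAGREACH_lang \<Sigma> R)"
      using s by auto
  qed (use fin D m in \<open>auto simp: \<Gamma>_def\<close>)
qed

section \<open>Subroutines of the verifier\<close>

abbreviation Empty :: "nat \<Rightarrow> com \<Rightarrow> com \<Rightarrow> com" where
  "Empty r c d \<equiv> If r (\<lambda>t. t = None) c d"

lemma top_eq_None [simp]: "top xs = None \<longleftrightarrow> xs = []"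
  by (simp add: top_def split: list.splits)

lemma top_eq_Some: "top xs = Some a \<longleftrightarrow> (\<exists>ys. xs = a # ys)"
  by (auto simp: top_def split: list.splits)

text \<open>A register used as a flag records a failed check by becoming nonempty.\<close>

definition chk :: "bool \<Rightarrow> nat list \<Rightarrow> nat list" where
  "chk C e = (if C then e else if e = [] then [0] else e)"

lemma chk_simps [simp]:
  "chk True e = e" "chk C (chk D e) = chk (C \<and> D) e" "chk C e = [] \<longleftrightarrow> C \<and> e = []" "tl (chk C []) = []"
  by (auto simp: chk_def)

text \<open>Pushing only onto an empty flag means that repeated failures leave a single symbol, so
  one \<open>Pop\<close> resets a flag that started empty.\<close>

definition Fail :: "nat \<Rightarrow> com" where
  "Fail r = Empty r (Push r 0) Skip"

lemma run_Fail [simp]: "run N (Fail r) s = Some (s(r := chk False (s r)))"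
  by (auto simp: Fail_def chk_def)

lemma wf_Fail [simp]: "wf_com k K (Fail r) \<longleftrightarrow> r < k \<and> 0 < K"
  by (auto simp: Fail_def)

text \<open>The verdict goes to register 5 and not to the global flag 1, because in a search a
  mismatch is no failure. \<open>Assert\<close> passes it on where it is one.\<close>

definition Neq :: "nat \<Rightarrow> nat \<Rightarrow> com" where
  "Neq r1 r2 = Copy 3 r1 ;; Copy 4 r2 ;; For 3 (\<lambda>a. If 4 (\<lambda>t. t = Some a) (Pop 4) (Fail 5)) ;;
     Empty 4 Skip (Fail 5) ;; Clear 4"

text \<open>The content of register 4 in \<open>Neq\<close> after \<open>ys\<close> has been read.
  It is meaningful only while \<open>ys\<close> is a prefix of \<open>zs\<close>; after a mismatch
  the flag is already raised.\<close>

definition strip :: "nat list \<Rightarrow> nat list \<Rightarrow> nat list" where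
  "strip ys zs = foldl (\<lambda>b a. if top b = Some a then tl b else b) zs ys"

lemma strip_simps: "strip [] zs = zs" "strip (ys @ [a]) zs = (let b = strip ys zs in if top b = Some a then tl b else b)"
  by (simp_all add: strip_def Let_def)

lemma strip_append [simp]: "strip ys (ys @ zs) = zs"
  by (induction ys arbitrary: zs rule: rev_induct) (simp_all add: strip_simps)

lemma length_strip: "length (strip ys zs) \<le> length zs"
  by (induction ys rule: rev_induct) (auto simp: strip_simps Let_def)

lemma prefix_strip:
  "(\<exists>xs. zs = (ys @ [a]) @ xs) \<longleftrightarrow> (\<exists>xs. zs = ys @ xs) \<and> top (strip ys zs) = Some a"
  by (auto simp: top_eq_Some)

lemma run_Neq [simp]:
  assumes "s 2 = []" "s 3 = []" "s 4 = []" "s 5 = []" "r1 \<notin> {2,3,4,5}" "r2 \<notin> {2,3,4,5}"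
    and "length (s r1) \<le> N" "length (s r2) \<le> N"
  shows "run N (Neq r1 r2) s = Some (s(5 := chk (s r1 = s r2) []))"
proof -
  \<comment> \<open>The flag records whether the symbols read so far are a prefix of the second
    word. Equality then means a prefix with nothing left over.\<close>
  let ?S = "\<lambda>ys. s(3 := s r1, 4 := strip ys (s r2), 5 := chk (\<exists>xs. s r2 = ys @ xs) [])"
  have 1: "run N (For 3 (\<lambda>a. If 4 (\<lambda>t. t = Some a) (Pop 4) (Fail 5))) (s(3 := s r1, 4 := s r2)) =
    Some ((?S (s r1))(3 := []))"
  proof (rule run_For[where S = ?S])
    fix ys a zs
    show "run N (If 4 (\<lambda>t. t = Some a) (Pop 4) (Fail 5)) ((?S ys)(3 := zs)) = Some ((?S (ys @ [a]))(3 := zs))"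
      unfolding prefix_strip by (auto simp: strip_simps fun_eq_iff chk_def)
  qed (use assms in \<open>auto simp: strip_simps fun_eq_iff\<close>)
  have 2: "(\<exists>xs. s r2 = s r1 @ xs) \<and> strip (s r1) (s r2) = [] \<longleftrightarrow> s r1 = s r2"
    using strip_append[of "s r1" "[]"] by auto
  have 3: "length (strip (s r1) (s r2)) \<le> N" using length_strip assms(8) le_trans by blast
  have 4: "run N (Empty 4 Skip (Fail 5) ;; Clear 4) ((?S (s r1))(3 := [])) =
      Some (s(5 := chk (s r1 = s r2) []))"
    unfolding 2[symmetric] using assms 3 by (auto simp: fun_eq_iff chk_def)
  show ?thesis
    unfolding Neq_def
  proof (intro run_Seq)
    show "run N (Copy 3 r1) s = Some (s(3 := s r1))" using assms by auto
    show "run N (Copy 4 r2) (s(3 := s r1)) = Some (s(3 := s r1, 4 := s r2))" using assms by auto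
    show "run N (For 3 (\<lambda>a. If 4 (\<lambda>t. t = Some a) (Pop 4) (Fail 5))) (s(3 := s r1, 4 := s r2)) =
      Some ((?S (s r1))(3 := []))" by (rule 1)
    show "run N (Empty 4 Skip (Fail 5)) ((?S (s r1))(3 := [])) =
      Some ((?S (s r1))(3 := [], 5 := chk (s r1 = s r2) []))"
      unfolding 2[symmetric] by (auto simp: fun_eq_iff chk_def)
    show "run N (Clear 4) ((?S (s r1))(3 := [], 5 := chk (s r1 = s r2) [])) = Some (s(5 := chk (s r1 = s r2) []))"
      using assms 3 by (auto simp: fun_eq_iff)
  qed
qed

lemma wf_Neq [simp]: "wf_com k K (Neq r1 r2) \<longleftrightarrow> r1 < k \<and> r2 < k \<and> 5 < k \<and> 0 < K"
  by (auto simp: Neq_def)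

definition Assert :: com where
  "Assert = Empty 5 Skip (Fail 1) ;; Pop 5"

lemma run_Assert [simp]: "run N Assert s = Some (s(1 := chk (s 5 = []) (s 1), 5 := tl (s 5)))"
  by (auto simp: Assert_def fun_eq_iff)

lemma wf_Assert [simp]: "wf_com k K Assert \<longleftrightarrow> 5 < k \<and> 0 < K"
  by (auto simp: Assert_def)

definition Less :: "nat \<Rightarrow> nat \<Rightarrow> com" where
  "Less r1 r2 = Copy 3 r1 ;; Copy 4 r2 ;; For 3 (\<lambda>_. Pop 4) ;; Empty 4 (Fail 1) Skip ;; Clear 4"

lemma run_Less [simp]:
  assumes "s 2 = []" "s 3 = []" "s 4 = []" "r1 \<notin> {1,2,3,4}" "r2 \<notin> {1,2,3,4}"
    and "length (s r1) \<le> N" "length (s r2) \<le> N"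
  shows "run N (Less r1 r2) s = Some (s(1 := chk (length (s r1) < length (s r2)) (s 1)))"
proof -
  let ?s = "s(4 := drop (length (s r1)) (s r2))"
  have "run N (For 3 (\<lambda>_. Pop 4)) (s(3 := s r1, 4 := s r2)) = Some ?s"
    by (rule run_For[where S = "\<lambda>ys. s(3 := s r1, 4 := drop (length ys) (s r2))"])
      (use assms in \<open>auto simp: fun_eq_iff tl_drop drop_Suc\<close>)
  moreover have "run N (Empty 4 (Fail 1) Skip) ?s = Some (?s(1 := chk (length (s r1) < length (s r2)) (s 1)))"
    by (auto simp: chk_def)
  ultimately show ?thesis
    unfolding Less_def using assms by (simp add: fun_eq_iff)
qed

lemma wf_Less [simp]: "wf_com k K (Less r1 r2) \<longleftrightarrow> r1 < k \<and> r2 < k \<and> 4 < k \<and> 0 < K"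
  by (auto simp: Less_def)

definition SegFor :: "nat \<Rightarrow> nat \<Rightarrow> com \<Rightarrow> com" where
  "SegFor r d P = For r (\<lambda>a. if a = 0 then P else Push d a)"

text \<open>\<open>P\<close> is called with the reversal of each segment in register \<open>d\<close>.\<close>

lemma run_SegFor:
  assumes "r \<noteq> d" "length (s r) \<le> N" "s d = []" "S [] = s"
    and "\<And>ys zs. s r = ys @ 0 # zs \<Longrightarrow> length (rest ys) < length (s r) \<Longrightarrow>
      run N P ((S (segs ys))(d := rev (rest ys), r := zs)) = Some ((S (segs ys @ [rest ys]))(d := [], r := zs))"
    and "s' = (S (segs (s r)))(d := rev (rest (s r)), r := [])"
  shows "run N (SegFor r d P) s = Some s'"
  unfolding SegFor_def
proof (rule run_For[where S = "\<lambda>ys. (S (segs ys))(d := rev (rest ys))"])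
  fix ys a zs assume *: "s r = ys @ a # zs"
  show "run N (if a = 0 then P else Push d a) ((S (segs ys))(d := rev (rest ys), r := zs)) =
    Some ((S (segs (ys @ [a])))(d := rev (rest (ys @ [a])), r := zs))"
  proof (cases "a = 0")
    case True
    have "length (rest ys) < length (s r)"
      using length_rest[of ys] by (simp add: *)
    then show ?thesis using assms(5)[of ys zs] * True by simp
  next
    case False
    then show ?thesis using assms(1) by (auto simp: fun_eq_iff)
  qed
qed (use assms in auto)

lemma wf_SegFor: "r < k \<Longrightarrow> d < k \<Longrightarrow> wf_com k K P \<Longrightarrow> wf_com k K (SegFor r d P)"
  by (simp add: SegFor_def)

text \<open>Register 19 has the inverted sense here: it becomes nonempty once a match is
  found.\<close>

definition Member :: com where
  "Member = Copy 17 6 ;; SegFor 17 18 (Neq 18 22 ;; Empty 5 (Fail 19) Skip ;; Pop 5 ;; Clear 18) ;;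
     Clear 18 ;; Empty 19 (Fail 1) Skip ;; Pop 19"

lemma run_Member [simp]:
  assumes tmp: "\<forall>r\<in>{2,3,4,5,17,18,19}. s r = []" and "length (s 6) \<le> N" "length (s 22) \<le> N"
  shows "run N Member s = Some (s(1 := chk (rev (s 22) \<in> set (segs (s 6))) (s 1)))"
proof -
  let ?S = "\<lambda>ss. s(17 := s 6, 19 := chk (rev (s 22) \<notin> set ss) [])"
  let ?s = "(?S (segs (s 6)))(18 := rev (rest (s 6)), 17 := [])"
  have "run N (SegFor 17 18 (Neq 18 22 ;; Empty 5 (Fail 19) Skip ;; Pop 5 ;; Clear 18)) (s(17 := s 6)) = Some ?s"
  proof (rule run_SegFor[where S = ?S])
    fix ys zs :: "nat list" assume "length (rest ys) < length ((s(17 := s 6)) 17)"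
    then have "length (rest ys) \<le> N" using assms by simp
    then show "run N (Neq 18 22 ;; Empty 5 (Fail 19) Skip ;; Pop 5 ;; Clear 18)
       ((?S (segs ys))(18 := rev (rest ys), 17 := zs)) = Some ((?S (segs ys @ [rest ys]))(18 := [], 17 := zs))"
      using assms rev_swap[of "rest ys" "s 22"] by (cases "rest ys = rev (s 22)") (auto simp: fun_eq_iff chk_def)
  qed (use assms in \<open>auto simp: fun_eq_iff\<close>)
  moreover have "length (rest (s 6)) \<le> N" using assms(2) length_rest le_trans by blast
  then have "run N (Clear 18 ;; Empty 19 (Fail 1) Skip ;; Pop 19) ?s = Some (s(1 := chk (rev (s 22) \<in> set (segs (s 6))) (s 1)))"
    using tmp by (auto simp: fun_eq_iff chk_def)
  ultimately show ?thesis
    unfolding Member_def using assms by simp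
qed

lemma find_snoc: "find P (xs @ [x]) = (case find P xs of None \<Rightarrow> if P x then Some x else None | Some y \<Rightarrow> Some y)"
  by (induction xs) auto

text \<open>Register 19 is empty until one of the two words is met, then frozen: 2 if the head
  (register 10) came first, 1 if the tail (register 12) did.\<close>

definition Precedes :: com where
  "Precedes = Copy 17 7 ;; SegFor 17 18 (Empty 19 (Neq 18 10 ;; Empty 5 (Push 19 2) Skip ;; Pop 5 ;;
       Empty 19 (Neq 18 12 ;; Empty 5 (Push 19 1) Skip ;; Pop 5) Skip) Skip ;; Clear 18) ;;
     Clear 18 ;; If 19 (\<lambda>t. t = Some 1) Skip (Fail 1) ;; Clear 19"

lemma run_Precedes [simp]:
  assumes tmp: "\<forall>r\<in>{2,3,4,5,17,18,19}. s r = []"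
    and N: "length (s 7) \<le> N" "length (s 10) \<le> N" "length (s 12) \<le> N" "1 \<le> N"
  shows "run N Precedes s = Some (s(1 := chk (precedes (segs (s 7)) (s 12) (s 10)) (s 1)))"
proof -
  let ?f = "\<lambda>ss. find (\<lambda>e. rev e = s 10 \<or> rev e = s 12) ss"
  let ?st = "\<lambda>ss. case ?f ss of None \<Rightarrow> [] | Some e \<Rightarrow> [if rev e = s 10 then 2 else 1]"
  let ?S = "\<lambda>ss. s(17 := s 7, 19 := ?st ss)"
  let ?B = "Empty 19 (Neq 18 10 ;; Empty 5 (Push 19 2) Skip ;; Pop 5 ;;
       Empty 19 (Neq 18 12 ;; Empty 5 (Push 19 1) Skip ;; Pop 5) Skip) Skip ;; Clear 18"
  let ?s = "(?S (segs (s 7)))(18 := rev (rest (s 7)), 17 := [])"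
  have "run N (SegFor 17 18 ?B) (s(17 := s 7)) = Some ?s"
  proof (rule run_SegFor[where S = ?S])
    fix ys zs :: "nat list" assume "length (rest ys) < length ((s(17 := s 7)) 17)"
    then have "length (rest ys) \<le> N" using assms by simp
    then show "run N ?B ((?S (segs ys))(18 := rev (rest ys), 17 := zs)) = Some ((?S (segs ys @ [rest ys]))(18 := [], 17 := zs))"
      using assms by (cases "?f (segs ys)") (auto simp: fun_eq_iff find_snoc)
  qed (use assms in \<open>auto simp: fun_eq_iff\<close>)
  moreover have "length (rest (s 7)) \<le> N" using N(1) length_rest le_trans by blast
  then have "run N (Clear 18 ;; If 19 (\<lambda>t. t = Some 1) Skip (Fail 1) ;; Clear 19) ?s =
      Some (s(1 := chk (precedes (segs (s 7)) (s 12) (s 10)) (s 1)))"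
    using tmp N by (cases "?f (segs (s 7))") (auto simp: fun_eq_iff precedes_def)
  ultimately show ?thesis
    unfolding Precedes_def using assms by simp
qed

lemma wf_Member [simp]: "wf_com k K Member \<longleftrightarrow> 22 < k \<and> 0 < K"
  by (auto simp: Member_def SegFor_def)

lemma wf_Precedes: "19 < k \<Longrightarrow> 2 < K \<Longrightarrow> wf_com k K Precedes"
  by (auto simp: Precedes_def SegFor_def)

section \<open>Parsing segments\<close>

text \<open>The segment is read backwards, so ones before the label belong to the head and ones
  after it to the tail. A second label or a foreign symbol only clears the verdict.\<close>

fun pstep :: "nat set \<Rightarrow> nat list \<times> nat list \<times> nat list \<times> bool \<Rightarrow> nat \<Rightarrow> nat list \<times> nat list \<times> nat list \<times> bool" where
  "pstep \<Sigma> (v, l, u, ok) a =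
     (if a = 1 then if l = [] then (1 # v, l, u, ok) else (v, l, 1 # u, ok)
      else if a \<in> (+) 2 ` \<Sigma> \<and> l = [] then (v, [a], u, ok) else (v, l, u, False))"

definition parse :: "nat set \<Rightarrow> nat list \<Rightarrow> nat list \<times> nat list \<times> nat list \<times> bool" where
  "parse \<Sigma> xs = foldl (pstep \<Sigma>) ([], [], [], True) xs"

text \<open>The argument of the following functions is a reversed segment.\<close>

definition head_of :: "nat set \<Rightarrow> nat list \<Rightarrow> nat list" where "head_of \<Sigma> xs = fst (parse \<Sigma> xs)"
definition label_of :: "nat set \<Rightarrow> nat list \<Rightarrow> nat list" where "label_of \<Sigma> xs = fst (snd (parse \<Sigma> xs))"
definition tail_of :: "nat set \<Rightarrow> nat list \<Rightarrow> nat list" where "tail_of \<Sigma> xs = fst (snd (snd (parse \<Sigma> xs)))"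
definition parse_ok :: "nat set \<Rightarrow> nat list \<Rightarrow> bool" where "parse_ok \<Sigma> xs = snd (snd (snd (parse \<Sigma> xs)))"

lemmas parse_defs = head_of_def label_of_def tail_of_def parse_ok_def

lemma parse_simps:
  "head_of \<Sigma> [] = []" "label_of \<Sigma> [] = []" "tail_of \<Sigma> [] = []" "parse_ok \<Sigma> [] = True"
  "head_of \<Sigma> (xs @ [a]) = (if a = 1 \<and> label_of \<Sigma> xs = [] then 1 # head_of \<Sigma> xs else head_of \<Sigma> xs)"
  "label_of \<Sigma> (xs @ [a]) = (if a \<noteq> 1 \<and> a \<in> (+) 2 ` \<Sigma> \<and> label_of \<Sigma> xs = [] then [a] else label_of \<Sigma> xs)"
  "tail_of \<Sigma> (xs @ [a]) = (if a = 1 \<and> label_of \<Sigma> xs \<noteq> [] then 1 # tail_of \<Sigma> xs else tail_of \<Sigma> xs)"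
  "parse_ok \<Sigma> (xs @ [a]) \<longleftrightarrow> parse_ok \<Sigma> xs \<and> (a = 1 \<or> a \<in> (+) 2 ` \<Sigma> \<and> label_of \<Sigma> xs = [])"
proof -
  obtain v l u ok where p: "foldl (pstep \<Sigma>) ([], [], [], True) xs = (v, l, u, ok)"
    by (metis prod_cases4)
  show "head_of \<Sigma> [] = []" "label_of \<Sigma> [] = []" "tail_of \<Sigma> [] = []" "parse_ok \<Sigma> [] = True"
    by (simp_all add: parse_defs parse_def)
  show
    "head_of \<Sigma> (xs @ [a]) = (if a = 1 \<and> label_of \<Sigma> xs = [] then 1 # head_of \<Sigma> xs else head_of \<Sigma> xs)"
    "label_of \<Sigma> (xs @ [a]) = (if a \<noteq> 1 \<and> a \<in> (+) 2 ` \<Sigma> \<and> label_of \<Sigma> xs = [] then [a] else label_of \<Sigma> xs)"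
    "tail_of \<Sigma> (xs @ [a]) = (if a = 1 \<and> label_of \<Sigma> xs \<noteq> [] then 1 # tail_of \<Sigma> xs else tail_of \<Sigma> xs)"
    "parse_ok \<Sigma> (xs @ [a]) \<longleftrightarrow> parse_ok \<Sigma> xs \<and> (a = 1 \<or> a \<in> (+) 2 ` \<Sigma> \<and> label_of \<Sigma> xs = [])"
    by (simp_all add: parse_defs parse_def p)
qed

lemma length_segs: "e \<in> set (segs w) \<Longrightarrow> length e \<le> length w"
proof (induction w rule: rev_induct)
  case (snoc a w)
  then show ?case using length_rest[of w] by (auto split: if_splits)
qed simp

lemma length_parse:
  "length (head_of \<Sigma> xs) \<le> length xs" "length (tail_of \<Sigma> xs) \<le> length xs" "length (label_of \<Sigma> xs) \<le> 1"
  by (induction xs rule: rev_induct) (auto simp: parse_simps)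

lemma parse_unary:
  "head_of \<Sigma> (unary k) = unary k" "label_of \<Sigma> (unary k) = []" "tail_of \<Sigma> (unary k) = []" "parse_ok \<Sigma> (unary k)"
proof (induction k)
  case (Suc k)
  have *: "unary (Suc k) = unary k @ [1]" using unary_snoc[of k "[]"] by (simp add: unary_Suc)
  { case 1 then show ?case unfolding * using Suc by (simp add: parse_simps) (simp add: unary_Suc unary_snoc[symmetric, of k "[]", simplified]) }
  { case 2 then show ?case unfolding * using Suc by (simp add: parse_simps) }
  { case 3 then show ?case unfolding * using Suc by (simp add: parse_simps) }
  { case 4 then show ?case unfolding * using Suc by (simp add: parse_simps) }
qed (simp_all add: unary_Suc parse_simps)

lemma rev_edge_seg: "rev (edge_seg (u, a, v)) = unary v @ (a + 2) # unary u"
  by (simp add: edge_seg_def)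

lemma parse_edge_seg:
  assumes "a \<in> \<Sigma>"
  shows "head_of \<Sigma> (rev (edge_seg (u, a, v))) = unary v" "label_of \<Sigma> (rev (edge_seg (u, a, v))) = [a + 2]"
    "tail_of \<Sigma> (rev (edge_seg (u, a, v))) = unary u" "parse_ok \<Sigma> (rev (edge_seg (u, a, v)))"
proof (induction u)
  case 0
  have *: "rev (edge_seg (0, a, v)) = unary v @ [a + 2]" by (simp add: rev_edge_seg unary_Suc)
  { case 1 then show ?case unfolding * by (simp only: parse_simps parse_unary) (use assms in auto) }
  { case 2 then show ?case unfolding * by (simp only: parse_simps parse_unary) (use assms in auto) }
  { case 3 then show ?case unfolding * by (simp only: parse_simps parse_unary) (auto simp: unary_Suc) }
  { case 4 then show ?case unfolding * by (simp only: parse_simps parse_unary) (use assms in auto) }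
next
  case (Suc u)
  have *: "rev (edge_seg (Suc u, a, v)) = rev (edge_seg (u, a, v)) @ [1]"
    using unary_snoc[of u "[]"] by (simp add: rev_edge_seg unary_Suc)
  { case 1 then show ?case unfolding * using Suc by (simp add: parse_simps) }
  { case 2 then show ?case unfolding * using Suc by (simp add: parse_simps) }
  { case 3 then show ?case unfolding * using Suc by (simp add: parse_simps unary_Suc) }
  { case 4 then show ?case unfolding * using Suc by (simp add: parse_simps) }
qed

text \<open>An accepted word can be extended only by a 1 or by a first label. So two shapes arise, a
  number and an arc, and the label component tells them apart.\<close>

lemma parse_okD:
  "parse_ok \<Sigma> xs \<Longrightarrow> (label_of \<Sigma> xs = [] \<and> (\<exists>k. xs = unary k)) \<or>
    (\<exists>u v. \<exists>a\<in>\<Sigma>. label_of \<Sigma> xs = [a + 2] \<and> xs = rev (edge_seg (u, a, v)))"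
proof (induction xs rule: rev_induct)
  case (snoc b xs)
  then have ok: "parse_ok \<Sigma> xs" and b: "b = 1 \<or> b \<in> (+) 2 ` \<Sigma> \<and> label_of \<Sigma> xs = []"
    by (simp_all add: parse_simps)
  from snoc.IH[OF ok] show ?case
  proof (elim disjE conjE exE bexE)
    fix k assume *: "label_of \<Sigma> xs = []" "xs = unary k"
    show ?thesis
    proof (cases "b = 1")
      case True
      then have "xs @ [b] = unary (Suc k)" using unary_snoc[of k "[]"] by (simp add: * unary_Suc)
      moreover have "label_of \<Sigma> (xs @ [b]) = []" using * True by (simp add: parse_simps)
      ultimately show ?thesis by blast
    next
      case False
      then obtain a where a: "a \<in> \<Sigma>" "b = a + 2" using b by auto
      then have "xs @ [b] = rev (edge_seg (0, a, k))" by (simp add: * rev_edge_seg unary_Suc)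
      then show ?thesis using parse_edge_seg(2)[OF a(1), of 0 k] a(1) by metis
    qed
  next
    fix u v a assume *: "a \<in> \<Sigma>" "label_of \<Sigma> xs = [a + 2]" "xs = rev (edge_seg (u, a, v))"
    then have "b = 1" using b by simp
    then have "xs @ [b] = rev (edge_seg (Suc u, a, v))"
      using unary_snoc[of u "[]"] by (simp add: * rev_edge_seg unary_Suc)
    then show ?thesis using parse_edge_seg(2)[OF *(1), of "Suc u" v] *(1) by metis
  qed
qed (auto simp: parse_simps unary_def)

lemma parse_ok_unary:
  assumes "parse_ok \<Sigma> (rev e)" "label_of \<Sigma> (rev e) = []"
  obtains k where "e = unary k" "head_of \<Sigma> (rev e) = unary k"
  using parse_okD[OF assms(1)] assms(2) parse_unary(1) by (metis list.distinct(1) rev_rev_ident rev_unary)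

lemma parse_ok_edge:
  assumes "parse_ok \<Sigma> (rev e)" "label_of \<Sigma> (rev e) \<noteq> []"
  obtains u a v where "a \<in> \<Sigma>" "e = edge_seg (u, a, v)" "head_of \<Sigma> (rev e) = unary v"
    "tail_of \<Sigma> (rev e) = unary u" "label_of \<Sigma> (rev e) = [a + 2]"
  using parse_okD[OF assms(1)] assms(2) parse_edge_seg by (metis rev_rev_ident)

definition Parse :: "nat set \<Rightarrow> com" where
  "Parse \<Sigma> = For 9 (\<lambda>a. if a = 1 then Empty 11 (Push 10 1) (Push 12 1)
     else if a \<in> (+) 2 ` \<Sigma> then Empty 11 (Push 11 a) (Fail 1) else Fail 1)"

lemma run_Parse [simp]:
  assumes "s 10 = []" "s 11 = []" "s 12 = []" "length (s 9) \<le> N"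
  shows "run N (Parse \<Sigma>) s = Some (s(9 := [], 10 := head_of \<Sigma> (s 9), 11 := label_of \<Sigma> (s 9),
    12 := tail_of \<Sigma> (s 9), 1 := chk (parse_ok \<Sigma> (s 9)) (s 1)))"
  unfolding Parse_def
  by (rule run_For[where S = "\<lambda>ys. s(10 := head_of \<Sigma> ys, 11 := label_of \<Sigma> ys,
    12 := tail_of \<Sigma> ys, 1 := chk (parse_ok \<Sigma> ys) (s 1))"])
    (use assms in \<open>auto simp: parse_simps fun_eq_iff\<close>)

lemma wf_Parse: "12 < k \<Longrightarrow> 1 < K \<Longrightarrow> wf_com k K (Parse \<Sigma>)"
  by (auto simp: Parse_def)


section \<open>Checking the instance\<close>

definition Number :: "nat \<Rightarrow> com" where
  "Number r = Empty 11 Skip (Fail 1) ;; Copy r 10 ;; Pop 13"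

definition Arc :: com where
  "Arc = Empty 11 (Fail 1) Skip ;; Precedes ;; Less 12 14 ;; Less 10 14"

text \<open>Register 13 starts as \<open>[0, 1, 2]\<close>; its top says which of \<open>n\<close>,
  \<open>s\<close>, \<open>t\<close> comes next, and once it is empty all segments must be
  arcs.\<close>

definition Instance :: "nat set \<Rightarrow> com" where
  "Instance \<Sigma> = Parse \<Sigma> ;; If 13 (\<lambda>t. t = Some 0) (Number 14) (If 13 (\<lambda>t. t = Some 1) (Number 15)
     (If 13 (\<lambda>t. t = Some 2) (Number 16) Arc)) ;; Clear 10 ;; Clear 11 ;; Clear 12"

text \<open>A number has no label, so the parser leaves it in the head component.\<close>

definition header :: "nat set \<Rightarrow> nat list list \<Rightarrow> nat \<Rightarrow> nat list" where
  "header \<Sigma> ss i = (if i < length ss then head_of \<Sigma> (rev (ss ! i)) else [])"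

definition seg_ok :: "nat set \<Rightarrow> nat list list \<Rightarrow> nat list \<Rightarrow> nat \<Rightarrow> nat list \<Rightarrow> bool" where
  "seg_ok \<Sigma> Y n i e \<longleftrightarrow> parse_ok \<Sigma> (rev e) \<and>
     (if i < 3 then label_of \<Sigma> (rev e) = []
      else label_of \<Sigma> (rev e) \<noteq> [] \<and> precedes Y (tail_of \<Sigma> (rev e)) (head_of \<Sigma> (rev e)) \<and>
        length (tail_of \<Sigma> (rev e)) < length n \<and> length (head_of \<Sigma> (rev e)) < length n)"

definition segs_ok :: "nat set \<Rightarrow> nat list list \<Rightarrow> nat list list \<Rightarrow> bool" where
  "segs_ok \<Sigma> Y ss \<longleftrightarrow> (\<forall>i<length ss. seg_ok \<Sigma> Y (header \<Sigma> ss 0) i (ss ! i))"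

lemma header_snoc: "header \<Sigma> (ss @ [e]) i = (if i = length ss then head_of \<Sigma> (rev e) else header \<Sigma> ss i)"
  by (auto simp: header_def nth_append)

text \<open>This makes the check incremental: \<open>n\<close> is fixed by the first segment, and
  that segment itself, having index below 3, is checked without reference to
  \<open>n\<close>.\<close>

lemma segs_ok_snoc: "segs_ok \<Sigma> Y (ss @ [e]) \<longleftrightarrow> segs_ok \<Sigma> Y ss \<and> seg_ok \<Sigma> Y (header \<Sigma> ss 0) (length ss) e"
proof (cases "ss = []")
  case True
  then show ?thesis by (simp add: segs_ok_def seg_ok_def)
next
  case False
  then have "header \<Sigma> (ss @ [e]) 0 = header \<Sigma> ss 0" by (simp add: header_snoc)
  then show ?thesis unfolding segs_ok_def by (auto simp: less_Suc_eq nth_append)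
qed

lemma run_Number [simp]:
  assumes "s 2 = []" "s r = []" "r \<notin> {1,2,10,11,13}" "length (s 10) \<le> N"
  shows "run N (Number r) s = Some (s(1 := chk (s 11 = []) (s 1), r := s 10, 13 := tl (s 13)))"
  using assms by (auto simp: Number_def fun_eq_iff)

lemma run_Arc [simp]:
  assumes "\<forall>r\<in>{2,3,4,5,17,18,19}. s r = []"
    and "length (s 7) \<le> N" "length (s 10) \<le> N" "length (s 12) \<le> N" "length (s 14) \<le> N" "1 \<le> N"
  shows "run N Arc s = Some (s(1 := chk (s 11 \<noteq> [] \<and> precedes (segs (s 7)) (s 12) (s 10) \<and>
    length (s 12) < length (s 14) \<and> length (s 10) < length (s 14)) (s 1)))"
proof -
  have 1: "run N (Empty 11 (Fail 1) Skip) s = Some (s(1 := chk (s 11 \<noteq> []) (s 1)))"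
    by simp
  show ?thesis
    unfolding Arc_def by (rule run_Seq[OF 1]) (use assms in \<open>simp add: conj_ac\<close>)
qed

lemma run_Instance_number:
  assumes tmp: "\<forall>r\<in>{2,10,11,12,14+k}. s r = []" and N: "length (s 9) \<le> N" "1 \<le> N"
    and k: "k < 3" "s 13 = k # ks"
  shows "run N (Instance \<Sigma>) s = Some (s(9 := [], 13 := ks, 14 + k := head_of \<Sigma> (s 9),
    1 := chk (parse_ok \<Sigma> (s 9) \<and> label_of \<Sigma> (s 9) = []) (s 1)))"
proof -
  let ?s = "s(9 := [], 10 := head_of \<Sigma> (s 9), 11 := label_of \<Sigma> (s 9),
    12 := tail_of \<Sigma> (s 9), 1 := chk (parse_ok \<Sigma> (s 9)) (s 1))"
  let ?s' = "?s(1 := chk (label_of \<Sigma> (s 9) = []) (?s 1), 14 + k := head_of \<Sigma> (s 9), 13 := ks)"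
  have len: "length (head_of \<Sigma> (s 9)) \<le> N" "length (tail_of \<Sigma> (s 9)) \<le> N" "length (label_of \<Sigma> (s 9)) \<le> N"
    using length_parse[of \<Sigma> "s 9"] N by auto
  have "run N (Parse \<Sigma>) s = Some ?s" using tmp N by simp
  moreover have "run N (If 13 (\<lambda>t. t = Some 0) (Number 14) (If 13 (\<lambda>t. t = Some 1) (Number 15)
     (If 13 (\<lambda>t. t = Some 2) (Number 16) Arc))) ?s = run N (Number (14 + k)) ?s"
  proof -
    have "k = 0 \<or> k = 1 \<or> k = 2" using k(1) by linarith
    then show ?thesis using k(2) by auto
  qed
  moreover have "run N (Number (14 + k)) ?s = Some ?s'"
    using tmp k len by (subst run_Number) auto
  moreover have "run N (Clear 10 ;; Clear 11 ;; Clear 12) ?s' = Some (s(9 := [], 13 := ks, 14 + k := head_of \<Sigma> (s 9),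
    1 := chk (parse_ok \<Sigma> (s 9) \<and> label_of \<Sigma> (s 9) = []) (s 1)))"
    using tmp len by (simp, simp add: fun_eq_iff conj_commute)
  ultimately show ?thesis unfolding Instance_def by simp
qed

lemma run_Instance_arc:
  assumes tmp: "\<forall>r\<in>{2,3,4,5,10,11,12,17,18,19}. s r = []"
    and N: "length (s 9) \<le> N" "length (s 7) \<le> N" "length (s 14) \<le> N" "1 \<le> N"
    and k: "s 13 = []"
  shows "run N (Instance \<Sigma>) s = Some (s(9 := [],
    1 := chk (parse_ok \<Sigma> (s 9) \<and> label_of \<Sigma> (s 9) \<noteq> [] \<and>
      precedes (segs (s 7)) (tail_of \<Sigma> (s 9)) (head_of \<Sigma> (s 9)) \<and>
      length (tail_of \<Sigma> (s 9)) < length (s 14) \<and> length (head_of \<Sigma> (s 9)) < length (s 14)) (s 1)))"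
proof -
  let ?s = "s(9 := [], 10 := head_of \<Sigma> (s 9), 11 := label_of \<Sigma> (s 9),
    12 := tail_of \<Sigma> (s 9), 1 := chk (parse_ok \<Sigma> (s 9)) (s 1))"
  let ?C = "label_of \<Sigma> (s 9) \<noteq> [] \<and> precedes (segs (s 7)) (tail_of \<Sigma> (s 9)) (head_of \<Sigma> (s 9)) \<and>
      length (tail_of \<Sigma> (s 9)) < length (s 14) \<and> length (head_of \<Sigma> (s 9)) < length (s 14)"
  let ?s' = "?s(1 := chk ?C (?s 1))"
  have len: "length (head_of \<Sigma> (s 9)) \<le> N" "length (tail_of \<Sigma> (s 9)) \<le> N" "length (label_of \<Sigma> (s 9)) \<le> N"
    using length_parse[of \<Sigma> "s 9"] N by auto
  have "run N (Parse \<Sigma>) s = Some ?s" using tmp N by simp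
  moreover have "run N (If 13 (\<lambda>t. t = Some 0) (Number 14) (If 13 (\<lambda>t. t = Some 1) (Number 15)
     (If 13 (\<lambda>t. t = Some 2) (Number 16) Arc))) ?s = run N Arc ?s"
    using k by simp
  moreover have "run N Arc ?s = Some ?s'"
    using tmp N len by (subst run_Arc) auto
  moreover have "run N (Clear 10 ;; Clear 11 ;; Clear 12) ?s' = Some (s(9 := [], 1 := chk (parse_ok \<Sigma> (s 9) \<and> ?C) (s 1)))"
    using tmp len by (simp, simp add: fun_eq_iff conj_ac)
  ultimately show ?thesis unfolding Instance_def by simp
qed

lemma run_Instances:
  assumes tmp: "\<forall>r\<in>{2,3,4,5,9,10,11,12,13,14,15,16,17,18,19}. s r = []"
    and N: "length w \<le> N" "length (s 7) \<le> N" "1 \<le> N" and w: "s 8 = w"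
  shows "run N (SegFor 8 9 (Instance \<Sigma>)) (s(13 := [0,1,2])) = Some (s(13 := drop (length (segs w)) [0,1,2],
    14 := header \<Sigma> (segs w) 0, 15 := header \<Sigma> (segs w) 1, 16 := header \<Sigma> (segs w) 2,
    1 := chk (segs_ok \<Sigma> (segs (s 7)) (segs w)) (s 1), 9 := rev (rest w), 8 := []))"
proof -
  let ?S = "\<lambda>ss. s(13 := drop (length ss) [0,1,2],
    14 := header \<Sigma> ss 0, 15 := header \<Sigma> ss 1, 16 := header \<Sigma> ss 2,
    1 := chk (segs_ok \<Sigma> (segs (s 7)) ss) (s 1))"
  show ?thesis
  proof (rule run_SegFor[where S = ?S])
    fix ys zs assume ys: "(s(13 := [0,1,2])) 8 = ys @ 0 # zs" and "length (rest ys) < length ((s(13 := [0,1,2])) 8)"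
    then have len: "length (rest ys) \<le> N" using w N by simp
    let ?e = "rest ys" and ?ss = "segs ys"
    let ?s = "(?S ?ss)(9 := rev ?e, 8 := zs)"
    have hdr: "length (header \<Sigma> ?ss 0) \<le> N"
    proof -
      have "length ys \<le> N" using ys w N by simp
      then have "length e \<le> N" if "e \<in> set ?ss" for e
        using length_segs[OF that] by simp
      then have "?ss \<noteq> [] \<Longrightarrow> length (?ss ! 0) \<le> N" by simp
      then show ?thesis
        using length_parse(1)[of \<Sigma> "rev (?ss ! 0)"] by (auto simp: header_def)
    qed
    show "run N (Instance \<Sigma>) ?s = Some ((?S (?ss @ [?e]))(9 := [], 8 := zs))"
    proof (cases "length ?ss < 3")
      case True
      then have d: "drop (length ?ss) [0,1,2] = length ?ss # drop (Suc (length ?ss)) [0,1,2]"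
        by (auto simp: less_Suc_eq numeral_3_eq_3)
      have k: "?s 13 = length ?ss # drop (Suc (length ?ss)) [0,1,2]" using d by simp
      have z: "?s (14 + length ?ss) = []"
      proof -
        have "length ?ss = 0 \<or> length ?ss = 1 \<or> length ?ss = 2" using True by linarith
        then show ?thesis by (elim disjE) (simp_all add: header_def)
      qed
      have "?s r = []" if "r \<in> {2, 10, 11, 12, 14 + length ?ss}" for r
      proof (cases "r = 14 + length ?ss")
        case True
        then show ?thesis using z by (simp only:)
      next
        case False
        then show ?thesis using that tmp by auto
      qed
      then have "run N (Instance \<Sigma>) ?s = Some (?s(9 := [], 13 := drop (Suc (length ?ss)) [0,1,2],
          14 + length ?ss := head_of \<Sigma> (?s 9), 1 := chk (parse_ok \<Sigma> (?s 9) \<and> label_of \<Sigma> (?s 9) = []) (?s 1)))"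
        using len N by (intro run_Instance_number[where s = ?s and k = "length ?ss"] True k) (blast, simp_all)
      also have "\<dots> = Some ((?S (?ss @ [?e]))(9 := [], 8 := zs))"
      proof -
        have "length ?ss = 0 \<or> length ?ss = 1 \<or> length ?ss = 2" using True by linarith
        then show ?thesis
          by (elim disjE) (simp_all add: fun_eq_iff segs_ok_snoc segs_ok_snoc[of _ _ "[]", simplified] seg_ok_def
              header_snoc header_snoc[of _ "[]", simplified] conj_commute)
      qed
      finally show ?thesis .
    next
      case False
      have "run N (Instance \<Sigma>) ?s = Some (?s(9 := [], 1 := chk (parse_ok \<Sigma> (?s 9) \<and> label_of \<Sigma> (?s 9) \<noteq> [] \<and>
          precedes (segs (?s 7)) (tail_of \<Sigma> (?s 9)) (head_of \<Sigma> (?s 9)) \<and>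
          length (tail_of \<Sigma> (?s 9)) < length (?s 14) \<and> length (head_of \<Sigma> (?s 9)) < length (?s 14)) (?s 1)))"
        using len N tmp False hdr by (intro run_Instance_arc) auto
      also have "\<dots> = Some ((?S (?ss @ [?e]))(9 := [], 8 := zs))"
      proof -
        have "0 < length ?ss" "1 < length ?ss" "2 < length ?ss" "?ss \<noteq> []" using False by auto
        then show ?thesis
          using False by (simp add: fun_eq_iff segs_ok_snoc seg_ok_def header_snoc conj_ac)
      qed
      finally show ?thesis .
    qed
  qed (use N w tmp in \<open>auto simp: fun_eq_iff header_def segs_ok_def\<close>)
qed

section \<open>Checking the walk\<close>

text \<open>An arc of the walk is compared with whole segments of the instance, so the instance is
  not parsed again. The label is a list of at most one symbol, hence \<open>map\<close>; subtracting
  2 undoes the shift in the code.\<close>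

fun walk_step :: "nat set \<Rightarrow> nat list list \<Rightarrow> nat list \<times> nat list \<times> bool \<Rightarrow> nat list \<Rightarrow> nat list \<times> nat list \<times> bool" where
  "walk_step \<Sigma> X (c, l, ok) e =
     (if label_of \<Sigma> (rev e) = [] then (c, l, ok \<and> parse_ok \<Sigma> (rev e))
      else (head_of \<Sigma> (rev e), rev (map (\<lambda>a. a - 2) (label_of \<Sigma> (rev e))) @ l,
        ok \<and> parse_ok \<Sigma> (rev e) \<and> e \<in> set X \<and> tail_of \<Sigma> (rev e) = c))"

definition Walk_Step :: "nat set \<Rightarrow> com" where
  "Walk_Step \<Sigma> = Copy 22 9 ;; Parse \<Sigma> ;;
     Empty 11 Skip (Member ;; Neq 12 20 ;; Assert ;; Clear 20 ;; Copy 20 10 ;; For 11 (\<lambda>a. Push 21 (a - 2))) ;;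
     Clear 10 ;; Clear 11 ;; Clear 12 ;; Clear 22"

lemma run_labels:
  "length (s 11) \<le> N \<Longrightarrow>
    run N (For 11 (\<lambda>a. Push 21 (a - 2))) s = Some (s(11 := [], 21 := rev (map (\<lambda>a. a - 2) (s 11)) @ s 21))"
  by (rule run_For[where S = "\<lambda>ys. s(21 := rev (map (\<lambda>a. a - 2) ys) @ s 21)"]) (auto simp: fun_eq_iff)

text \<open>The step starts from \<open>True\<close> because \<open>chk\<close> on register 1 forms
  the conjunction with earlier verdicts.\<close>

lemma run_Walk_Step:
  assumes tmp: "\<forall>r\<in>{2,3,4,5,10,11,12,17,18,19,22}. s r = []"
    and N: "length (s 9) \<le> N" "length (s 6) \<le> N" "length (s 20) \<le> N" "1 \<le> N"
    and step: "walk_step \<Sigma> (segs (s 6)) (s 20, s 21, True) (rev (s 9)) = (c, l, ok)"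
  shows "run N (Walk_Step \<Sigma>) s = Some (s(9 := [], 20 := c, 21 := l, 1 := chk ok (s 1)))"
proof -
  let ?s = "s(22 := s 9, 9 := [], 10 := head_of \<Sigma> (s 9), 11 := label_of \<Sigma> (s 9),
    12 := tail_of \<Sigma> (s 9), 1 := chk (parse_ok \<Sigma> (s 9)) (s 1))"
  have len: "length (head_of \<Sigma> (s 9)) \<le> N" "length (tail_of \<Sigma> (s 9)) \<le> N" "length (label_of \<Sigma> (s 9)) \<le> N"
    using length_parse[of \<Sigma> "s 9"] N by auto
  have 1: "run N (Copy 22 9) s = Some (s(22 := s 9))" using tmp N by simp
  have 2: "run N (Parse \<Sigma>) (s(22 := s 9)) = Some ?s"
    using tmp N by simp
  let ?B = "Member ;; Neq 12 20 ;; Assert ;; Clear 20 ;; Copy 20 10 ;; For 11 (\<lambda>a. Push 21 (a - 2))"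
  have 3: "run N (Empty 11 Skip ?B) ?s = Some (?s(20 := c, 21 := l, 1 := chk ok (s 1),
      11 := if label_of \<Sigma> (s 9) = [] then label_of \<Sigma> (s 9) else []))"
  proof (cases "label_of \<Sigma> (s 9) = []")
    case True
    then have "c = s 20" "l = s 21" "ok = parse_ok \<Sigma> (s 9)" using step by auto
    then show ?thesis using True by (auto simp: fun_eq_iff)
  next
    case False
    then have eq: "c = head_of \<Sigma> (s 9)" "l = rev (map (\<lambda>a. a - 2) (label_of \<Sigma> (s 9))) @ s 21"
      "ok \<longleftrightarrow> parse_ok \<Sigma> (s 9) \<and> rev (s 9) \<in> set (segs (s 6)) \<and> tail_of \<Sigma> (s 9) = s 20" using step by auto
    let ?s1 = "?s(1 := chk (rev (s 9) \<in> set (segs (s 6))) (?s 1))"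
    let ?s2 = "?s1(1 := chk (tail_of \<Sigma> (s 9) = s 20) (?s1 1))"
    let ?s3 = "?s2(20 := [], 20 := head_of \<Sigma> (s 9))"
    have "run N ?B ?s = Some (?s3(11 := [], 21 := rev (map (\<lambda>a. a - 2) (label_of \<Sigma> (s 9))) @ s 21))"
    proof (intro run_Seq)
      show "run N Member ?s = Some ?s1" using tmp N by (subst run_Member) auto
      show "run N (Neq 12 20) ?s1 = Some (?s1(5 := chk (tail_of \<Sigma> (s 9) = s 20) []))"
        using tmp N len by (subst run_Neq) auto
      show "run N Assert (?s1(5 := chk (tail_of \<Sigma> (s 9) = s 20) [])) = Some ?s2"
        using tmp by (auto simp: fun_eq_iff)
      show "run N (Clear 20) ?s2 = Some (?s2(20 := []))" using N by simp
      show "run N (Copy 20 10) (?s2(20 := [])) = Some ?s3" using tmp len by simp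
      show "run N (For 11 (\<lambda>a. Push 21 (a - 2))) ?s3 = Some (?s3(11 := [], 21 := rev (map (\<lambda>a. a - 2) (label_of \<Sigma> (s 9))) @ s 21))"
        using len by (subst run_labels) auto
    qed
    then show ?thesis using False eq by (auto simp: fun_eq_iff conj_ac)
  qed
  have 4: "run N (Clear 10 ;; Clear 11 ;; Clear 12 ;; Clear 22) (?s(20 := c, 21 := l, 1 := chk ok (s 1),
      11 := if label_of \<Sigma> (s 9) = [] then label_of \<Sigma> (s 9) else [])) =
    Some (s(9 := [], 20 := c, 21 := l, 1 := chk ok (s 1)))"
    using tmp len N by (simp, simp add: fun_eq_iff)
  show ?thesis
    unfolding Walk_Step_def by (intro run_Seq[OF 1] run_Seq[OF 2] run_Seq[OF 3] 4)
qed

definition walk :: "nat set \<Rightarrow> nat list list \<Rightarrow> nat list \<Rightarrow> nat list list \<Rightarrow> nat list \<times> nat list \<times> bool" where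
  "walk \<Sigma> X c ss = foldl (walk_step \<Sigma> X) (c, [], True) ss"

lemma walk_snoc: "walk \<Sigma> X c (ss @ [e]) = walk_step \<Sigma> X (walk \<Sigma> X c ss) e"
  by (simp add: walk_def)

lemma length_walk:
  assumes "\<forall>e\<in>set ss. length e \<le> N" "length c \<le> N"
  shows "length (fst (walk \<Sigma> X c ss)) \<le> N \<and> length (fst (snd (walk \<Sigma> X c ss))) \<le> length ss"
  using assms(1)
proof (induction ss rule: rev_induct)
  case (snoc e ss)
  obtain c' l ok where w: "walk \<Sigma> X c ss = (c', l, ok)" by (metis prod_cases3)
  show ?case
    using snoc length_parse[of \<Sigma> "rev e"] by (auto simp: walk_snoc w)
qed (simp add: walk_def assms(2))

lemma run_Walk:
  assumes tmp: "\<forall>r\<in>{2,3,4,5,9,10,11,12,17,18,19,21,22}. s r = []"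
    and N: "length (s 8) \<le> N" "length (s 6) \<le> N" "length (s 20) \<le> N" "1 \<le> N"
    and walk: "walk \<Sigma> (segs (s 6)) (s 20) (segs (s 8)) = (c, l, ok)"
  shows "run N (SegFor 8 9 (Walk_Step \<Sigma>)) s = Some (s(20 := c, 21 := l, 1 := chk ok (s 1),
    9 := rev (rest (s 8)), 8 := []))"
proof -
  let ?w = "walk \<Sigma> (segs (s 6)) (s 20)"
  let ?S = "\<lambda>ss. s(20 := fst (?w ss), 21 := fst (snd (?w ss)), 1 := chk (snd (snd (?w ss))) (s 1))"
  show ?thesis
  proof (rule run_SegFor[where S = ?S])
    fix ys zs assume ys: "s 8 = ys @ 0 # zs" and "length (rest ys) < length (s 8)"
    then have len: "length (rest ys) \<le> N" using N by simp
    let ?s = "(?S (segs ys))(9 := rev (rest ys), 8 := zs)"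
    obtain c' l' ok' where w: "?w (segs ys) = (c', l', ok')" by (metis prod_cases3)
    obtain c'' l'' ok'' where st: "walk_step \<Sigma> (segs (s 6)) (c', l', True) (rest ys) = (c'', l'', ok'')" by (metis prod_cases3)
    then have st': "?w (segs ys @ [rest ys]) = (c'', l'', ok' \<and> ok'')"
      by (auto simp: walk_snoc w split: if_splits)
    have "length ys \<le> N" using ys N by simp
    then have "\<forall>e\<in>set (segs ys). length e \<le> N" using length_segs le_trans by blast
    then have "length c' \<le> N" using length_walk[of "segs ys" N "s 20" \<Sigma> "segs (s 6)"] N(3) w by simp
    then have "run N (Walk_Step \<Sigma>) ?s = Some (?s(9 := [], 20 := c'', 21 := l'', 1 := chk ok'' (?s 1)))"
      using tmp N len st by (intro run_Walk_Step) (auto simp: w)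
    also have "\<dots> = Some ((?S (segs ys @ [rest ys]))(9 := [], 8 := zs))"
      unfolding st' by (simp add: w fun_eq_iff conj_commute)
    finally show "run N (Walk_Step \<Sigma>) ?s = Some ((?S (segs ys @ [rest ys]))(9 := [], 8 := zs))" .
  qed (use N walk tmp in \<open>auto simp: fun_eq_iff walk_def\<close>)
qed


section \<open>The verifier\<close>

text \<open>Register 23 becomes nonempty at the first 0. Malformed pairs are not rejected; later
  zeros decode to 0 by truncated subtraction. This is harmless, as \<open>class_NP\<close> queries
  only words \<open>pair_word x y\<close>.\<close>

definition Split :: com where
  "Split = For 0 (\<lambda>a. Empty 23 (if a = 0 then Push 23 0 else Push 24 (a - 1)) (Push 25 (a - 1))) ;;
     For 24 (Push 6) ;; For 25 (Push 7)"

definition fst_word :: "nat list \<Rightarrow> nat list" where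
  "fst_word z = map (\<lambda>a. a - 1) (takeWhile (\<lambda>a. a \<noteq> 0) z)"

definition snd_word :: "nat list \<Rightarrow> nat list" where
  "snd_word z = map (\<lambda>a. a - 1) (tl (dropWhile (\<lambda>a. a \<noteq> 0) z))"

lemma split_simps:
  "fst_word [] = []" "snd_word [] = []"
  "fst_word (z @ [a]) = (if 0 \<in> set z \<or> a = 0 then fst_word z else fst_word z @ [a - 1])"
  "snd_word (z @ [a]) = (if 0 \<in> set z then snd_word z @ [a - 1] else snd_word z)"
proof -
  show "fst_word (z @ [a]) = (if 0 \<in> set z \<or> a = 0 then fst_word z else fst_word z @ [a - 1])"
    by (induction z) (auto simp: fst_word_def)
  show "snd_word (z @ [a]) = (if 0 \<in> set z then snd_word z @ [a - 1] else snd_word z)"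
    by (induction z) (auto simp: snd_word_def)
qed (simp_all add: fst_word_def snd_word_def)

lemma pair_word_simps [simp]: "fst_word (pair_word x y) = x" "snd_word (pair_word x y) = y"
proof -
  have "takeWhile (\<lambda>a. a \<noteq> 0) (map Suc x @ 0 # ys) = map Suc x"
    "dropWhile (\<lambda>a. a \<noteq> 0) (map Suc x @ 0 # ys) = 0 # ys" for ys
    by (induction x) auto
  then show "fst_word (pair_word x y) = x" "snd_word (pair_word x y) = y"
    by (simp_all add: fst_word_def snd_word_def pair_word_def comp_def)
qed

lemma length_split: "length (fst_word z) \<le> length z" "length (snd_word z) \<le> length z"
  by (induction z rule: rev_induct) (auto simp: split_simps)

lemma run_Split:
  assumes "length z \<le> N"
  shows "run N Split (ini z) = Some ((\<lambda>_. [])(6 := fst_word z, 7 := snd_word z, 23 := chk (0 \<notin> set z) []))"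
proof -
  let ?S = "\<lambda>ys. (ini z)(23 := chk (0 \<notin> set ys) [], 24 := rev (fst_word ys), 25 := rev (snd_word ys))"
  let ?s = "(?S z)(0 := [])"
  have len: "length (fst_word z) \<le> N" "length (snd_word z) \<le> N" using length_split[of z] assms by auto
  have 1: "run N (For 0 (\<lambda>a. Empty 23 (if a = 0 then Push 23 0 else Push 24 (a - 1)) (Push 25 (a - 1)))) (ini z) = Some ?s"
    by (rule run_For[where S = ?S]) (use assms in \<open>auto simp: ini_def split_simps fun_eq_iff chk_def\<close>)
  have 2: "run N (For 24 (Push 6)) ?s = Some (?s(24 := [], 6 := fst_word z))"
    using run_move[of 24 6 ?s N] len by (simp add: ini_def)
  have 3: "run N (For 25 (Push 7)) (?s(24 := [], 6 := fst_word z)) = Some (?s(24 := [], 6 := fst_word z, 25 := [], 7 := snd_word z))"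
    using run_move[of 25 7 "?s(24 := [], 6 := fst_word z)" N] len by (simp add: ini_def)
  have "run N Split (ini z) = Some (?s(24 := [], 6 := fst_word z, 25 := [], 7 := snd_word z))"
    unfolding Split_def by (intro run_Seq[OF 1] run_Seq[OF 2] 3)
  then show ?thesis by (auto simp: ini_def fun_eq_iff)
qed

text \<open>
  Register 6 holds the instance and 7 the certificate. The segments of the certificate without
  label list the vertices in topological order, those with label are the arcs of the walk.
  Registers 14, 15, 16 hold \<open>n\<close>, \<open>s\<close>, \<open>t\<close>; register 20 is the current vertex of the walk and 21
  the reversed word of labels read so far.
\<close>

definition Verify :: "nat set \<Rightarrow> com" where
  "Verify \<Sigma> = Split ;; (Push 13 2 ;; Push 13 1 ;; Push 13 0 ;; Copy 8 6) ;; SegFor 8 9 (Instance \<Sigma>) ;;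
     (Empty 9 Skip (Fail 1) ;; Clear 9 ;; Empty 13 Skip (Fail 1) ;; Less 15 14 ;; Less 16 14 ;;
      Copy 20 15 ;; Copy 8 7) ;;
     SegFor 8 9 (Walk_Step \<Sigma>) ;; (Neq 20 16 ;; Assert) ;; For 21 (Push 26)"

text \<open>The verdict of \<open>Verify\<close> as a property of two words, so that soundness and
  completeness can be proved without programs.\<close>

definition accepts :: "nat set \<Rightarrow> nat list \<Rightarrow> nat list \<Rightarrow> bool" where
  "accepts \<Sigma> x y \<longleftrightarrow> rest x = [] \<and> 3 \<le> length (segs x) \<and> segs_ok \<Sigma> (segs y) (segs x) \<and>
     length (header \<Sigma> (segs x) 1) < length (header \<Sigma> (segs x) 0) \<and>
     length (header \<Sigma> (segs x) 2) < length (header \<Sigma> (segs x) 0) \<and>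
     snd (snd (walk \<Sigma> (segs x) (header \<Sigma> (segs x) 1) (segs y))) \<and>
     fst (walk \<Sigma> (segs x) (header \<Sigma> (segs x) 1) (segs y)) = header \<Sigma> (segs x) 2"

definition yield :: "nat set \<Rightarrow> nat list \<Rightarrow> nat list \<Rightarrow> nat list" where
  "yield \<Sigma> x y = rev (fst (snd (walk \<Sigma> (segs x) (header \<Sigma> (segs x) 1) (segs y))))"

lemma length_segs_le: "length (segs w) \<le> length w"
  by (induction w rule: rev_induct) auto

text \<open>A linear cap suffices: every loop runs over a part of the input, over at most one symbol
  per segment of the certificate, or over a single symbol.\<close>

lemma run_Verify:
  assumes "length z < N"
  shows "\<exists>s. run N (Verify \<Sigma>) (ini z) = Some s \<and>
    (s 1 = [] \<longleftrightarrow> accepts \<Sigma> (fst_word z) (snd_word z)) \<and> s 26 = yield \<Sigma> (fst_word z) (snd_word z)"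
proof -
  let ?x = "fst_word z" and ?y = "snd_word z"
  let ?h = "header \<Sigma> (segs ?x)"
  have len: "length ?x \<le> N" "length ?y \<le> N" "1 \<le> N" using length_split[of z] assms by auto
  have hdr: "length (?h i) \<le> N" for i
  proof (cases "i < length (segs ?x)")
    case True
    then have "length (segs ?x ! i) \<le> length ?x" by (intro length_segs) simp
    then show ?thesis using len(1) length_parse(1)[of \<Sigma> "rev (segs ?x ! i)"] by (simp add: header_def)
  qed (simp add: header_def)
  have rst: "length (rest ?x) \<le> N" using length_rest[of ?x] len(1) by simp
  obtain c l ok where w: "walk \<Sigma> (segs ?x) (?h 1) (segs ?y) = (c, l, ok)" by (metis prod_cases3)
  have "\<forall>e\<in>set (segs ?y). length e \<le> N" using length_segs len(2) le_trans by blast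
  then have cl: "length c \<le> N" "length l \<le> N"
    using length_walk[of "segs ?y" N "?h 1" \<Sigma> "segs ?x"] hdr[of 1] w length_segs_le[of ?y] len(2) by auto
  let ?s0 = "((\<lambda>_. []) :: state)(6 := ?x, 7 := ?y, 23 := chk (0 \<notin> set z) [])"
  let ?s1 = "?s0(8 := ?x)"
  let ?s2 = "?s1(13 := drop (length (segs ?x)) [0,1,2], 14 := ?h 0, 15 := ?h 1, 16 := ?h 2,
    1 := chk (segs_ok \<Sigma> (segs ?y) (segs ?x)) [], 9 := rev (rest ?x), 8 := [])"
  let ?C = "rest ?x = [] \<and> 3 \<le> length (segs ?x) \<and> segs_ok \<Sigma> (segs ?y) (segs ?x) \<and>
    length (?h 1) < length (?h 0) \<and> length (?h 2) < length (?h 0)"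
  let ?s3 = "?s2(1 := chk ?C [], 9 := [], 20 := ?h 1, 8 := ?y)"
  let ?s4 = "?s3(20 := c, 21 := l, 1 := chk ok (?s3 1), 9 := rev (rest ?y), 8 := [])"
  let ?s5 = "?s4(1 := chk (c = ?h 2) (?s4 1))"
  let ?s6 = "?s5(21 := [], 26 := rev l)"
  have 1: "run N Split (ini z) = Some ?s0" using assms by (intro run_Split) simp
  have 2: "run N (Push 13 2 ;; Push 13 1 ;; Push 13 0 ;; Copy 8 6) ?s0 = Some (?s1(13 := [0, 1, 2]))"
    using len by (simp, simp add: fun_eq_iff)
  have 3: "run N (SegFor 8 9 (Instance \<Sigma>)) (?s1(13 := [0, 1, 2])) = Some ?s2"
    by (subst run_Instances[where w = ?x]) (use len in auto)
  have 4: "run N (Empty 9 Skip (Fail 1) ;; Clear 9 ;; Empty 13 Skip (Fail 1) ;; Less 15 14 ;; Less 16 14 ;;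
      Copy 20 15 ;; Copy 8 7) ?s2 = Some ?s3"
  proof (intro run_Seq)
    let ?t1 = "?s2(1 := chk (rest ?x = []) (?s2 1))"
    let ?t2 = "?t1(9 := [])"
    let ?t3 = "?t2(1 := chk (3 \<le> length (segs ?x)) (?t2 1))"
    let ?t4 = "?t3(1 := chk (length (?h 1) < length (?h 0)) (?t3 1))"
    let ?t5 = "?t4(1 := chk (length (?h 2) < length (?h 0)) (?t4 1))"
    show "run N (Empty 9 Skip (Fail 1)) ?s2 = Some ?t1" by (auto simp: fun_eq_iff)
    show "run N (Clear 9) ?t1 = Some ?t2" using rst by simp
    show "run N (Empty 13 Skip (Fail 1)) ?t2 = Some ?t3" by (auto simp: fun_eq_iff)
    show "run N (Less 15 14) ?t3 = Some ?t4" using hdr by (subst run_Less) auto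
    show "run N (Less 16 14) ?t4 = Some ?t5" using hdr by (subst run_Less) auto
    show "run N (Copy 20 15) ?t5 = Some (?t5(20 := ?h 1))" using hdr by (subst run_Copy) auto
    show "run N (Copy 8 7) (?t5(20 := ?h 1)) = Some ?s3"
      using len by (subst run_Copy) (auto simp: fun_eq_iff conj_ac)
  qed
  have 5: "run N (SegFor 8 9 (Walk_Step \<Sigma>)) ?s3 = Some ?s4"
    by (subst run_Walk[where c = c and l = l and ok = ok]) (use len hdr w in auto)
  have 6: "run N (Neq 20 16 ;; Assert) ?s4 = Some ?s5"
    using cl hdr by (simp, simp add: fun_eq_iff)
  have 7: "run N (For 21 (Push 26)) ?s5 = Some ?s6"
    using cl by (subst run_move) auto
  have "run N (Verify \<Sigma>) (ini z) = Some ?s6"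
    unfolding Verify_def
    by (intro run_Seq[OF 1] run_Seq[OF 2] run_Seq[OF 3] run_Seq[OF 4] run_Seq[OF 5] run_Seq[OF 6] 7)
  then show ?thesis
    unfolding accepts_def yield_def w by (intro exI[of _ ?s6]) auto
qed

lemma wf_Verify:
  assumes "3 \<le> K"
  shows "wf_com (Suc 26) K (Verify \<Sigma>)"
  using assms
  by (auto simp: Verify_def Split_def Instance_def Number_def Arc_def Walk_Step_def
      intro!: wf_SegFor wf_Parse wf_Precedes)

section \<open>Soundness and completeness of the verifier\<close>

lemma twalk_snoc: "twalk E s (ls @ [a]) t \<longleftrightarrow> (\<exists>u. twalk E s ls u \<and> (u, a, t) \<in> E)"
  by (induction ls arbitrary: s) auto

text \<open>The verdict is never set again once cleared, so a final \<open>True\<close> means that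
  every step succeeded.\<close>

lemma walk_sound:
  assumes "\<And>u a v. edge_seg (u, a, v) \<in> set X \<Longrightarrow> (u, a, v) \<in> E"
  shows "walk \<Sigma> X (unary s) ss = (c, l, True) \<Longrightarrow> \<exists>t. c = unary t \<and> twalk E s (rev l) t"
proof (induction ss arbitrary: c l rule: rev_induct)
  case Nil
  then show ?case by (auto simp: walk_def)
next
  case (snoc e ss)
  obtain c' l' ok where w: "walk \<Sigma> X (unary s) ss = (c', l', ok)" by (metis prod_cases3)
  have ok: "ok" "parse_ok \<Sigma> (rev e)" using snoc.prems by (auto simp: walk_snoc w split: if_splits)
  obtain t where t: "c' = unary t" "twalk E s (rev l') t" using snoc.IH[of c' l'] w ok(1) by auto
  show ?case
  proof (cases "label_of \<Sigma> (rev e) = []")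
    case True
    then show ?thesis using snoc.prems t by (auto simp: walk_snoc w)
  next
    case False
    then obtain u a v where e: "e = edge_seg (u, a, v)" "head_of \<Sigma> (rev e) = unary v"
      "tail_of \<Sigma> (rev e) = unary u" "label_of \<Sigma> (rev e) = [a + 2]"
      using parse_ok_edge[OF ok(2)] by metis
    have "e \<in> set X" "u = t" "c = unary v" "l = a # l'"
      using snoc.prems t e by (auto simp: walk_snoc w split: if_splits)
    moreover have "(u, a, v) \<in> E" using assms e(1) \<open>e \<in> set X\<close> by simp
    ultimately show ?thesis using t by (auto simp: twalk_snoc)
  qed
qed

text \<open>All knowledge about \<open>x\<close> comes from its segments: three numbers, then arcs.
  With an empty rest, \<open>enc_segs_rest\<close> shows that \<open>x\<close> itself is the code.
  Acyclicity follows from the order alone, whatever segments \<open>y\<close> has.\<close>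

lemma accepts_sound:
  assumes "accepts \<Sigma> x y"
  shows "\<exists>n s t es. x = instance_code n s t es \<and> valid_instance \<Sigma> n s t es \<and>
    twalk (set es) s (yield \<Sigma> x y) t"
proof -
  let ?X = "segs x" and ?Y = "segs y"
  have len: "3 \<le> length ?X" and ok: "segs_ok \<Sigma> ?Y ?X" and rst: "rest x = []"
    using assms by (simp_all add: accepts_def)
  have num: "\<exists>k. ?X ! i = unary k \<and> header \<Sigma> ?X i = unary k" if "i < 3" for i
  proof -
    have "parse_ok \<Sigma> (rev (?X ! i))" "label_of \<Sigma> (rev (?X ! i)) = []"
      using ok len that by (auto simp: segs_ok_def seg_ok_def)
    then show ?thesis using parse_ok_unary[of \<Sigma> "?X ! i"] len that by (metis header_def less_le_trans)
  qed
  obtain n where n: "?X ! 0 = unary n" "header \<Sigma> ?X 0 = unary n" using num[of 0] by auto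
  obtain s where s: "?X ! 1 = unary s" "header \<Sigma> ?X 1 = unary s" using num[of 1] by auto
  obtain t where t: "?X ! 2 = unary t" "header \<Sigma> ?X 2 = unary t" using num[of 2] by auto
  have arc: "\<exists>u a v. e = edge_seg (u, a, v) \<and> a \<in> \<Sigma> \<and> u < n \<and> v < n \<and> precedes ?Y (unary u) (unary v)"
    if "e \<in> set (drop 3 ?X)" for e
  proof -
    obtain j where "j < length (drop 3 ?X)" "e = drop 3 ?X ! j"
      using \<open>e \<in> set (drop 3 ?X)\<close> by (metis in_set_conv_nth)
    then obtain i where i: "3 \<le> i" "i < length ?X" "e = ?X ! i"
      using len by (metis add.commute le_add1 length_drop less_diff_conv nth_drop)
    then have e: "seg_ok \<Sigma> ?Y (unary n) i e" using ok n(2) by (auto simp: segs_ok_def)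
    then have "parse_ok \<Sigma> (rev e)" "label_of \<Sigma> (rev e) \<noteq> []" using i by (auto simp: seg_ok_def)
    then obtain u a v where "a \<in> \<Sigma>" "e = edge_seg (u, a, v)" "head_of \<Sigma> (rev e) = unary v"
      "tail_of \<Sigma> (rev e) = unary u" by (rule parse_ok_edge)
    then show ?thesis using e i by (auto simp: seg_ok_def)
  qed
  then have "\<exists>es. drop 3 ?X = map edge_seg es" unfolding ex_map_conv by blast
  then obtain es where es: "drop 3 ?X = map edge_seg es" by blast
  have X: "?X = [unary n, unary s, unary t] @ map edge_seg es"
  proof -
    have "?X = take 3 ?X @ drop 3 ?X" by simp
    moreover have "take 3 ?X = [?X ! 0, ?X ! 1, ?X ! 2]"
      by (rule nth_equalityI) (use len in \<open>auto simp: less_Suc_eq numeral_3_eq_3 numeral_2_eq_2\<close>)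
    ultimately show ?thesis using n s t es by metis
  qed
  have x: "x = instance_code n s t es"
    using enc_segs_rest[of x] rst unfolding X instance_code_enc by simp
  have arcs: "a \<in> \<Sigma> \<and> u < n \<and> v < n \<and> precedes ?Y (unary u) (unary v)" if "(u, a, v) \<in> set es" for u a v
  proof -
    have "edge_seg (u, a, v) \<in> set (drop 3 ?X)" using that es by simp
    from arc[OF this] show ?thesis by auto
  qed
  have "acyclic {(u, v). \<exists>a. (u, a, v) \<in> set es}"
    by (rule acyclic_if_precedes[of _ ?Y]) (use arcs in blast)
  then have "valid_instance \<Sigma> n s t es"
    using assms n s t arcs by (auto simp: valid_instance_def accepts_def)
  moreover have "twalk (set es) s (yield \<Sigma> x y) t"
  proof -
    obtain c l where w: "walk \<Sigma> ?X (unary s) ?Y = (c, l, True)" "c = unary t"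
      using assms s t unfolding accepts_def by (metis prod.collapse)
    have "(u, a, v) \<in> set es" if "edge_seg (u, a, v) \<in> set ?X" for u a v
      using that unfolding X by auto
    from walk_sound[OF this w(1)] w(2) show ?thesis
      unfolding yield_def s(2) w(1) by auto
  qed
  ultimately show ?thesis using x by blast
qed

lemma walk_unary:
  "foldl (walk_step \<Sigma> X) (c, l, True) (map unary xs) = (c, l, True)"
  by (induction xs) (auto simp: parse_unary)

lemma walk_complete:
  assumes "\<And>u a v. (u, a, v) \<in> E \<Longrightarrow> a \<in> \<Sigma> \<and> edge_seg (u, a, v) \<in> set X"
  shows "twalk E s ls t \<Longrightarrow> \<exists>p. set p \<subseteq> E \<and> length p = length ls \<and>
    foldl (walk_step \<Sigma> X) (unary s, l, True) (map edge_seg p) = (unary t, rev ls @ l, True)"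
proof (induction ls arbitrary: s l)
  case (Cons a ls)
  then obtain v where v: "(s, a, v) \<in> E" "twalk E v ls t" by auto
  from Cons.IH[OF v(2), of "a # l"] obtain p where
    p: "set p \<subseteq> E" "length p = length ls"
      "foldl (walk_step \<Sigma> X) (unary v, a # l, True) (map edge_seg p) = (unary t, rev ls @ a # l, True)"
    by blast
  show ?case
    using p v assms[OF v(1)]
    by (intro exI[of _ "(s, a, v) # p"]) (simp add: parse_edge_seg)
qed auto

lemma twalk_length:
  fixes f :: "nat \<Rightarrow> nat"
  assumes "\<And>u a v. (u, a, v) \<in> E \<Longrightarrow> f u < f v"
  shows "twalk E s ls t \<Longrightarrow> f s + length ls \<le> f t"
proof (induction ls arbitrary: s)
  case (Cons a ls)
  then obtain v where "(s, a, v) \<in> E" "twalk E v ls t" by auto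
  then show ?case using Cons.IH[of v] assms by fastforce
qed auto

lemma length_enc_le:
  "\<forall>e\<in>set ss. length e \<le> M \<Longrightarrow> length (enc ss) \<le> length ss * (M + 1)"
  by (induction ss) auto

lemma set_enc: "set (enc ss) \<subseteq> insert 0 (\<Union> (set ` set ss))"
  by (induction ss) auto

lemma set_edge_seg: "set (edge_seg (u, a, v)) \<subseteq> {1, a + 2}"
  by (auto simp: edge_seg_def unary_def)

lemma length_edge_seg: "length (edge_seg (u, a, v)) = u + v + 1"
  by (simp add: edge_seg_def)

text \<open>The certificate has at most \<open>2 * n\<close> segments, \<open>n\<close> vertices and
  at most \<open>n\<close> arcs of the walk. Each has length at most \<open>2 * n\<close> and is
  followed by one separator.\<close>

lemma accepts_complete:
  assumes val: "valid_instance \<Sigma> n s t es" and walk: "twalk (set es) s ls t"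
    and \<Sigma>: "\<Sigma> \<subseteq> {..<m}"
  defines "x \<equiv> instance_code n s t es"
  shows "\<exists>y. accepts \<Sigma> x y \<and> yield \<Sigma> x y = ls \<and> length y \<le> 2 * n * (2 * n + 1) \<and>
    set x \<subseteq> {..<m + 2} \<and> set y \<subseteq> {..<m + 2}"
proof -
  have arcs: "u < n \<and> v < n \<and> a \<in> \<Sigma>" if "(u, a, v) \<in> set es" for u a v
    using val that by (auto simp: valid_instance_def)
  let ?r = "{(u, v). \<exists>a. (u, a, v) \<in> set es}"
  have "acyclic ?r" "?r \<subseteq> {..<n} \<times> {..<n}" using val arcs by (auto simp: valid_instance_def)
  then obtain xs where xs: "set xs = {..<n}" "length xs = n"
    and prec: "\<And>u v. (u, v) \<in> ?r \<Longrightarrow> precedes (map unary xs) (unary u) (unary v)"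
    using acyclic_obtain_order by blast
  let ?X = "[unary n, unary s, unary t] @ map edge_seg es"
  have X: "segs x = ?X" "rest x = []" unfolding x_def by (rule segs_instance_code)+
  obtain p where p: "set p \<subseteq> set es" "length p = length ls"
      "foldl (walk_step \<Sigma> ?X) (unary s, [], True) (map edge_seg p) = (unary t, rev ls, True)"
    using walk_complete[OF _ walk, of \<Sigma> ?X "[]"] arcs by auto
  define Y where "Y = map unary xs @ map edge_seg p"
  \<comment> \<open>Ranks are positions in a list of length \<open>n\<close> and increase along
    every arc, so no walk is longer than \<open>n\<close>.\<close>
  have "length ls \<le> n"
  proof -
    let ?f = "\<lambda>u. length (takeWhile (\<lambda>e. rev e \<noteq> unary u) (map unary xs))"
    have "?f s + length ls \<le> ?f t"
      by (rule twalk_length[OF _ walk]) (intro precedes_rank prec, blast)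
    also have "?f t \<le> length (map unary xs)" by (rule length_takeWhile_le)
    finally show ?thesis using xs(2) by simp
  qed
  then have "length Y \<le> 2 * n" using xs p by (simp add: Y_def)
  moreover have "\<forall>e\<in>set Y. length e \<le> 2 * n"
    using xs p(1) arcs by (fastforce simp: Y_def length_edge_seg)
  then have "length (enc Y) \<le> length Y * (2 * n + 1)" by (rule length_enc_le)
  ultimately have len: "length (enc Y) \<le> 2 * n * (2 * n + 1)"
    by (meson le_trans mult_le_mono1)
  have segsY: "segs (enc Y) = Y"
  proof -
    have "\<forall>e\<in>set Y. 0 \<notin> set e"
      using zero_notin_unary zero_notin_edge_seg by (auto simp: Y_def)
    from segs_enc[OF this] show ?thesis by simp
  qed
  have w: "walk \<Sigma> ?X (unary s) Y = (unary t, rev ls, True)"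
    using p(3) by (simp add: walk_def Y_def walk_unary)
  have hdr: "header \<Sigma> ?X 0 = unary n" "header \<Sigma> ?X 1 = unary s" "header \<Sigma> ?X 2 = unary t"
    by (simp_all add: header_def parse_unary)
  have "segs_ok \<Sigma> Y ?X"
    unfolding segs_ok_def
  proof (intro allI impI)
    fix i assume i: "i < length ?X"
    show "seg_ok \<Sigma> Y (header \<Sigma> ?X 0) i (?X ! i)"
    proof (cases "i < 3")
      case True
      then have "i = 0 \<or> i = 1 \<or> i = 2" by linarith
      then show ?thesis by (auto simp: seg_ok_def parse_unary)
    next
      case False
      then have "?X ! i = map edge_seg es ! (i - 3)" by (simp add: nth_append numeral_3_eq_3)
      moreover have "i - 3 < length es" using i False by simp
      moreover obtain u a v where "es ! (i - 3) = (u, a, v)" by (metis prod_cases3)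
      ultimately have e: "?X ! i = edge_seg (u, a, v)" "(u, a, v) \<in> set es"
        by (auto simp: in_set_conv_nth)
      then have "precedes Y (unary u) (unary v)" unfolding Y_def by (intro precedes_append prec) blast
      then show ?thesis
        using arcs[OF e(2)] False unfolding e(1) hdr by (simp add: seg_ok_def parse_edge_seg)
    qed
  qed
  then have "accepts \<Sigma> x (enc Y)"
    using val unfolding accepts_def X segsY hdr w by (simp add: valid_instance_def)
  moreover have "yield \<Sigma> x (enc Y) = ls" unfolding yield_def X segsY hdr w by simp
  moreover have sym: "set (edge_seg e) \<subseteq> {..<m + 2}" if "e \<in> set es" for e
  proof -
    obtain u a v where e: "e = (u, a, v)" by (metis prod_cases3)
    then have "a < m" using arcs \<Sigma> that by blast
    then show ?thesis using set_edge_seg[of u a v] by (auto simp: e)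
  qed
  then have "set x \<subseteq> {..<m + 2}" "set (enc Y) \<subseteq> {..<m + 2}"
  proof -
    show "set x \<subseteq> {..<m + 2}"
      unfolding x_def instance_code_enc
      by (rule order_trans[OF set_enc]) (use sym set_unary in fastforce)
    show "set (enc Y) \<subseteq> {..<m + 2}"
      unfolding Y_def
      by (rule order_trans[OF set_enc]) (use sym p(1) set_unary in fastforce)
  qed
  ultimately show ?thesis using len by blast
qed

lemma DAGREACH_lang_in_NP:
  assumes "L \<in> class_P" "finite \<Sigma>" "L \<subseteq> lists \<Sigma>"
  shows "DAGREACH_lang \<Sigma> L \<in> class_NP"
proof -
  obtain m where m: "\<Sigma> \<subseteq> {..<m}" using assms(2) finite_nat_iff_bounded by blast
  \<comment> \<open>Symbols of instance and certificate are below \<open>m + 2\<close>, and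
    \<open>pair_word\<close> shifts them by one.\<close>
  define R where "R = {z \<in> lists {..<m + 3}. accepts \<Sigma> (fst_word z) (snd_word z) \<and>
    yield \<Sigma> (fst_word z) (snd_word z) \<in> L}"
  have "R \<in> class_P"
  proof (rule class_P_preimage[where \<Gamma> = "{..<m + 3}" and c = "Verify \<Sigma>" and out = 26 and K = "m + 3" and q = "[:1, 1:]"])
    show "wf_com (Suc 26) (m + 3) (Verify \<Sigma>)" by (rule wf_Verify) simp
    fix z assume z: "z \<in> lists {..<m + 3}"
    obtain s where "run (poly [:1, 1:] (length z)) (Verify \<Sigma>) (ini z) = Some s"
      "s 1 = [] \<longleftrightarrow> accepts \<Sigma> (fst_word z) (snd_word z)" "s 26 = yield \<Sigma> (fst_word z) (snd_word z)"
      using run_Verify[of z "poly [:1, 1:] (length z)" \<Sigma>] by auto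
    then show "\<exists>s. run (poly [:1, 1:] (length z)) (Verify \<Sigma>) (ini z) = Some s \<and> (z \<in> R \<longleftrightarrow> s 1 = [] \<and> s 26 \<in> L)"
      using z by (intro exI[of _ s]) (simp add: R_def)
  qed (use assms in \<open>auto simp: R_def\<close>)
  \<comment> \<open>The bound of \<open>accepts_complete\<close> with \<open>n\<close> replaced by
    the length of \<open>x\<close>, which is at least \<open>n\<close> because \<open>n\<close> is
    written in unary.\<close>
  define p :: "nat poly" where "p = [:0, 2:] * [:1, 2:]"
  have "x \<in> DAGREACH_lang \<Sigma> L \<longleftrightarrow> (\<exists>y. length y \<le> poly p (length x) \<and> pair_word x y \<in> R)" for x
  proof
    assume "x \<in> DAGREACH_lang \<Sigma> L"
    then obtain n s t es ls where x: "x = instance_code n s t es" and val: "valid_instance \<Sigma> n s t es"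
      and ls: "ls \<in> L" "twalk (set es) s ls t"
      unfolding DAGREACH_lang_iff by blast
    obtain y where y: "accepts \<Sigma> x y" "yield \<Sigma> x y = ls" "length y \<le> 2 * n * (2 * n + 1)"
      "set x \<subseteq> {..<m + 2}" "set y \<subseteq> {..<m + 2}"
      using accepts_complete[OF val ls(2) m] x by blast
    have "n \<le> length x" by (simp add: x instance_code_def)
    then have "2 * n * (2 * n + 1) \<le> 2 * length x * (2 * length x + 1)" by (intro mult_le_mono) auto
    then have "length y \<le> poly p (length x)" using y(3) by (simp add: p_def algebra_simps)
    moreover have "pair_word x y \<in> R"
      using y ls(1) by (auto simp: R_def pair_word_def[of x y, symmetric]) (auto simp: pair_word_def)
    ultimately show "\<exists>y. length y \<le> poly p (length x) \<and> pair_word x y \<in> R" by blast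
  next
    assume "\<exists>y. length y \<le> poly p (length x) \<and> pair_word x y \<in> R"
    then obtain y where "accepts \<Sigma> x y" "yield \<Sigma> x y \<in> L" by (auto simp: R_def)
    then show "x \<in> DAGREACH_lang \<Sigma> L"
      unfolding DAGREACH_lang_iff using accepts_sound by blast
  qed
  then have "DAGREACH_lang \<Sigma> L = {x. \<exists>y. length y \<le> poly p (length x) \<and> pair_word x y \<in> R}" by blast
  then show ?thesis using \<open>R \<in> class_P\<close> unfolding class_NP_def by blast
qed


theorem theorem10:
  shows "class_P \<noteq> DAGR class_P \<longleftrightarrow> class_P \<noteq> class_NP"
proof -
  \<comment> \<open>Since \<open>DAGR(P)\<close> lies in \<open>P\<close> and \<open>P\<close> in
    \<open>NP\<close> unconditionally, the two equalities amount to the reverse inclusions.\<close>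
  have "class_P \<subseteq> DAGR class_P" if "class_NP \<subseteq> class_P"
  proof
    fix L assume L: "L \<in> class_P"
    then obtain \<Sigma> where "finite \<Sigma>" "L \<subseteq> lists \<Sigma>" by (auto simp: class_P_def)
    then show "L \<in> DAGR class_P"
      using DAGREACH_lang_in_NP[OF L, of \<Sigma>] that by (auto simp: DAGR_def)
  qed
  then show ?thesis
    using class_P_subset_NP DAGR_P_subset_P NP_subset_P by blast
qed

end
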